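(* Let $A,C\in\mathbb C_{\rm H}^{m}$ and $B\in\mathbb C^{m\times m}$ be given, and assume that $BXB^*=C$ has a Hermitian solution. Let $$M_1=\begin{bmatrix} A & B \\ B^* & 0 \end{bmatrix},\quad M_2=\begin{bmatrix} BA & B^2 \\ B^* & 0 \end{bmatrix},\quad M_3=BAB^*-BC-CB^*,\quad {\cal S}=\{X\in\mathbb C_{\rm H}^{m} : BXB^*=C\}.$$ Then the following hold. (a) $$\max_{X\in{\cal S}}r(A-BX-XB^* )=\min\{\,m+r[\,B^2,\ C-BA\,]-r(B),\ \ r(M_1),\ \ 2m-2r(B)+r(M_3)\,\}.$$ (b) $$\min_{X\in{\cal S}}r(A-BX-XB^* )=\max\{s_1,s_2,s_3,s_4\},$$ where $$s_1=2r[\,B^2,\ C-BA\,]+r(M_1)-2r(M_2),$$ $$s_2=2r[\,B^2,\ C-BA\,]+r(M_3)-2r[\,B^2,\ BAB^*-CB^*\,],$$ $$s_3=2r[\,B^2,\ C-BA\,]+i_+(M_1)-r(M_2)+i_-(M_3)-r[\,B^2,\ CB^*-BAB^*\,],$$ $$s_4=2r[\,B^2,\ C-BA\,]+i_-(M_1)-r(M_2)+i_+(M_3)-r[\,B^2,\ CB^*-BAB^*\,].$$ (c) For each choice of sign, $$\max_{X\in{\cal S}}i_{\pm}(A-BX-XB^* )=\min\{\,i_{\pm}(M_1),\ \ m-r(B)+i_{\pm}(M_3)\,\}.$$ (d) For each choice of sign, $$\min_{X\in{\cal S}}i_{\pm}(A-BX-XB^* )=r[\,B^2,\ C-BA\,]+\max\{\,i_{\pm}(M_1)-r(M_2),\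 \ i_{\pm}(M_3)-r[\,B^2,\ CB^*-BAB^*\,]\,\}.$$
   Context: $\mathbb C_{\rm H}^{m}$ is the set of $m\times m$ complex Hermitian matrices; $r(\cdot)$ is rank; ${}^*$ is conjugate transpose; $i_+(\cdot)$ and $i_-(\cdot)$ are the numbers of positive and negative eigenvalues (with multiplicity) of a Hermitian matrix; $[\,P,\ Q\,]$ is the row block matrix. In each formula with $\pm$ the upper signs, respectively the lower signs, are taken throughout. *)

theory Defs
  imports
    "Jordan_Normal_Form.DL_Rank"
    "Jordan_Normal_Form.Char_Poly"
    "Jordan_Normal_Form.Schur_Decomposition"
begin

abbreviation rank_mat :: "complex mat \<Rightarrow> nat" where
  "rank_mat M \<equiv> vec_space.rank (dim_row M) M"

definition herm_mats :: "nat \<Rightarrow> complex mat set" where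
  "herm_mats m = {X \<in> carrier_mat m m. mat_adjoint X = X}"

(* The column analogue of append_rows: the row block matrix [P, Q]. *)
definition append_cols :: "complex mat \<Rightarrow> complex mat \<Rightarrow> complex mat" (infixr \<open>@\<^sub>c\<close> 65) where
  "P @\<^sub>c Q = four_block_mat P Q (0\<^sub>m 0 (dim_col P)) (0\<^sub>m 0 (dim_col Q))"

(* Eigenvalues are counted with algebraic multiplicity, i.e. as roots of the characteristic
   polynomial. Both counts are meant for Hermitian matrices, all of whose eigenvalues are real. *)
definition i_plus :: "complex mat \<Rightarrow> nat" where
  "i_plus M = (\<Sum>x\<in>{x :: real. x > 0 \<and> eigenvalue M (complex_of_real x)}.
     order (complex_of_real x) (char_poly M))"

definition i_minus :: "complex mat \<Rightarrow> nat" where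
  "i_minus M = (\<Sum>x\<in>{x :: real. x < 0 \<and> eigenvalue M (complex_of_real x)}.
     order (complex_of_real x) (char_poly M))"

end

(* Write L for the adjoint of B, and fix a Hermitian solution X0. In terms of Hermitian forms, the
   matrices A - B X - X B^* with X a Hermitian solution are exactly h + theta + theta^*, where
   h = A - B X0 - X0 B^* and theta runs through the sesquilinear forms that vanish when their left
   argument lies in K1 = ker L or their right argument lies in K2 = range L. So the forms obtained are
   the Hermitian forms on C^m with prescribed restrictions to K1, to K2 and to K0 x C^m, where
   K0 is the intersection of K1 and K2.

   The inertia of such a form is that of its restriction to the orthogonal complement N of K0, up to a
   constant (pos_perp). On N the intersection of N1 = K1 Int N and N2 = K2 Int N lies in the radical, and
   the problem is a completion problem for a block matrix with two diagonal blocks given and all else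
   free. Diagonalising the two blocks and pairing basis vectors of N1 with basis vectors of N2 (equal
   signs for the minima, nonpositive vectors for the maximal positive index, null vectors for the
   maximal rank) attains the bounds that hold for dimension reasons. The ranks and inertias in the
   theorem are then expressed through K0, K1, K2 and h. *)
theory Submission
  imports Defs "HOL-Library.Function_Algebras"
begin

section \<open>Subspaces of finite dimension\<close>

text \<open>Write a solution as X = X0 + Y. Since Y(L x, L y) = 0 for all x and y, the form theta(x,
  y) = - Y(L x, y) vanishes for x in K1 and for y in K2, and the term X B^* contributes its adjoint.
  Conversely a form with these two properties factors through a linear section of L. The
  restrictions to K1 and K2 would be independent data but for K0, on which theta and its adjoint
  both vanish. Vectors of K0 orthogonal to all of C^m (dimension d) lie in the radical of every form
  of the family; those orthogonal only to K1 or K2 (dimensions d1, d2) raise the lower bounds by d1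
  - d and d2 - d. These defects are what the ranks of [B^2, C - BA], M2 and [B^2, BAB^* - CB^*]
  measure. A single theta minimises the positive and the negative index at once, so the minimal rank
  is a sum of two maxima; expanded, it has the four terms s1 to s4. The maximal indices, in
  contrast, need not be attained by the same X, so the maximal rank needs a construction of its own,
  which minimises the nullity.\<close>

lemma int_labels:
  assumes "finite A"
  obtains g :: "'a \<Rightarrow> int" where "bij_betw g A {1..int (card A)}"
  using finite_same_card_bij[OF assms, of "{1..int (card A)}"] by auto

locale complex_vs = vector_space scale
  for scale :: "complex \<Rightarrow> 'v::ab_group_add \<Rightarrow> 'v"  (infixr \<open>*s\<close> 75)
begin

text \<open>Vectors will be functions from nat to complex, an infinite-dimensional type, so finite
  dimension has to be a property of a subspace and not of the type.\<close>

definition fd :: "'v set \<Rightarrow> bool" where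
  "fd K \<longleftrightarrow> subspace K \<and> (\<exists>T. finite T \<and> K \<subseteq> span T)"

lemma fd_subspace: "fd K \<Longrightarrow> subspace K"
  by (simp add: fd_def)

lemma fd_mono: "fd V \<Longrightarrow> subspace K \<Longrightarrow> K \<subseteq> V \<Longrightarrow> fd K"
  by (auto simp: fd_def)

lemma fd_span: "finite T \<Longrightarrow> fd (span T)"
  by (auto simp: fd_def)

lemma fd_finite_independent:
  assumes "fd V" "B \<subseteq> V" "independent B"
  shows "finite B"
proof -
  obtain T where "finite T" "V \<subseteq> span T" using assms by (auto simp: fd_def)
  then show ?thesis using independent_span_bound[of T B] assms by auto
qed

lemma basis_extend:
  assumes "fd V" "B \<subseteq> V" "independent B"
  obtains C where "finite C" "B \<inter> C = {}" "independent (B \<union> C)" "span (B \<union> C) = V" "C \<subseteq> V"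
    "dim V = card B + card C"
proof -
  obtain D where D: "B \<subseteq> D" "D \<subseteq> V" "independent D" "V \<subseteq> span D"
    using maximal_independent_subset_extend[OF assms(2,3)] by blast
  have fD: "finite D" using fd_finite_independent assms(1) D by blast
  have sp: "span D = V" using D assms(1) fd_subspace span_subspace by blast
  have dm: "dim V = card D" using D sp by (metis basis_card_eq_dim)
  show ?thesis
    by (rule that[of "D - B"])
      (use D fD sp dm in \<open>auto simp: Un_absorb1 card_Diff_subset finite_subset card_mono\<close>)
qed

lemma fd_basis:
  assumes "fd V"
  obtains B where "finite B" "independent B" "span B = V" "dim V = card B" "B \<subseteq> V"
  using basis_extend[OF assms, of "{}"] independent_empty by auto

lemma dim_mono: "fd V \<Longrightarrow> K \<subseteq> V \<Longrightarrow> dim K \<le> dim V"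
  by (metis fd_basis dim_le_card)

lemma dim_subspace_eq:
  assumes "fd V" "subspace K" "K \<subseteq> V" "dim V \<le> dim K"
  shows "K = V"
proof -
  obtain B where B: "finite B" "independent B" "span B = K" "dim K = card B" "B \<subseteq> K"
    by (rule fd_basis[OF fd_mono[OF assms(1-3)]])
  have BV: "B \<subseteq> V" using B(5) assms(3) by blast
  obtain C where C: "finite C" "B \<inter> C = {}" "independent (B \<union> C)" "span (B \<union> C) = V" "C \<subseteq> V"
    "dim V = card B + card C"
    by (rule basis_extend[OF assms(1) BV B(2)])
  show ?thesis using assms(4) B C by auto
qed

text \<open>By uniqueness of coordinates with respect to \<open>B \<union> C\<close>, a common
  vector has coordinates supported in \<open>B\<close> and also in \<open>C\<close>, hence
  nowhere.\<close>

lemma span_Int_span_diff: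
  assumes "independent (B \<union> C)" "B \<inter> C = {}"
  shows "span B \<inter> span C = {0}"
proof -
  have "x = 0" if "x \<in> span B" "x \<in> span C" for x
  proof -
    have B: "independent B" and C: "independent C"
      using assms(1) independent_mono by blast+
    have 1: "representation (B \<union> C) x = representation B x"
      using representation_extend[OF assms(1) that(1)] by auto
    have 2: "representation (B \<union> C) x = representation C x"
      using representation_extend[OF assms(1) that(2)] by auto
    have "representation B x b = 0" for b
      using 1 2 representation_ne_zero[of B x b] representation_ne_zero[of C x b] assms(2) by fastforce
    then show ?thesis using sum_nonzero_representation_eq[OF B that(1)] by simp
  qed
  then show ?thesis using span_zero by blast
qed

lemma independent_UnI:
  assumes "independent B" "independent C" "span B \<inter> span C \<subseteq> {0}" "finite B" "finite C"
  shows "independent (B \<union> C)" "B \<inter> C = {}"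
proof -
  show dis: "B \<inter> C = {}"
  proof -
    have "0 \<notin> B" using assms(1) dependent_zero by blast
    then show ?thesis using assms(3) span_base by blast
  qed
  show "independent (B \<union> C)"
  proof (rule independent_if_scalars_zero)
    show "finite (B \<union> C)" using assms by simp
    fix f x assume s: "(\<Sum>x\<in>B \<union> C. f x *s x) = 0" and x: "x \<in> B \<union> C"
    have e: "(\<Sum>x\<in>B. f x *s x) + (\<Sum>x\<in>C. f x *s x) = 0"
      using s dis assms by (simp add: sum.union_disjoint)
    have 1: "(\<Sum>x\<in>B. f x *s x) \<in> span B" by (simp add: span_base span_scale span_sum)
    have 2: "(\<Sum>x\<in>C. f x *s x) \<in> span C" by (simp add: span_base span_scale span_sum)
    have "(\<Sum>x\<in>B. f x *s x) = - (\<Sum>x\<in>C. f x *s x)" using e by (simp add: eq_neg_iff_add_eq_0)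
    then have "(\<Sum>x\<in>B. f x *s x) = 0" using 1 2 span_neg assms(3) by fastforce
    moreover from this have "(\<Sum>x\<in>C. f x *s x) = 0" using e by simp
    ultimately show "f x = 0" using x independentD[OF assms(1,4)] independentD[OF assms(2,5)] by blast
  qed
qed

text \<open>A basis of the intersection is extended separately inside \<open>K\<close> and inside
  \<open>L\<close>; a relation between the two extensions would give a vector of the intersection,
  so there is none.\<close>

lemma dim_span_Un_Int:
  assumes "fd K" "fd L"
  shows "dim (span (K \<union> L)) + dim (K \<inter> L) = dim K + dim L"
proof -
  have sI: "subspace (K \<inter> L)" using assms fd_subspace subspace_inter by blast
  then have fI: "fd (K \<inter> L)" using fd_mono[OF assms(1)] by blast
  obtain D where D: "finite D" "independent D" "span D = K \<inter> L" "dim (K \<inter> L) = card D" "D \<subseteq> K \<inter> L"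
    by (rule fd_basis[OF fI])
  have DK: "D \<subseteq> K" and DL: "D \<subseteq> L" using D by auto
  obtain B where B: "finite B" "D \<inter> B = {}" "independent (D \<union> B)" "span (D \<union> B) = K" "B \<subseteq> K"
    "dim K = card D + card B"
    by (rule basis_extend[OF assms(1) DK D(2)])
  obtain C where C: "finite C" "D \<inter> C = {}" "independent (D \<union> C)" "span (D \<union> C) = L" "C \<subseteq> L"
    "dim L = card D + card C"
    by (rule basis_extend[OF assms(2) DL D(2)])
  have "span (D \<union> B) \<inter> span C \<subseteq> {0}"
  proof
    fix x assume x: "x \<in> span (D \<union> B) \<inter> span C"
    then have "x \<in> span D" using B C D by (metis Int_iff Un_upper2 span_mono subsetD)
    then show "x \<in> {0}" using x span_Int_span_diff[OF C(3,2)] by blast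
  qed
  then have i: "independent ((D \<union> B) \<union> C)" "(D \<union> B) \<inter> C = {}"
    using independent_UnI[of "D \<union> B" C] B C D independent_mono by blast+
  have "span ((D \<union> B) \<union> C) = span (K \<union> L)"
  proof
    show "span ((D \<union> B) \<union> C) \<subseteq> span (K \<union> L)"
      using B(5) C(5) D(5) by (intro span_mono) auto
    have "K \<subseteq> span ((D \<union> B) \<union> C)" "L \<subseteq> span ((D \<union> B) \<union> C)"
      using B(4) C(4) span_mono[of "D \<union> B" "(D \<union> B) \<union> C"] span_mono[of "D \<union> C" "(D \<union> B) \<union> C"] by blast+
    then show "span (K \<union> L) \<subseteq> span ((D \<union> B) \<union> C)"
      by (intro span_minimal) auto
  qed
  then have "dim (span (K \<union> L)) = card ((D \<union> B) \<union> C)"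
    using i by (metis dim_span_eq_card_independent)
  also have "\<dots> = card D + card B + card C"
    using i B C D by (simp add: card_Un_disjoint)
  finally show ?thesis using B C D by simp
qed

lemma dim_trivial_Int:
  assumes "fd V" "subspace K" "subspace L" "K \<subseteq> V" "L \<subseteq> V" "K \<inter> L \<subseteq> {0}"
  shows "dim K + dim L \<le> dim V"
proof -
  have f: "fd K" "fd L" using fd_mono assms by blast+
  have "K \<inter> L = {0}" using assms subspace_0 by blast
  then have "dim (K \<inter> L) = 0" by (metis dim_le_card' card.empty dim_span finite.emptyI le_zero_eq span_empty)
  moreover have "span (K \<union> L) \<subseteq> V" using assms by (simp add: fd_subspace span_minimal)
  ultimately show ?thesis using dim_span_Un_Int[OF f] dim_mono[OF assms(1)] by (metis add.right_neutral)
qed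

section \<open>Linear functionals, dual coordinates and linear maps\<close>

definition functional :: "('v \<Rightarrow> complex) \<Rightarrow> bool" where
  "functional f \<longleftrightarrow> (\<forall>x y. f (x + y) = f x + f y) \<and> (\<forall>c x. f (c *s x) = c * f x)"

lemma functionalD:
  assumes "functional f"
  shows "f (x + y) = f x + f y" "f (c *s x) = c * f x" "f 0 = 0" "f (- x) = - f x" "f (x - y) = f x - f y"
    "f (sum g I) = (\<Sum>i\<in>I. f (g i))"
proof -
  show a: "f (x + y) = f x + f y" "f (c *s x) = c * f x" for x y c using assms by (auto simp: functional_def)
  show z: "f 0 = 0" using a(2)[of 0 0] by simp
  show m: "f (- x) = - f x" for x using a(1)[of x "-x"] z by (simp add: minus_unique)
  show "f (x - y) = f x - f y" using a(1)[of x "-y"] m by simp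
  show "f (sum g I) = (\<Sum>i\<in>I. f (g i))"
    by (induction I rule: infinite_finite_induct) (auto simp: a z)
qed

lemma subspace_kernel: "functional f \<Longrightarrow> subspace K \<Longrightarrow> subspace {x \<in> K. f x = 0}"
  by (auto simp: subspace_def functionalD)

lemma dim_kernel_functional:
  assumes "fd V" "functional f"
  shows "dim V \<le> dim {x \<in> V. f x = 0} + 1"
proof (cases "\<forall>x\<in>V. f x = 0")
  case True
  then have "{x \<in> V. f x = 0} = V" by auto
  then show ?thesis by simp
next
  case False
  then obtain v where v: "v \<in> V" "f v \<noteq> 0" by blast
  let ?K = "{x \<in> V. f x = 0}"
  have fK: "fd ?K" using fd_mono[OF assms(1)] subspace_kernel[OF assms(2)] fd_subspace[OF assms(1)] by blast
  obtain B where B: "finite B" "independent B" "span B = ?K" "dim ?K = card B" "B \<subseteq> ?K"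
    by (rule fd_basis[OF fK])
  have "V \<subseteq> span (insert v B)"
  proof
    fix x assume x: "x \<in> V"
    have "x - (f x / f v) *s v \<in> ?K"
      using v x assms fd_subspace[OF assms(1)] by (simp add: functionalD subspace_diff subspace_scale)
    then show "x \<in> span (insert v B)" using B by (metis span_breakdown_eq)
  qed
  then have "dim V \<le> card (insert v B)" using B dim_le_card by blast
  also have "\<dots> \<le> card B + 1" using B by (simp add: card_insert_if)
  finally show ?thesis using B by simp
qed

text \<open>Each functional costs at most one dimension. This count produces the large definite and
  semidefinite subspaces below.\<close>

lemma dim_kernel_functionals:
  assumes "fd V" "finite I" "\<And>i. i \<in> I \<Longrightarrow> functional (f i)"
  shows "dim V \<le> dim {x \<in> V. \<forall>i\<in>I. f i x = 0} + card I"
    and "subspace {x \<in> V. \<forall>i\<in>I. f i x = 0}"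
proof -
  have "dim V \<le> dim {x \<in> V. \<forall>i\<in>I. f i x = 0} + card I \<and> subspace {x \<in> V. \<forall>i\<in>I. f i x = 0}"
    using assms(2,3)
  proof (induction I rule: finite_induct)
    case empty
    then show ?case using assms fd_subspace by simp
  next
    case (insert i I)
    let ?K = "{x \<in> V. \<forall>i\<in>I. f i x = 0}"
    have eq: "{x \<in> V. \<forall>i\<in>insert i I. f i x = 0} = {x \<in> ?K. f i x = 0}" by auto
    have s: "subspace ?K" and d: "dim V \<le> dim ?K + card I" using insert by auto
    have "fd ?K" using fd_mono[OF assms(1) s] by blast
    then have "dim ?K \<le> dim {x \<in> ?K. f i x = 0} + 1" "subspace {x \<in> ?K. f i x = 0}"
      using dim_kernel_functional[of ?K "f i"] subspace_kernel[of "f i" ?K] insert.prems s by auto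
    then show ?case unfolding eq using d insert.hyps by simp
  qed
  then show "dim V \<le> dim {x \<in> V. \<forall>i\<in>I. f i x = 0} + card I"
    and "subspace {x \<in> V. \<forall>i\<in>I. f i x = 0}" by auto
qed

text \<open>Coordinates are taken with respect to an extension of \<open>B\<close> to a basis of the
  whole type, which makes them functionals defined everywhere and not only on
  \<open>span B\<close>.\<close>

lemma coordinates:
  assumes "independent B"
  obtains \<phi> where "\<And>b. functional (\<phi> b)" "\<And>b c. b \<in> B \<Longrightarrow> c \<in> B \<Longrightarrow> \<phi> b c = (if b = c then 1 else 0)"
    "\<And>x. finite B \<Longrightarrow> x \<in> span B \<Longrightarrow> (\<Sum>b\<in>B. \<phi> b x *s b) = x"
proof -
  let ?E = "extend_basis B"
  have E: "independent ?E" "span ?E = UNIV" "B \<subseteq> ?E"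
    using assms by (auto simp: independent_extend_basis extend_basis_superset subsetD)
  define \<phi> where "\<phi> b x = representation ?E x b" for b x
  show ?thesis
  proof (rule that[of \<phi>])
    show "functional (\<phi> b)" for b
      using E by (simp add: functional_def \<phi>_def representation_add representation_scale)
    show "\<phi> b c = (if b = c then 1 else 0)" if "b \<in> B" "c \<in> B" for b c
      using that E by (auto simp: \<phi>_def representation_basis subsetD)
    show "(\<Sum>b\<in>B. \<phi> b x *s b) = x" if "finite B" "x \<in> span B" for x
      unfolding \<phi>_def representation_extend[OF E(1) that(2) E(3)]
      using that assms by (simp add: sum_representation_eq)
  qed
qed

definition linmap :: "('v \<Rightarrow> 'v) \<Rightarrow> bool" where
  "linmap T \<longleftrightarrow> (\<forall>x y. T (x + y) = T x + T y) \<and> (\<forall>c x. T (c *s x) = c *s T x)"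

lemma linmap_iff: "linmap T \<longleftrightarrow> Vector_Spaces.linear scale scale T"
  by (auto simp: linmap_def Vector_Spaces.linear_iff vector_space_axioms)

lemma linmapD:
  assumes "linmap T"
  shows "T (x + y) = T x + T y" "T (c *s x) = c *s T x" "T 0 = 0" "T (- x) = - T x" "T (x - y) = T x - T y"
proof -
  show a: "T (x + y) = T x + T y" "T (c *s x) = c *s T x" for x y c using assms by (auto simp: linmap_def)
  show z: "T 0 = 0" using a(2)[of 0 0] by simp
  show m: "T (- x) = - T x" for x using a(1)[of x "-x"] z by (simp add: minus_unique)
  show "T (x - y) = T x - T y" using a(1)[of x "-y"] m by simp
qed

text \<open>The section \<open>S\<close> is linear on the whole type with all values in
  \<open>K\<close>, but inverts \<open>T\<close> only on the image of \<open>K\<close>. It pulls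
  definite subspaces back and, for \<open>T = L\<close>, turns perturbations into matrices.\<close>

lemma linmap_right_inverse:
  assumes "linmap T" "subspace K"
  obtains S where "linmap S" "\<And>x. S x \<in> K" "\<And>y. y \<in> T ` K \<Longrightarrow> T (S y) = y"
proof -
  interpret vector_space_pair scale scale by unfold_locales
  show ?thesis using linear_exists_right_inverse_on[of T K] assms that by (auto simp: linmap_iff image_subset_iff)
qed

lemma linmap_sum: "linmap T \<Longrightarrow> T (\<Sum>x\<in>I. f x *s g x) = (\<Sum>x\<in>I. f x *s T (g x))"
  by (induction I rule: infinite_finite_induct) (simp_all add: linmapD)

lemma subspace_image: "linmap T \<Longrightarrow> subspace K \<Longrightarrow> subspace (T ` K)"
  unfolding subspace_def by (safe; metis linmapD(1-3) imageI)

lemma span_image: "linmap T \<Longrightarrow> span (T ` B) = T ` span B"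
proof -
  assume "linmap T"
  interpret module_pair scale scale by unfold_locales
  interpret module_hom scale scale T using \<open>linmap T\<close> by (simp add: linmap_iff linear_iff_module_hom)
  show ?thesis by (rule span_image)
qed

lemma fd_image: "linmap T \<Longrightarrow> fd K \<Longrightarrow> fd (T ` K)"
  by (metis fd_basis fd_span finite_imageI span_image)

text \<open>Rank-nullity on a subspace: a linear section carries a basis of the image to a basis of
  a complement of the kernel.\<close>

lemma dim_image_kernel:
  assumes T: "linmap T" and K: "fd K"
  shows "dim (T ` K) + dim {x \<in> K. T x = 0} = dim K"
proof -
  have sK: "subspace {x \<in> K. T x = 0}" using T fd_subspace[OF K] by (auto simp: subspace_def linmapD)
  have fK: "fd {x \<in> K. T x = 0}" using fd_mono[OF K sK] by auto
  obtain S where S: "linmap S" "\<And>x. S x \<in> K" "\<And>y. y \<in> T ` K \<Longrightarrow> T (S y) = y"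
    using linmap_right_inverse[OF T fd_subspace[OF K]] by blast
  obtain B where B: "finite B" "independent B" "span B = {x \<in> K. T x = 0}" "dim {x \<in> K. T x = 0} = card B" "B \<subseteq> {x \<in> K. T x = 0}"
    by (rule fd_basis[OF fK])
  obtain C where C: "finite C" "independent C" "span C = T ` K" "dim (T ` K) = card C" "C \<subseteq> T ` K"
    by (rule fd_basis[OF fd_image[OF T K]])
  have inj: "inj_on S (T ` K)" using S(3) by (metis inj_onI)
  have ic: "card (S ` C) = card C" using inj C card_image inj_on_subset by blast
  have sp: "span (S ` C) = S ` (T ` K)" using span_image[OF S(1)] C by metis
  have iS: "independent (S ` C)"
  proof (rule independent_if_scalars_zero)
    fix f x assume s: "(\<Sum>x\<in>S ` C. f x *s x) = 0" and x: "x \<in> S ` C"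
    have "T (\<Sum>x\<in>S ` C. f x *s x) = (\<Sum>x\<in>S ` C. f x *s T x)"
      by (rule linmap_sum[OF T])
    also have "\<dots> = (\<Sum>c\<in>C. f (S c) *s c)"
      using inj_on_subset[OF inj C(5)] C(5) S(3) by (simp add: sum.reindex subset_iff)
    finally have "(\<Sum>c\<in>C. f (S c) *s c) = 0" using s T by (simp add: linmapD)
    moreover obtain c where "x = S c" "c \<in> C" using x by blast
    ultimately show "f x = 0" using independentD[OF C(2,1) order_refl, of "\<lambda>c. f (S c)"] by simp
  qed (use C in simp)
  have int: "span B \<inter> span (S ` C) \<subseteq> {0}"
  proof
    fix x assume "x \<in> span B \<inter> span (S ` C)"
    then obtain y where y: "T x = 0" "x = S y" "y \<in> T ` K" unfolding sp B(3) by blast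
    then have "y = 0" using S(3) by metis
    then show "x \<in> {0}" using y S(1) by (simp add: linmapD)
  qed
  have i: "independent (B \<union> S ` C)" "B \<inter> S ` C = {}"
    using independent_UnI[OF B(2) iS int] B C by auto
  have "span (B \<union> S ` C) = K"
  proof
    show "span (B \<union> S ` C) \<subseteq> K"
      using S(2) B(3) span_superset[of B] fd_subspace[OF K] by (intro span_minimal) auto
    show "K \<subseteq> span (B \<union> S ` C)"
    proof
      fix x assume x: "x \<in> K"
      have "x - S (T x) \<in> span B"
        unfolding B(3) using x S T fd_subspace[OF K] by (simp add: linmapD subspace_diff)
      moreover have "S (T x) \<in> span (S ` C)" unfolding sp using x by blast
      ultimately show "x \<in> span (B \<union> S ` C)"
        using span_add[of "x - S (T x)" "B \<union> S ` C" "S (T x)"] span_mono[of B "B \<union> S ` C"]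
          span_mono[of "S ` C" "B \<union> S ` C"] by auto
    qed
  qed
  then have "dim K = card (B \<union> S ` C)" using i by (metis dim_span_eq_card_independent)
  then show ?thesis using i B C ic by (simp add: card_Un_disjoint)
qed

section \<open>Hermitian forms and their inertia\<close>

text \<open>Linear in the second argument; conjugate linearity in the first one then follows from
  the symmetry.\<close>

definition hermitian :: "('v \<Rightarrow> 'v \<Rightarrow> complex) \<Rightarrow> bool" where
  "hermitian h \<longleftrightarrow> (\<forall>x. functional (h x)) \<and> (\<forall>x y. h y x = cnj (h x y))"

lemma hermitian_functional: "hermitian h \<Longrightarrow> functional (h x)"
  by (simp add: hermitian_def)

lemma hermitian_sym: "hermitian h \<Longrightarrow> h y x = cnj (h x y)"
  unfolding hermitian_def by blast

lemma hermitian_zero_sym: "hermitian h \<Longrightarrow> h x y = 0 \<longleftrightarrow> h y x = 0"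
  using hermitian_sym[of h x y] by simp

lemma hermitianD:
  assumes "hermitian h"
  shows "h z (x + y) = h z x + h z y" "h z (c *s x) = c * h z x" "h z 0 = 0" "h z (- x) = - h z x"
    "h z (x - y) = h z x - h z y"
    "h (x + y) z = h x z + h y z" "h (c *s x) z = cnj c * h x z" "h 0 z = 0" "h (- x) z = - h x z"
    "h (x - y) z = h x z - h y z"
    "h z (sum g I) = (\<Sum>i\<in>I. h z (g i))" "h (sum g I) z = (\<Sum>i\<in>I. h (g i) z)"
proof -
  note f = functionalD[OF hermitian_functional[OF assms]]
  note s = hermitian_sym[OF assms]
  show "h z (x + y) = h z x + h z y" "h z (c *s x) = c * h z x" "h z 0 = 0" "h z (- x) = - h z x"
    "h z (x - y) = h z x - h z y" "h z (sum g I) = (\<Sum>i\<in>I. h z (g i))" by (rule f)+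
  show "h (x + y) z = h x z + h y z" "h (c *s x) z = cnj c * h x z" "h 0 z = 0" "h (- x) z = - h x z"
    "h (x - y) z = h x z - h y z" "h (sum g I) z = (\<Sum>i\<in>I. h (g i) z)"
    by (simp_all add: s[of _ z] f)
qed

lemma hermitian_Im: "hermitian h \<Longrightarrow> Im (h x x) = 0"
  using arg_cong[OF hermitian_sym[of h x x], of Im] by simp

lemma hermitian_eq_Re: "hermitian h \<Longrightarrow> h x x = complex_of_real (Re (h x x))"
  by (simp add: complex_eq_iff hermitian_Im)

lemma hermitian_uminus:
  assumes "hermitian h"
  shows "hermitian (\<lambda>x y. - h x y)"
  unfolding hermitian_def
proof (intro conjI allI)
  show "functional (\<lambda>y. - h x y)" for x
    using hermitian_functional[OF assms, of x] by (simp add: functional_def)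
  show "- h y x = cnj (- h x y)" for x y
    using hermitian_sym[OF assms, of y x] by simp
qed

definition posdef :: "('v \<Rightarrow> 'v \<Rightarrow> complex) \<Rightarrow> 'v set \<Rightarrow> bool" where
  "posdef h P \<longleftrightarrow> (\<forall>x\<in>P. x \<noteq> 0 \<longrightarrow> 0 < Re (h x x))"

definition nonpos :: "('v \<Rightarrow> 'v \<Rightarrow> complex) \<Rightarrow> 'v set \<Rightarrow> bool" where
  "nonpos h Q \<longleftrightarrow> (\<forall>x\<in>Q. Re (h x x) \<le> 0)"

text \<open>The index in the basis-free form of Sylvester's law, so that the restrictions of one
  form to various subspaces can be compared directly. It depends only on the diagonal values of
  \<open>h\<close>, and the maximum is over a finite set when \<open>fd K\<close> holds. The link
  with eigenvalues is made in \<open>inertia_eq\<close>.\<close>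

definition pos :: "('v \<Rightarrow> 'v \<Rightarrow> complex) \<Rightarrow> 'v set \<Rightarrow> nat" where
  "pos h K = Max (dim ` {P. subspace P \<and> P \<subseteq> K \<and> posdef h P})"

abbreviation neg :: "('v \<Rightarrow> 'v \<Rightarrow> complex) \<Rightarrow> 'v set \<Rightarrow> nat" where
  "neg h \<equiv> pos (\<lambda>x y. - h x y)"

text \<open>For \<open>K = V\<close> this is the radical of the restriction to \<open>V\<close>.
  Neither set has to contain the other: \<open>perp h V K\<close> with \<open>K\<close> inside
  \<open>V\<close> is the part of \<open>K\<close> orthogonal to everything, and its dimension is
  the correction term in most formulas below.\<close>

definition perp :: "('v \<Rightarrow> 'v \<Rightarrow> complex) \<Rightarrow> 'v set \<Rightarrow> 'v set \<Rightarrow> 'v set" where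
  "perp h K V = {v \<in> V. \<forall>k\<in>K. h k v = 0}"

lemma posdef_nonpos_dim:
  assumes "fd V" "subspace P" "subspace Q" "P \<subseteq> V" "Q \<subseteq> V" "posdef h P" "nonpos h Q"
  shows "dim P + dim Q \<le> dim V"
  using assms(6,7) by (intro dim_trivial_Int[OF assms(1-5)]) (force simp: posdef_def nonpos_def)

lemma finite_posdef_dims: "fd K \<Longrightarrow> finite (dim ` {P. subspace P \<and> P \<subseteq> K \<and> posdef h P})"
  by (rule finite_subset[of _ "{..dim K}"]) (auto simp: dim_mono)

lemma pos_ge:
  assumes "fd K" "subspace P" "P \<subseteq> K" "posdef h P"
  shows "dim P \<le> pos h K"
  unfolding pos_def using assms finite_posdef_dims by (intro Max_ge) auto

lemma ex_posdef:
  assumes "fd K"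
  obtains P where "subspace P" "P \<subseteq> K" "posdef h P" "dim P = pos h K"
proof -
  have "subspace {0}" "{0} \<subseteq> K" "posdef h {0}"
    using fd_subspace[OF assms] subspace_0 by (auto simp: posdef_def subspace_def)
  then have "pos h K \<in> dim ` {P. subspace P \<and> P \<subseteq> K \<and> posdef h P}"
    unfolding pos_def by (intro Max_in finite_posdef_dims assms) blast
  then show ?thesis using that by auto
qed

lemma pos_le:
  assumes "fd K" "subspace Q" "Q \<subseteq> K" "nonpos h Q"
  shows "pos h K + dim Q \<le> dim K"
proof -
  obtain P where "subspace P" "P \<subseteq> K" "posdef h P" "dim P = pos h K"
    by (rule ex_posdef[OF assms(1)])
  then show ?thesis using posdef_nonpos_dim[OF assms(1) _ assms(2) _ assms(3) _ assms(4), of P] by simp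
qed

lemma pos_mono:
  assumes "fd L" "subspace K" "K \<subseteq> L"
  shows "pos h K \<le> pos h L"
proof -
  obtain P where "subspace P" "P \<subseteq> K" "posdef h P" "dim P = pos h K"
    by (rule ex_posdef[OF fd_mono[OF assms]])
  then show ?thesis using pos_ge[OF assms(1), of P h] assms(3) by simp
qed

lemma pos_cong:
  assumes "\<And>x. x \<in> K \<Longrightarrow> Re (h x x) = Re (h' x x)"
  shows "pos h K = pos h' K"
proof -
  have "{P. subspace P \<and> P \<subseteq> K \<and> posdef h P} = {P. subspace P \<and> P \<subseteq> K \<and> posdef h' P}"
    unfolding posdef_def using assms by (auto simp: subset_iff)
  then show ?thesis by (simp add: pos_def)
qed

definition orth_basis :: "('v \<Rightarrow> 'v \<Rightarrow> complex) \<Rightarrow> 'v set \<Rightarrow> 'v set \<Rightarrow> bool" where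
  "orth_basis h K E \<longleftrightarrow> finite E \<and> independent E \<and> span E = K \<and> (\<forall>x\<in>E. \<forall>y\<in>E. x \<noteq> y \<longrightarrow> h x y = 0)"

lemma orth_sum:
  assumes "hermitian h" "finite E" "\<And>x y. x \<in> E \<Longrightarrow> y \<in> E \<Longrightarrow> x \<noteq> y \<Longrightarrow> h x y = 0"
  shows "h (\<Sum>e\<in>E. c e *s e) (\<Sum>e\<in>E. c e *s e) = (\<Sum>e\<in>E. complex_of_real ((cmod (c e))\<^sup>2 * Re (h e e)))"
proof -
  have "h (\<Sum>e\<in>E. c e *s e) (\<Sum>e\<in>E. c e *s e) = (\<Sum>e\<in>E. \<Sum>f\<in>E. cnj (c e) * (c f * h e f))"
    by (subst sum.swap) (simp add: hermitianD[OF assms(1)] sum_distrib_left mult_ac)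
  also have "\<dots> = (\<Sum>e\<in>E. \<Sum>f\<in>E. if f = e then cnj (c e) * (c e * h e e) else 0)"
    using assms(3) by (intro sum.cong refl) auto
  also have "\<dots> = (\<Sum>e\<in>E. cnj (c e) * (c e * h e e))"
    using assms(2) by (intro sum.cong refl) (simp add: sum.delta)
  also have "\<dots> = (\<Sum>e\<in>E. complex_of_real ((cmod (c e))\<^sup>2 * Re (h e e)))"
  proof (rule sum.cong[OF refl])
    fix e
    have "cnj (c e) * (c e * h e e) = (c e * cnj (c e)) * h e e" by simp
    also have "\<dots> = complex_of_real ((cmod (c e))\<^sup>2) * complex_of_real (Re (h e e))"
      by (intro arg_cong2[where f = times] complex_norm_square[symmetric] hermitian_eq_Re[OF assms(1)])
    finally show "cnj (c e) * (c e * h e e) = complex_of_real ((cmod (c e))\<^sup>2 * Re (h e e))"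
      by (simp only: of_real_mult)
  qed
  finally show ?thesis .
qed

lemma span_finite_sum: "finite E \<Longrightarrow> x \<in> span E \<Longrightarrow> \<exists>c. x = (\<Sum>e\<in>E. c e *s e)"
  by (auto simp: span_finite)

lemma Re_orth_sum:
  assumes "hermitian h" "finite E" "\<And>x y. x \<in> E \<Longrightarrow> y \<in> E \<Longrightarrow> x \<noteq> y \<Longrightarrow> h x y = 0"
  shows "Re (h (\<Sum>e\<in>E. c e *s e) (\<Sum>e\<in>E. c e *s e)) = (\<Sum>e\<in>E. (cmod (c e))\<^sup>2 * Re (h e e))"
  by (subst orth_sum[OF assms(1,2)]) (use assms(3) in \<open>auto simp: Re_sum\<close>)

lemma nonpos_span:
  assumes "hermitian h" "finite E" "\<And>x y. x \<in> E \<Longrightarrow> y \<in> E \<Longrightarrow> x \<noteq> y \<Longrightarrow> h x y = 0"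
    "\<And>x. x \<in> E \<Longrightarrow> Re (h x x) \<le> 0"
  shows "nonpos h (span E)"
  unfolding nonpos_def
proof
  fix x assume "x \<in> span E"
  then obtain c where "x = (\<Sum>e\<in>E. c e *s e)" using span_finite_sum[OF assms(2)] by blast
  then show "Re (h x x) \<le> 0"
    using Re_orth_sum[OF assms(1,2) assms(3), of c] assms(4) by (auto intro!: sum_nonpos mult_nonneg_nonpos)
qed

lemma posdef_span:
  assumes "hermitian h" "finite E" "\<And>x y. x \<in> E \<Longrightarrow> y \<in> E \<Longrightarrow> x \<noteq> y \<Longrightarrow> h x y = 0"
    "\<And>x. x \<in> E \<Longrightarrow> 0 < Re (h x x)"
  shows "posdef h (span E)"
  unfolding posdef_def
proof (intro ballI impI)
  fix x assume "x \<in> span E" "x \<noteq> 0"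
  then obtain c where x: "x = (\<Sum>e\<in>E. c e *s e)" using span_finite_sum[OF assms(2)] by blast
  obtain e where e: "e \<in> E" "c e \<noteq> 0"
    using x \<open>x \<noteq> 0\<close> by (metis (mono_tags, lifting) scale_zero_left sum.neutral)
  have "0 < (\<Sum>e\<in>E. (cmod (c e))\<^sup>2 * Re (h e e))"
  proof (rule sum_pos2[OF assms(2) e(1)])
    show "0 < (cmod (c e))\<^sup>2 * Re (h e e)" using e assms(4) by simp
    show "0 \<le> (cmod (c i))\<^sup>2 * Re (h i i)" if "i \<in> E" for i using assms(4)[OF that] by simp
  qed
  then show "0 < Re (h x x)"
    using Re_orth_sum[OF assms(1,2) assms(3), of c] x by simp
qed

text \<open>Sylvester's law: the positive basis vectors span a positive definite subspace, the
  others a nonpositive one, and the two dimensions add up to \<open>dim K\<close>, which makes both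
  estimates sharp.\<close>

lemma orth_basis_pos:
  assumes h: "hermitian h" and E: "orth_basis h K E"
  shows "pos h K = card {e \<in> E. 0 < Re (h e e)}"
proof -
  let ?P = "{e \<in> E. 0 < Re (h e e)}" and ?Q = "{e \<in> E. Re (h e e) \<le> 0}"
  have fE: "finite E" "independent E" "span E = K" and o: "\<And>x y. x \<in> E \<Longrightarrow> y \<in> E \<Longrightarrow> x \<noteq> y \<Longrightarrow> h x y = 0"
    using E by (auto simp: orth_basis_def)
  have fK: "fd K" using fd_span fE by blast
  have "independent ?P" "independent ?Q" by (rule independent_mono[OF fE(2)], blast)+
  then have dP: "dim (span ?P) = card ?P" and dQ: "dim (span ?Q) = card ?Q" and dK: "dim K = card E"
    using fE(2,3) dim_span_eq_card_independent by blast+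
  have sub: "span ?P \<subseteq> K" "span ?Q \<subseteq> K" unfolding fE(3)[symmetric] by (intro span_mono; blast)+
  have "E = ?P \<union> ?Q" by auto
  then have "card E = card (?P \<union> ?Q)" by (rule arg_cong)
  also have "\<dots> = card ?P + card ?Q" using fE by (intro card_Un_disjoint) auto
  finally have c: "card E = card ?P + card ?Q" .
  have "posdef h (span ?P)" by (rule posdef_span[OF h]) (use fE o in auto)
  then have 1: "card ?P \<le> pos h K" using pos_ge[OF fK subspace_span sub(1)] dP by simp
  have "nonpos h (span ?Q)" by (rule nonpos_span[OF h]) (use fE o in auto)
  then have 2: "pos h K + card ?Q \<le> card E" using pos_le[OF fK subspace_span sub(2)] dQ dK by simp
  show ?thesis using 1 2 c by linarith
qed

lemma subspace_perp: "hermitian h \<Longrightarrow> subspace V \<Longrightarrow> subspace (perp h K V)"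
  by (auto simp: subspace_def perp_def hermitianD)

lemma fd_perp: "hermitian h \<Longrightarrow> fd V \<Longrightarrow> fd (perp h K V)"
  using fd_mono[OF _ subspace_perp] fd_subspace by (auto simp: perp_def)

lemma perp_uminus: "perp (\<lambda>x y. - h x y) K V = perp h K V"
  by (simp add: perp_def)

lemma orth_basis_rad:
  assumes h: "hermitian h" and E: "orth_basis h K E"
  shows "dim (perp h K K) = card {e \<in> E. h e e = 0}"
proof -
  let ?Z = "{e \<in> E. h e e = 0}"
  have fE: "finite E" "independent E" "span E = K" and o: "\<And>x y. x \<in> E \<Longrightarrow> y \<in> E \<Longrightarrow> x \<noteq> y \<Longrightarrow> h x y = 0"
    using E by (auto simp: orth_basis_def)
  have "perp h K K = span ?Z"
  proof
    show "perp h K K \<subseteq> span ?Z"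
    proof
      fix x assume x: "x \<in> perp h K K"
      then have "x \<in> span E" using fE by (auto simp: perp_def)
      then obtain c where c: "x = (\<Sum>e\<in>E. c e *s e)" using span_finite_sum[OF fE(1)] by blast
      have "c e = 0 \<or> h e e = 0" if e: "e \<in> E" for e
      proof -
        have "e \<in> K" using e fE span_base by blast
        \<comment> \<open>Pairing with \<open>e\<close> isolates the single summand
          \<open>c e * h e e\<close>, so \<open>c e\<close> can be nonzero only where
          \<open>h e e = 0\<close>.\<close>
        then have "0 = h e x" using x by (auto simp: perp_def)
        also have "\<dots> = (\<Sum>f\<in>E. c f * h e f)" unfolding c by (simp add: hermitianD[OF h])
        also have "\<dots> = (\<Sum>f\<in>E. if f = e then c e * h e e else 0)"
          using o e by (intro sum.cong refl) auto
        also have "\<dots> = c e * h e e" using e fE by simp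
        finally show ?thesis by simp
      qed
      then have "x = (\<Sum>e\<in>?Z. c e *s e)"
        unfolding c using fE by (intro sum.mono_neutral_right) auto
      moreover have "(\<Sum>e\<in>?Z. c e *s e) \<in> span ?Z" by (intro span_sum span_scale span_base)
      ultimately show "x \<in> span ?Z" by simp
    qed
    have "e \<in> perp h K K" if "e \<in> ?Z" for e
    proof -
      have "K \<subseteq> {v. h e v = 0}"
        unfolding fE(3)[symmetric]
      proof (rule span_minimal)
        show "E \<subseteq> {v. h e v = 0}"
        proof
          fix v assume "v \<in> E"
          then show "v \<in> {v. h e v = 0}" using o[of e v] that by (cases "e = v") auto
        qed
        show "subspace {v. h e v = 0}" by (simp add: subspace_def hermitianD[OF h])
      qed
      then have "h x e = 0" if "x \<in> K" for x using that hermitian_zero_sym[OF h, of x e] by blast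
      moreover have "e \<in> K" using that fE(3) span_base by blast
      ultimately show ?thesis by (simp add: perp_def)
    qed
    then show "span ?Z \<subseteq> perp h K K"
      using fE by (intro span_minimal subspace_perp[OF h]) auto
  qed
  then show ?thesis using independent_mono[OF fE(2), of ?Z]
    by (simp add: dim_eq_card_independent)
qed

lemma normalize_vector:
  assumes h: "hermitian h" and "h x x \<noteq> 0"
  obtains c where "c \<noteq> 0" "h (c *s x) (c *s x) \<in> {1, -1}"
proof -
  define r where "r = Re (h x x)"
  have hr: "h x x = of_real r" unfolding r_def by (rule hermitian_eq_Re[OF h])
  then have r0: "r \<noteq> 0" using assms(2) by auto
  define c where "c = complex_of_real (1 / sqrt \<bar>r\<bar>)"
  have "h (c *s x) (c *s x) = of_real (1 / sqrt \<bar>r\<bar> * (1 / sqrt \<bar>r\<bar>) * r)"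
    by (simp add: hermitianD[OF h] hr c_def flip: of_real_mult)
  also have "1 / sqrt \<bar>r\<bar> * (1 / sqrt \<bar>r\<bar>) * r = r / \<bar>r\<bar>" by simp
  also have "complex_of_real (r / \<bar>r\<bar>) \<in> {1, -1}" using r0 by (cases "r > 0") auto
  finally show ?thesis using that[of c] r0 c_def by simp
qed

lemma hermitian_polarize:
  assumes h: "hermitian h" and K: "subspace K" and z: "\<And>x. x \<in> K \<Longrightarrow> h x x = 0"
    and x: "x \<in> K" and y: "y \<in> K"
  shows "h x y = 0"
proof -
  \<comment> \<open>With the coefficient \<open>h y x\<close> both cross terms equal the squared
    modulus of \<open>h x y\<close>, so one test vector settles real and imaginary part
    together.\<close>
  have "h (x + h y x *s y) (x + h y x *s y) = 0"
    using K x y by (intro z) (simp add: subspace_add subspace_scale)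
  then have "h y x * h x y + cnj (h y x) * h y x = 0"
    by (simp add: hermitianD[OF h] z[OF x] z[OF y] add.commute)
  then have "h x y * cnj (h x y) = 0"
    unfolding hermitian_sym[OF h, of y x] by (simp only: complex_cnj_cnj mult.commute) simp
  then show ?thesis by simp
qed

text \<open>Induction on the dimension: a vector with \<open>h x x\<close> nonzero is normalised and
  split off, and its orthogonal complement in \<open>K\<close> is smaller. If there is no such
  vector, polarisation shows that the form vanishes on \<open>K\<close>, and every basis will
  do.\<close>

lemma orth_basis_exists:
  assumes h: "hermitian h" and "fd K"
  obtains E where "orth_basis h K E" "\<And>e. e \<in> E \<Longrightarrow> h e e \<in> {1, -1, 0}"
proof -
  have "\<exists>E. orth_basis h K E \<and> (\<forall>e\<in>E. h e e \<in> {1, -1, 0})" using \<open>fd K\<close>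
  proof (induction "dim K" arbitrary: K rule: less_induct)
    case less
    note K = fd_subspace[OF less.prems]
    show ?case
    proof (cases "\<forall>x\<in>K. h x x = 0")
      case True
      have t: "h x x = 0" if "x \<in> K" for x using True that by blast
      have z: "h x y = 0" if "x \<in> K" "y \<in> K" for x y
        by (rule hermitian_polarize[OF h K t that])
      obtain B where B: "finite B" "independent B" "span B = K" "dim K = card B" "B \<subseteq> K"
        by (rule fd_basis[OF less.prems])
      have "h a b = 0" if "a \<in> B" "b \<in> B" for a b using that B(5) z by blast
      then have "orth_basis h K B \<and> (\<forall>e\<in>B. h e e \<in> {1, -1, 0})"
        using B(1-3) unfolding orth_basis_def by simp
      then show ?thesis by blast
    next
      case False
      then obtain x0 where x0: "x0 \<in> K" "h x0 x0 \<noteq> 0" by blast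
      obtain c where c: "c \<noteq> 0" "h (c *s x0) (c *s x0) \<in> {1, -1}"
        by (rule normalize_vector[OF h x0(2)])
      define x where "x = c *s x0"
      have x: "x \<in> K" "h x x \<in> {1, -1}" "h x x \<noteq> 0"
        using c x0 K x_def by (auto simp: subspace_scale)
      let ?L = "perp h {x} K"
      have fL: "fd ?L" using fd_perp[OF h less.prems] .
      have "?L \<subseteq> K" "x \<notin> ?L" using x by (auto simp: perp_def)
      then have "dim ?L < dim K"
        using dim_subspace_eq[OF less.prems fd_subspace[OF fL]] x(1) by (metis not_le)
      from less.hyps[OF this fL] obtain E where E: "orth_basis h ?L E" "\<forall>e\<in>E. h e e \<in> {1, -1, 0}" by blast
      have EL: "E \<subseteq> ?L" using E(1) span_superset[of E] by (auto simp: orth_basis_def)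
      have nx: "x \<notin> span E" using E(1) \<open>x \<notin> ?L\<close> by (simp add: orth_basis_def)
      have "span (insert x E) = K"
      proof
        show "span (insert x E) \<subseteq> K" using EL \<open>?L \<subseteq> K\<close> x K by (intro span_minimal) auto
        show "K \<subseteq> span (insert x E)"
        proof
          fix y assume y: "y \<in> K"
          have "y - (h x y / h x x) *s x \<in> ?L"
            using y x K by (simp add: perp_def hermitianD[OF h] subspace_diff subspace_scale)
          then show "y \<in> span (insert x E)"
            using E(1) unfolding orth_basis_def by (metis span_breakdown_eq)
        qed
      qed
      moreover have "h x y = 0 \<and> h y x = 0" if "y \<in> E" for y
        using that EL hermitian_zero_sym[OF h, of x y] by (auto simp: perp_def)
      ultimately have "orth_basis h K (insert x E)"
        using E(1) nx by (auto simp: orth_basis_def independent_insertI)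
      then show ?thesis using E(2) x(2) by blast
    qed
  qed
  then show ?thesis using that by blast
qed

text \<open>On the common kernel of the functionals with positive coefficient the form is
  nonpositive, and that kernel has codimension at most their number. Independence of the squares is
  not assumed.\<close>

lemma pos_le_card_squares:
  assumes K: "fd K" and J: "finite J" and F: "\<And>k. functional (F k)"
    and eq: "\<And>x. x \<in> K \<Longrightarrow> Re (h x x) = (\<Sum>k\<in>J. c k * (cmod (F k x))\<^sup>2)"
  shows "pos h K \<le> card {k \<in> J. 0 < c k}"
proof -
  let ?I = "{k \<in> J. 0 < c k}"
  let ?Q = "{x \<in> K. \<forall>k\<in>?I. F k x = 0}"
  have fI: "finite ?I" using J by simp
  have "nonpos h ?Q"
    unfolding nonpos_def
  proof
    fix x assume x: "x \<in> ?Q"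
    have "c k * (cmod (F k x))\<^sup>2 \<le> 0" if "k \<in> J" for k
      using x that by (cases "0 < c k") (auto simp: mult_nonpos_nonneg)
    then show "Re (h x x) \<le> 0" using x eq[of x] by (simp add: sum_nonpos)
  qed
  then have "pos h K + dim ?Q \<le> dim K"
    by (intro pos_le[OF K] dim_kernel_functionals(2)[where f = F, OF K fI F]) auto
  then show ?thesis using dim_kernel_functionals(1)[where f = F, OF K fI F] by simp
qed

lemma inertia_sum:
  assumes h: "hermitian h" and "fd K"
  shows "pos h K + neg h K + dim (perp h K K) = dim K"
proof -
  obtain E where E: "orth_basis h K E" "\<And>e. e \<in> E \<Longrightarrow> h e e \<in> {1, -1, 0}"
    using orth_basis_exists[OF assms] by metis
  have E': "orth_basis (\<lambda>x y. - h x y) K E" using E by (simp add: orth_basis_def)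
  let ?P = "{e \<in> E. 0 < Re (h e e)}" and ?N = "{e \<in> E. 0 < Re (- h e e)}" and ?Z = "{e \<in> E. h e e = 0}"
  have f: "finite E" using E by (simp add: orth_basis_def)
  have "E = ?P \<union> ?N \<union> ?Z" using E(2) by fastforce
  then have "card E = card (?P \<union> ?N \<union> ?Z)" by (rule arg_cong)
  also have "\<dots> = card (?P \<union> ?N) + card ?Z" using f by (intro card_Un_disjoint) auto
  also have "card (?P \<union> ?N) = card ?P + card ?N" using f by (intro card_Un_disjoint) auto
  finally have "card E = card ?P + card ?N + card ?Z" .
  moreover have "dim K = card E" using E(1) unfolding orth_basis_def by (metis dim_span_eq_card_independent)
  ultimately show ?thesis
    using orth_basis_pos[OF h E(1)] orth_basis_pos[OF hermitian_uminus[OF h] E'] orth_basis_rad[OF h E(1)]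
    by simp
qed

lemma ex_nonpos:
  assumes h: "hermitian h" and "fd K"
  obtains Q where "subspace Q" "Q \<subseteq> K" "nonpos h Q" "pos h K + dim Q = dim K"
proof -
  obtain E where E: "orth_basis h K E" "\<And>e. e \<in> E \<Longrightarrow> h e e \<in> {1, -1, 0}"
    using orth_basis_exists[OF assms] by metis
  let ?P = "{e \<in> E. 0 < Re (h e e)}" and ?Q = "{e \<in> E. Re (h e e) \<le> 0}"
  have fE: "finite E" "independent E" "span E = K" and o: "\<And>x y. x \<in> E \<Longrightarrow> y \<in> E \<Longrightarrow> x \<noteq> y \<Longrightarrow> h x y = 0"
    using E by (auto simp: orth_basis_def)
  have "independent ?Q" by (rule independent_mono[OF fE(2)]) blast
  then have dQ: "dim (span ?Q) = card ?Q" and dK: "dim K = card E"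
    using fE(2,3) dim_span_eq_card_independent by blast+
  have "E = ?P \<union> ?Q" by auto
  then have "card E = card (?P \<union> ?Q)" by (rule arg_cong)
  also have "\<dots> = card ?P + card ?Q" using fE by (intro card_Un_disjoint) auto
  finally have c: "card E = card ?P + card ?Q" .
  show ?thesis
  proof (rule that[of "span ?Q"])
    show "span ?Q \<subseteq> K" unfolding fE(3)[symmetric] by (intro span_mono) blast
    show "nonpos h (span ?Q)" by (rule nonpos_span[OF h]) (use fE o in auto)
    show "pos h K + dim (span ?Q) = dim K" unfolding orth_basis_pos[OF h E(1)] dQ dK c ..
  qed auto
qed

text \<open>A nonpositive subspace of \<open>K\<close> of dimension \<open>dim K - pos h K\<close>
  is also one of \<open>V\<close>. This is the source of all upper bounds on the indices.\<close>

lemma pos_codim: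
  assumes "hermitian h" "fd V" "subspace K" "K \<subseteq> V"
  shows "pos h V + dim K \<le> dim V + pos h K"
proof -
  obtain Q where Q: "subspace Q" "Q \<subseteq> K" "nonpos h Q" "pos h K + dim Q = dim K"
    by (rule ex_nonpos[OF assms(1) fd_mono[OF assms(2-4)]])
  then show ?thesis using pos_le[OF assms(2) Q(1) _ Q(3)] assms(4) by fastforce
qed

text \<open>Being orthogonal to \<open>K\<close> is tested on a basis of \<open>K\<close>; the basis
  vectors in \<open>perp h V K\<close> impose no condition on \<open>V\<close>, so only the
  remaining ones count as functionals.\<close>

lemma dim_perp_le:
  assumes h: "hermitian h" and "fd K" "fd V"
  shows "dim V + dim (perp h V K) \<le> dim K + dim (perp h K V)"
proof -
  have sub: "perp h V K \<subseteq> K" by (auto simp: perp_def)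
  obtain B where B: "finite B" "independent B" "span B = perp h V K" "dim (perp h V K) = card B" "B \<subseteq> perp h V K"
    by (rule fd_basis[OF fd_perp[OF h \<open>fd K\<close>]])
  have BK: "B \<subseteq> K" using B sub by blast
  obtain C where C: "finite C" "B \<inter> C = {}" "independent (B \<union> C)" "span (B \<union> C) = K" "C \<subseteq> K"
    "dim K = card B + card C"
    by (rule basis_extend[OF \<open>fd K\<close> BK B(2)])
  have "{x \<in> V. \<forall>c\<in>C. h c x = 0} = perp h K V"
  proof (rule equalityI)
    show "{x \<in> V. \<forall>c\<in>C. h c x = 0} \<subseteq> perp h K V"
    proof
      fix x assume x: "x \<in> {x \<in> V. \<forall>c\<in>C. h c x = 0}"
      have "h b x = 0" if "b \<in> B" for b
        using x B(5) that hermitian_zero_sym[OF h, of b x] by (auto simp: perp_def)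
      then have "B \<union> C \<subseteq> {k. h k x = 0}"
        using x by auto
      then have "K \<subseteq> {k. h k x = 0}"
        unfolding C(4)[symmetric] by (intro span_minimal) (auto simp: subspace_def hermitianD[OF h])
      then show "x \<in> perp h K V" using x by (auto simp: perp_def)
    qed
  qed (use C in \<open>auto simp: perp_def\<close>)
  then have "dim V \<le> dim (perp h K V) + card C"
    using dim_kernel_functionals(1)[OF \<open>fd V\<close> C(1), of h] hermitian_functional[OF h] by simp
  then show ?thesis using B C by simp
qed

text \<open>\<open>dim V - dim (perp h K V)\<close> and \<open>dim K - dim (perp h V K)\<close> are
  both the rank of the pairing between \<open>K\<close> and \<open>V\<close>; exchanging the two
  spaces in \<open>dim_perp_le\<close> gives the other inequality.\<close>

lemma dim_perp:
  assumes h: "hermitian h" and "fd K" "fd V"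
  shows "dim V + dim (perp h V K) = dim K + dim (perp h K V)"
  using dim_perp_le[OF assms] dim_perp_le[OF h assms(3,2)] by simp

text \<open>Maximal nonpositive subspaces of \<open>K\<close> and of its orthogonal complement in
  \<open>V\<close> are orthogonal to each other, so their sum is nonpositive; they meet only inside
  the radical of \<open>K\<close>.\<close>

lemma pos_perp_le:
  assumes h: "hermitian h" and V: "fd V" and K: "subspace K" "K \<subseteq> V"
  shows "pos h V + dim (perp h V K) \<le> pos h K + pos h (perp h K V) + dim (perp h K K)"
proof -
  let ?N = "perp h K V" and ?R = "perp h K K"
  have fK: "fd K" and fN: "fd ?N" using fd_mono[OF V K] fd_perp[OF h V] by auto
  obtain Q where Q: "subspace Q" "Q \<subseteq> K" "nonpos h Q" "pos h K + dim Q = dim K"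
    by (rule ex_nonpos[OF h fK])
  obtain S where S: "subspace S" "S \<subseteq> ?N" "nonpos h S" "pos h ?N + dim S = dim ?N"
    by (rule ex_nonpos[OF h fN])
  have NV: "?N \<subseteq> V" by (auto simp: perp_def)
  have "span (Q \<union> S) \<subseteq> V" using Q S K NV fd_subspace[OF V] by (intro span_minimal) auto
  moreover have "nonpos h (span (Q \<union> S))"
    unfolding nonpos_def
  proof
    fix x assume "x \<in> span (Q \<union> S)"
    then obtain a b where ab: "x = a + b" "a \<in> Q" "b \<in> S"
      unfolding span_Un span_eq_iff[THEN iffD2, OF Q(1)] span_eq_iff[THEN iffD2, OF S(1)] by blast
    have z: "h a b = 0" using ab Q S by (auto simp: perp_def)
    then have "h b a = 0" using hermitian_zero_sym[OF h] by blast
    then have "h x x = h a a + h b b" using ab z by (simp add: hermitianD[OF h])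
    then show "Re (h x x) \<le> 0" using Q(3) S(3) ab by (simp add: nonpos_def add_nonpos_nonpos)
  qed
  ultimately have 1: "pos h V + dim (span (Q \<union> S)) \<le> dim V"
    by (intro pos_le[OF V]) auto
  have fQ: "fd Q" and fS: "fd S" using fd_mono[OF fK Q(1,2)] fd_mono[OF fN S(1,2)] by auto
  have "Q \<inter> S \<subseteq> ?R" using Q S by (auto simp: perp_def)
  then have "dim (Q \<inter> S) \<le> dim ?R" by (rule dim_mono[OF fd_perp[OF h fK]])
  then show ?thesis
    using 1 dim_span_Un_Int[OF fQ fS] Q(4) S(4) dim_perp[OF h fK V] by linarith
qed

text \<open>\<open>pos_perp_le\<close> holds for \<open>h\<close> and for \<open>-h\<close>, and the
  sum of the two inequalities is an equality for dimension reasons: the radical of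
  \<open>perp h K V\<close> contains the radicals of \<open>V\<close> and of \<open>K\<close>, and
  these intersect inside \<open>perp h V K\<close>. Hence neither inequality is strict.\<close>

lemma pos_perp:
  assumes h: "hermitian h" and V: "fd V" and K: "subspace K" "K \<subseteq> V"
  shows "pos h V + dim (perp h V K) = pos h K + pos h (perp h K V) + dim (perp h K K)"
proof -
  let ?N = "perp h K V" and ?R = "perp h K K" and ?D = "perp h V K" and ?V = "perp h V V"
  have fK: "fd K" and fN: "fd ?N" using fd_mono[OF V K] fd_perp[OF h V] by auto
  have f: "fd ?V" "fd ?R" using fd_perp[OF h V] fd_perp[OF h fK] by auto
  have "h k x = 0" if "x \<in> K" "k \<in> ?N" for k x
    using that hermitian_zero_sym[OF h, of k x] by (auto simp: perp_def)
  then have "?V \<union> ?R \<subseteq> perp h ?N ?N"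
    using K by (auto simp: perp_def)
  then have "span (?V \<union> ?R) \<subseteq> perp h ?N ?N"
    using subspace_perp[OF h fd_subspace[OF fN]] by (intro span_minimal)
  then have 1: "dim (span (?V \<union> ?R)) \<le> dim (perp h ?N ?N)"
    by (rule dim_mono[OF fd_perp[OF h fN]])
  have "?V \<inter> ?R \<subseteq> ?D" by (auto simp: perp_def)
  then have 2: "dim (?V \<inter> ?R) \<le> dim ?D" by (rule dim_mono[OF fd_perp[OF h fK]])
  show ?thesis
    using 1 2 dim_span_Un_Int[OF f] inertia_sum[OF h V] inertia_sum[OF h fK] inertia_sum[OF h fN]
      pos_perp_le[OF assms] pos_perp_le[OF hermitian_uminus[OF h] V K] dim_perp[OF h fK V]
    unfolding perp_uminus by linarith
qed

text \<open>The form vanishes on the kernel of \<open>T\<close>, so a positive definite subspace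
  meets this kernel trivially and keeps its dimension under \<open>T\<close>; a linear section
  carries definite subspaces of the image back.\<close>

lemma pos_pullback:
  assumes T: "linmap T" and K: "fd K" and h': "hermitian h'"
    and eq: "\<And>x. x \<in> K \<Longrightarrow> Re (h x x) = Re (h' (T x) (T x))"
  shows "pos h K = pos h' (T ` K)"
proof (rule antisym)
  obtain P where P: "subspace P" "P \<subseteq> K" "posdef h P" "dim P = pos h K"
    by (rule ex_posdef[OF K])
  have fP: "fd P" using fd_mono[OF K P(1,2)] .
  have "{x \<in> P. T x = 0} \<subseteq> {0}"
  proof
    fix x assume x: "x \<in> {x \<in> P. T x = 0}"
    then have "Re (h x x) = 0" using eq[of x] P(2) hermitianD(3)[OF h'] by auto
    then show "x \<in> {0}" using P(3) x by (auto simp: posdef_def)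
  qed
  then have "dim {x \<in> P. T x = 0} = 0"
    using dim_le_card[of "{x \<in> P. T x = 0}" "{}"] by simp
  then have "dim P = dim (T ` P)" using dim_image_kernel[OF T fP] by simp
  moreover have "posdef h' (T ` P)"
    unfolding posdef_def
  proof (intro ballI impI)
    fix y assume "y \<in> T ` P" "y \<noteq> 0"
    then obtain x where x: "x \<in> P" "y = T x" "x \<noteq> 0" using linmapD(3)[OF T] by blast
    then have "0 < Re (h x x)" using P(3) by (simp add: posdef_def)
    then show "0 < Re (h' y y)" using eq[of x] x P(2) by auto
  qed
  ultimately show "pos h K \<le> pos h' (T ` K)"
    using pos_ge[OF fd_image[OF T K] subspace_image[OF T P(1)], of h'] P(2,4) by auto
next
  obtain P where P: "subspace P" "P \<subseteq> T ` K" "posdef h' P" "dim P = pos h' (T ` K)"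
    by (rule ex_posdef[OF fd_image[OF T K]])
  obtain S where S: "linmap S" "\<And>x. S x \<in> K" "\<And>y. y \<in> T ` K \<Longrightarrow> T (S y) = y"
    using linmap_right_inverse[OF T fd_subspace[OF K]] by metis
  have fP: "fd P" using fd_mono[OF fd_image[OF T K] P(1,2)] .
  have "{x \<in> P. S x = 0} \<subseteq> {0}"
  proof
    fix x assume x: "x \<in> {x \<in> P. S x = 0}"
    then have "T (S x) = x" using S(3) P(2) by blast
    then show "x \<in> {0}" using x linmapD(3)[OF T] by simp
  qed
  then have "dim {x \<in> P. S x = 0} = 0"
    using dim_le_card[of "{x \<in> P. S x = 0}" "{}"] by simp
  then have "dim P = dim (S ` P)" using dim_image_kernel[OF S(1) fP] by simp
  moreover have "posdef h (S ` P)"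
    unfolding posdef_def
  proof (intro ballI impI)
    fix y assume "y \<in> S ` P" "y \<noteq> 0"
    then obtain x where x: "x \<in> P" "y = S x" "x \<noteq> 0" using linmapD(3)[OF S(1)] by blast
    then have "0 < Re (h' x x)" using P(3) by (simp add: posdef_def)
    moreover have "T y = x" using S(3) x P(2) by auto
    ultimately show "0 < Re (h y y)" using eq[of y] S(2) x by auto
  qed
  ultimately show "pos h' (T ` K) \<le> pos h K"
    using pos_ge[OF K subspace_image[OF S(1) P(1)], of h] S(2) P(4) by auto
qed

section \<open>Perturbations with prescribed restrictions\<close>

definition sesq :: "('v \<Rightarrow> 'v \<Rightarrow> complex) \<Rightarrow> bool" where
  "sesq \<theta> \<longleftrightarrow> (\<forall>x. functional (\<theta> x)) \<and> (\<forall>y. functional (\<lambda>x. cnj (\<theta> x y)))"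

definition herm_add :: "('v \<Rightarrow> 'v \<Rightarrow> complex) \<Rightarrow> ('v \<Rightarrow> 'v \<Rightarrow> complex) \<Rightarrow> 'v \<Rightarrow> 'v \<Rightarrow> complex" where
  "herm_add h \<theta> x y = h x y + \<theta> x y + cnj (\<theta> y x)"

lemma hermitian_herm_add:
  assumes "hermitian h" "sesq \<theta>"
  shows "hermitian (herm_add h \<theta>)"
proof -
  have "functional (h x)" "functional (\<theta> x)" "functional (\<lambda>y. cnj (\<theta> y x))" for x
    using assms hermitian_functional by (auto simp: sesq_def)
  then have "functional (herm_add h \<theta> x)" for x
    unfolding functional_def herm_add_def by (simp add: algebra_simps)
  moreover have "herm_add h \<theta> y x = cnj (herm_add h \<theta> x y)" for x y
    using hermitian_sym[OF assms(1), of y x] by (simp add: herm_add_def)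
  ultimately show ?thesis unfolding hermitian_def by blast
qed

definition adm :: "'v set \<Rightarrow> 'v set \<Rightarrow> ('v \<Rightarrow> 'v \<Rightarrow> complex) \<Rightarrow> bool" where
  "adm K L \<theta> \<longleftrightarrow> sesq \<theta> \<and> (\<forall>x\<in>K. \<forall>y. \<theta> x y = 0) \<and> (\<forall>x. \<forall>y\<in>L. \<theta> x y = 0)"

text \<open>Passing to the adjoint of \<open>\<theta>\<close> exchanges the two subspaces and leaves
  the perturbed form as it is, so the roles of \<open>K1\<close> and \<open>K2\<close> are
  symmetric.\<close>

lemma adm_swap:
  assumes "adm K L \<theta>"
  shows "adm L K (\<lambda>x y. cnj (\<theta> y x))" "herm_add h (\<lambda>x y. cnj (\<theta> y x)) = herm_add h \<theta>"
  using assms by (auto simp: adm_def sesq_def herm_add_def fun_eq_iff)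

text \<open>Reduces statements on the negative index to the positive index of the family belonging
  to \<open>-h\<close>.\<close>

lemma adm_uminus:
  assumes "adm K L \<theta>"
  shows "adm K L (\<lambda>x y. - \<theta> x y)"
    "herm_add h (\<lambda>x y. - \<theta> x y) = (\<lambda>x y. - herm_add (\<lambda>x y. - h x y) \<theta> x y)"
  using assms by (auto simp: adm_def sesq_def herm_add_def functional_def fun_eq_iff)

end

section \<open>The completion problem on a frame\<close>

text \<open>An admissible perturbation cannot change the restrictions of a form on \<open>N\<close> to \<open>N1\<close> and to \<open>N2\<close>;
  both are diagonal on a frame, and \<open>ER\<close> spans the intersection of \<open>N1\<close> and \<open>N2\<close>.\<close>
locale frame = complex_vs scale for scale :: "complex \<Rightarrow> 'v::ab_group_add \<Rightarrow> 'v" (infixr \<open>*s\<close> 75) +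
  fixes h :: "'v \<Rightarrow> 'v \<Rightarrow> complex" and N N1 N2 K1 K2 ER E1 E2 EW :: "'v set"
  assumes h: "hermitian h"
    and fdK: "fd K1" "fd K2"
    and N1: "N1 = K1 \<inter> N" and N2: "N2 = K2 \<inter> N"
    and fin: "finite ER" "finite E1" "finite E2" "finite EW"
    and disj: "ER \<inter> E1 = {}" "ER \<inter> E2 = {}" "ER \<inter> EW = {}" "E1 \<inter> E2 = {}" "E1 \<inter> EW = {}" "E2 \<inter> EW = {}"
    and indep: "independent (ER \<union> E1 \<union> E2 \<union> EW)"
    and spanN: "span (ER \<union> E1 \<union> E2 \<union> EW) = N"
    and span1: "span (ER \<union> E1) = N1" and span2: "span (ER \<union> E2) = N2"
    and radR: "\<And>x y. x \<in> ER \<Longrightarrow> y \<in> N \<Longrightarrow> h x y = 0"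
    and diag1: "\<And>x y. x \<in> E1 \<Longrightarrow> y \<in> E1 \<Longrightarrow> x \<noteq> y \<Longrightarrow> h x y = 0"
    and diag2: "\<And>x y. x \<in> E2 \<Longrightarrow> y \<in> E2 \<Longrightarrow> x \<noteq> y \<Longrightarrow> h x y = 0"
    and unit1: "\<And>x. x \<in> E1 \<Longrightarrow> h x x \<in> {1, -1, 0}"
    and unit2: "\<And>x. x \<in> E2 \<Longrightarrow> h x x \<in> {1, -1, 0}"
begin

abbreviation "E \<equiv> E1 \<union> E2 \<union> EW"

lemma fdN: "fd N"
  using fin fd_span[of "ER \<union> E1 \<union> E2 \<union> EW"] by (simp add: spanN)

lemma finE: "finite E" using fin by simp

lemma E_sub_N: "ER \<subseteq> N" "E1 \<subseteq> N" "E2 \<subseteq> N" "EW \<subseteq> N"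
  unfolding spanN[symmetric] by (rule subsetI, rule span_base, simp)+

lemma dimN: "dim N = card ER + card E1 + card E2 + card EW"
  and dimN1: "dim N1 = card ER + card E1" and dimN2: "dim N2 = card ER + card E2"
proof -
  have "dim N = card (ER \<union> E1 \<union> E2 \<union> EW)" unfolding spanN[symmetric] by (rule dim_span_eq_card_independent[OF indep])
  also have "\<dots> = card (ER \<union> E1 \<union> E2) + card EW" by (simp add: card_Un_disjoint Int_Un_distrib2 fin disj)
  also have "card (ER \<union> E1 \<union> E2) = card (ER \<union> E1) + card E2" by (simp add: card_Un_disjoint Int_Un_distrib2 fin disj)
  also have "card (ER \<union> E1) = card ER + card E1" by (simp add: card_Un_disjoint fin disj)
  finally show "dim N = card ER + card E1 + card E2 + card EW" .
  have "independent (ER \<union> E1)" "independent (ER \<union> E2)" by (rule independent_mono[OF indep], blast)+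
  then have "dim N1 = card (ER \<union> E1)" "dim N2 = card (ER \<union> E2)"
    unfolding span1[symmetric] span2[symmetric]
    using dim_span_eq_card_independent[of "ER \<union> E1"] dim_span_eq_card_independent[of "ER \<union> E2"] by simp_all
  then show "dim N1 = card ER + card E1" "dim N2 = card ER + card E2"
    using fin disj by (simp_all add: card_Un_disjoint)
qed

lemma frame_swap: "frame scale h N N2 N1 K2 K1 ER E2 E1 EW"
proof (rule frame.intro[OF complex_vs_axioms frame_axioms.intro])
  have "ER \<union> E2 \<union> E1 \<union> EW = ER \<union> E1 \<union> E2 \<union> EW" by blast
  then show "independent (ER \<union> E2 \<union> E1 \<union> EW)" "span (ER \<union> E2 \<union> E1 \<union> EW) = N"
    using indep spanN by simp_all
  show "E2 \<inter> E1 = {}" using disj by blast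
qed (fact h fdK N1 N2 fin disj span1 span2 radR diag1 diag2 unit1 unit2)+

lemma orth1: "orth_basis h N1 (ER \<union> E1)"
proof -
  have "h x y = 0" if "x \<in> ER \<union> E1" "y \<in> ER \<union> E1" "x \<noteq> y" for x y
    using that radR[of x y] radR[of y x] diag1[of x y] subsetD[OF E_sub_N(1)] subsetD[OF E_sub_N(2)]
      hermitian_zero_sym[OF h, of x y] by (elim UnE) simp_all
  then show ?thesis
    using fin independent_mono[OF indep, of "ER \<union> E1"] span1 by (auto simp: orth_basis_def)
qed

lemma unitR: "x \<in> ER \<Longrightarrow> h x x = 0"
  using radR E_sub_N by blast

lemma pos_N1: "pos h N1 = card {e \<in> E1. h e e = 1}"
  and neg_N1: "neg h N1 = card {e \<in> E1. h e e = -1}"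
  and nul_N1: "dim (perp h N1 N1) = card ER + card {e \<in> E1. h e e = 0}"
proof -
  have o: "orth_basis (\<lambda>x y. - h x y) N1 (ER \<union> E1)" using orth1 by (simp add: orth_basis_def)
  have "{e \<in> ER \<union> E1. 0 < Re (h e e)} = {e \<in> E1. h e e = 1}"
    using unit1 unitR by fastforce
  then show "pos h N1 = card {e \<in> E1. h e e = 1}" using orth_basis_pos[OF h orth1] by simp
  have "{e \<in> ER \<union> E1. 0 < Re (- h e e)} = {e \<in> E1. h e e = -1}"
    using unit1 unitR by fastforce
  then show "neg h N1 = card {e \<in> E1. h e e = -1}"
    using orth_basis_pos[OF hermitian_uminus[OF h] o] by simp
  have "{e \<in> ER \<union> E1. h e e = 0} = ER \<union> {e \<in> E1. h e e = 0}" using unitR by auto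
  moreover have "card (ER \<union> {e \<in> E1. h e e = 0}) = card ER + card {e \<in> E1. h e e = 0}"
    using fin disj by (intro card_Un_disjoint) auto
  ultimately show "dim (perp h N1 N1) = card ER + card {e \<in> E1. h e e = 0}"
    using orth_basis_rad[OF h orth1] by simp
qed

lemma pos_N2: "pos h N2 = card {e \<in> E2. h e e = 1}"
  and nul_N2: "dim (perp h N2 N2) = card ER + card {e \<in> E2. h e e = 0}"
  using frame.pos_N1[OF frame_swap] frame.nul_N1[OF frame_swap] by auto

text \<open>Admissibility requires vanishing on all of \<open>K1\<close>, which need not lie in
  \<open>N\<close>. Such a dual system exists because \<open>span (E2 \<union> EW)\<close> lies in
  \<open>N\<close>, so that it meets \<open>K1\<close> only inside
  \<open>N1 = span (ER \<union> E1)\<close>, that is, trivially.\<close>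

lemma dual_functionals:
  obtains \<phi> where "\<And>b. functional (\<phi> b)" "\<And>b x. b \<in> E2 \<union> EW \<Longrightarrow> x \<in> K1 \<Longrightarrow> \<phi> b x = 0"
    "\<And>b c. b \<in> E2 \<union> EW \<Longrightarrow> c \<in> E \<Longrightarrow> \<phi> b c = (if b = c then 1 else 0)"
proof -
  obtain B where B: "finite B" "independent B" "span B = K1" "dim K1 = card B" "B \<subseteq> K1"
    by (rule fd_basis[OF fdK(1)])
  have i: "independent (E2 \<union> EW)" by (rule independent_mono[OF indep]) blast
  have "span B \<inter> span (E2 \<union> EW) \<subseteq> span (ER \<union> E1) \<inter> span (E2 \<union> EW)"
  proof -
    have "span (E2 \<union> EW) \<subseteq> N" unfolding spanN[symmetric] by (intro span_mono) blast
    then show ?thesis using B(3) span1 N1 by blast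
  qed
  also have "\<dots> = {0}"
  proof (rule span_Int_span_diff)
    have "ER \<union> E1 \<union> (E2 \<union> EW) = ER \<union> E1 \<union> E2 \<union> EW" by (rule Un_assoc[symmetric])
    then show "independent (ER \<union> E1 \<union> (E2 \<union> EW))" using indep by simp
    show "(ER \<union> E1) \<inter> (E2 \<union> EW) = {}" by (simp add: Int_Un_distrib Int_Un_distrib2 disj)
  qed
  finally have "span B \<inter> span (E2 \<union> EW) \<subseteq> {0}" .
  note ind = independent_UnI[OF B(2) i this B(1) finite_UnI[OF fin(3,4)]]
  obtain \<phi> where \<phi>: "\<And>b. functional (\<phi> b)"
    "\<And>b c. b \<in> B \<union> (E2 \<union> EW) \<Longrightarrow> c \<in> B \<union> (E2 \<union> EW) \<Longrightarrow> \<phi> b c = (if b = c then 1 else 0)"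
    "\<And>x. finite (B \<union> (E2 \<union> EW)) \<Longrightarrow> x \<in> span (B \<union> (E2 \<union> EW)) \<Longrightarrow> (\<Sum>b\<in>B \<union> (E2 \<union> EW). \<phi> b x *s b) = x"
    using coordinates[OF ind(1)] by blast
  have z: "\<phi> b x = 0" if b: "b \<in> E2 \<union> EW" and x: "x \<in> K1" for b x
  proof -
    have "\<phi> b c = 0" if "c \<in> B" for c using \<phi>(2)[of b c] b that ind(2) by auto
    then have "B \<subseteq> {x \<in> UNIV. \<phi> b x = 0}" by blast
    then have "span B \<subseteq> {x \<in> UNIV. \<phi> b x = 0}"
      by (intro span_minimal subspace_kernel \<phi>(1)) auto
    then show ?thesis using x unfolding B(3) by blast
  qed
  show ?thesis
  proof (rule that[of \<phi>])
    fix b c assume b: "b \<in> E2 \<union> EW" and c: "c \<in> E"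
    show "\<phi> b c = (if b = c then 1 else 0)"
    proof (cases "c \<in> E1")
      case True
      then have "c \<in> N1" unfolding span1[symmetric] by (intro span_base) simp
      then have "c \<in> K1" using N1 by simp
      then show ?thesis using z[OF b] True b disj by auto
    next
      case False
      then show ?thesis using b c by (intro \<phi>(2)) auto
    qed
  qed (fact \<phi>(1) z)+
qed

text \<open>All entries outside the blocks of \<open>E1\<close> and \<open>E2\<close> are free:
  \<open>\<theta>\<close> is built from dual functionals of \<open>E2 \<union> EW\<close> on the
  left and of \<open>E1 \<union> EW\<close> on the right, and together with its adjoint it reaches
  every other pair.\<close>

lemma realize:
  assumes M: "\<And>b c. b \<in> E \<Longrightarrow> c \<in> E \<Longrightarrow> M c b = cnj (M b c)"
    and M1: "\<And>b c. b \<in> E1 \<Longrightarrow> c \<in> E1 \<Longrightarrow> M b c = h b c"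
    and M2: "\<And>b c. b \<in> E2 \<Longrightarrow> c \<in> E2 \<Longrightarrow> M b c = h b c"
  obtains \<theta> where "adm K1 K2 \<theta>" "\<And>b c. b \<in> E \<Longrightarrow> c \<in> E \<Longrightarrow> herm_add h \<theta> b c = M b c"
proof -
  obtain \<phi> where \<phi>: "\<And>b. functional (\<phi> b)" "\<And>b x. b \<in> E2 \<union> EW \<Longrightarrow> x \<in> K1 \<Longrightarrow> \<phi> b x = 0"
    "\<And>b c. b \<in> E2 \<union> EW \<Longrightarrow> c \<in> E \<Longrightarrow> \<phi> b c = (if b = c then 1 else 0)"
    using dual_functionals by metis
  obtain \<psi> where \<psi>: "\<And>b. functional (\<psi> b)" "\<And>b x. b \<in> E1 \<union> EW \<Longrightarrow> x \<in> K2 \<Longrightarrow> \<psi> b x = 0"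
    "\<And>b c. b \<in> E1 \<union> EW \<Longrightarrow> c \<in> E2 \<union> E1 \<union> EW \<Longrightarrow> \<psi> b c = (if b = c then 1 else 0)"
    using frame.dual_functionals[OF frame_swap] by metis
  \<comment> \<open>A pair from \<open>EW\<close> is reached both by \<open>\<theta>\<close> and by
    its adjoint, which accounts for the factor 1/2; every other free pair is reached by exactly one
    of them.\<close>
  define C where "C b c = (if b \<in> EW \<and> c \<in> EW then 1 / 2 else 1) * (M b c - h b c)" for b c
  define \<theta> where "\<theta> x y = (\<Sum>b\<in>E2 \<union> EW. \<Sum>c\<in>E1 \<union> EW. C b c * cnj (\<phi> b x) * \<psi> c y)" for x y
  have "sesq \<theta>"
    unfolding sesq_def functional_def \<theta>_def
    by (simp add: functionalD[OF \<phi>(1)] functionalD[OF \<psi>(1)] algebra_simps sum.distrib sum_distrib_left)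
  then have adm: "adm K1 K2 \<theta>"
    unfolding adm_def \<theta>_def using \<phi>(2) \<psi>(2) by (auto intro!: sum.neutral)
  have \<theta>E: "\<theta> b c = (if b \<in> E2 \<union> EW \<and> c \<in> E1 \<union> EW then C b c else 0)" if b: "b \<in> E" and c: "c \<in> E" for b c
  proof -
    have "\<theta> b c = (\<Sum>b'\<in>E2 \<union> EW. \<Sum>c'\<in>E1 \<union> EW. if b' = b then if c' = c then C b c else 0 else 0)"
      unfolding \<theta>_def using b c by (intro sum.cong refl) (auto simp: \<phi>(3) \<psi>(3))
    also have "\<dots> = (\<Sum>b'\<in>E2 \<union> EW. if b' = b then \<Sum>c'\<in>E1 \<union> EW. if c' = c then C b c else 0 else 0)"
      by (intro sum.cong refl) auto
    also have "\<dots> = (if b \<in> E2 \<union> EW \<and> c \<in> E1 \<union> EW then C b c else 0)"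
      using fin by (simp add: sum.delta)
    finally show ?thesis .
  qed
  show ?thesis
  proof (rule that[OF adm])
    fix b c assume b: "b \<in> E" and c: "c \<in> E"
    have s: "cnj (M c b - h c b) = M b c - h b c"
      using M[OF c b] hermitian_sym[OF h, of b c] by simp
    have cb: "cnj (C c b) = (if b \<in> EW \<and> c \<in> EW then 1 / 2 else 1) * (M b c - h b c)"
      unfolding C_def complex_cnj_mult s by simp
    have d: "b \<in> E1 \<longrightarrow> b \<notin> E2 \<and> b \<notin> EW" "b \<in> E2 \<longrightarrow> b \<notin> E1 \<and> b \<notin> EW"
      "c \<in> E1 \<longrightarrow> c \<notin> E2 \<and> c \<notin> EW" "c \<in> E2 \<longrightarrow> c \<notin> E1 \<and> c \<notin> EW"
      using disj by blast+
    have eq: "herm_add h \<theta> b c = h b c + (if b \<in> E2 \<union> EW \<and> c \<in> E1 \<union> EW then C b c else 0)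
        + (if c \<in> E2 \<union> EW \<and> b \<in> E1 \<union> EW then
            (if b \<in> EW \<and> c \<in> EW then 1 / 2 else 1) * (M b c - h b c) else 0)"
      unfolding herm_add_def \<theta>E[OF b c] \<theta>E[OF c b] cb[symmetric] by simp
    from b c show "herm_add h \<theta> b c = M b c"
      unfolding eq C_def using d M1[of b c] M2[of b c]
      by (elim UnE) simp_all
  qed
qed

lemma ER_K: "ER \<subseteq> K1" "ER \<subseteq> K2"
proof -
  have "ER \<subseteq> N1" "ER \<subseteq> N2"
    unfolding span1[symmetric] span2[symmetric] by (rule subsetI, rule span_base, simp)+
  then show "ER \<subseteq> K1" "ER \<subseteq> K2" using N1 N2 by auto
qed

text \<open>Prescribing the matrix \<open>M b c = [b = c] w b + [\<mu> b = \<mu> c] s (\<mu> b)\<close> on the frame turns the perturbed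
  form into a combination of squares of coordinates and of sums of coordinates with equal label.\<close>
lemma realize_labelled:
  fixes w :: "'v \<Rightarrow> real" and s :: "int \<Rightarrow> real" and \<mu> :: "'v \<Rightarrow> int"
  assumes d1: "\<And>b. b \<in> E1 \<Longrightarrow> h b b = of_real (w b + s (\<mu> b))"
    and o1: "\<And>b c. b \<in> E1 \<Longrightarrow> c \<in> E1 \<Longrightarrow> b \<noteq> c \<Longrightarrow> \<mu> b = \<mu> c \<Longrightarrow> s (\<mu> b) = 0"
    and d2: "\<And>b. b \<in> E2 \<Longrightarrow> h b b = of_real (w b + s (\<mu> b))"
    and o2: "\<And>b c. b \<in> E2 \<Longrightarrow> c \<in> E2 \<Longrightarrow> b \<noteq> c \<Longrightarrow> \<mu> b = \<mu> c \<Longrightarrow> s (\<mu> b) = 0"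
  obtains \<theta> \<chi> where "adm K1 K2 \<theta>" "\<And>b. functional (\<chi> b)"
    "\<And>x. x \<in> N \<Longrightarrow> x = (\<Sum>b\<in>ER. \<chi> b x *s b) + (\<Sum>b\<in>E. \<chi> b x *s b)"
    "\<And>b c. b \<in> ER \<union> E \<Longrightarrow> c \<in> ER \<union> E \<Longrightarrow> \<chi> b c = (if b = c then 1 else 0)"
    "\<And>b x. b \<in> E \<Longrightarrow> x \<in> N \<Longrightarrow> herm_add h \<theta> b x =
       of_real (w b) * \<chi> b x + of_real (s (\<mu> b)) * (\<Sum>c | c \<in> E \<and> \<mu> c = \<mu> b. \<chi> c x)"
    "\<And>x. x \<in> N \<Longrightarrow> Re (herm_add h \<theta> x x) = (\<Sum>b\<in>E. w b * (cmod (\<chi> b x))\<^sup>2) +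
       (\<Sum>k\<in>\<mu> ` E. s k * (cmod (\<Sum>c | c \<in> E \<and> \<mu> c = k. \<chi> c x))\<^sup>2)"
proof -
  have Un: "ER \<union> E = ER \<union> E1 \<union> E2 \<union> EW" by blast
  obtain \<chi> where \<chi>: "\<And>b. functional (\<chi> b)"
    "\<And>b c. b \<in> ER \<union> E \<Longrightarrow> c \<in> ER \<union> E \<Longrightarrow> \<chi> b c = (if b = c then 1 else 0)"
    "\<And>x. finite (ER \<union> E) \<Longrightarrow> x \<in> span (ER \<union> E) \<Longrightarrow> (\<Sum>b\<in>ER \<union> E. \<chi> b x *s b) = x"
    using coordinates[OF indep] unfolding Un by blast
  have \<chi>N: "x = (\<Sum>b\<in>ER. \<chi> b x *s b) + (\<Sum>b\<in>E. \<chi> b x *s b)" if "x \<in> N" for x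
  proof -
    have "x = (\<Sum>b\<in>ER \<union> E. \<chi> b x *s b)"
      using \<chi>(3)[of x] that fin unfolding Un spanN by simp
    also have "\<dots> = (\<Sum>b\<in>ER. \<chi> b x *s b) + (\<Sum>b\<in>E. \<chi> b x *s b)"
      using fin disj by (intro sum.union_disjoint) (simp_all add: Int_Un_distrib)
    finally show ?thesis .
  qed
  define M where "M b c = complex_of_real ((if b = c then w b else 0) + (if \<mu> b = \<mu> c then s (\<mu> b) else 0))" for b c
  obtain \<theta> where \<theta>: "adm K1 K2 \<theta>" "\<And>b c. b \<in> E \<Longrightarrow> c \<in> E \<Longrightarrow> herm_add h \<theta> b c = M b c"
  proof (rule realize)
    show "M c b = cnj (M b c)" for b c by (simp add: M_def)
    show "M b c = h b c" if "b \<in> E1" "c \<in> E1" for b c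
      using that d1 diag1[of b c] o1[of b c] by (cases "b = c") (auto simp: M_def)
    show "M b c = h b c" if "b \<in> E2" "c \<in> E2" for b c
      using that d2 diag2[of b c] o2[of b c] by (cases "b = c") (auto simp: M_def)
  qed blast
  let ?H = "herm_add h \<theta>"
  have H: "hermitian ?H" using hermitian_herm_add[OF h] \<theta>(1) by (simp add: adm_def)
  \<comment> \<open>Membership of \<open>b\<close> in \<open>K1\<close> kills
    \<open>\<theta>\<close> with \<open>b\<close> on the left, membership in \<open>K2\<close> kills
    the adjoint term; what remains is \<open>h\<close>, for which \<open>ER\<close> is in the
    radical of \<open>N\<close>.\<close>
  have HR: "?H b x = 0" if "b \<in> ER" "x \<in> N" for b x
  proof -
    have "b \<in> K1" "b \<in> K2" using that ER_K by auto
    then show ?thesis using radR[OF that] \<theta>(1) by (simp add: herm_add_def adm_def)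
  qed
  have HE: "?H b x = of_real (w b) * \<chi> b x + of_real (s (\<mu> b)) * (\<Sum>c | c \<in> E \<and> \<mu> c = \<mu> b. \<chi> c x)"
    if b: "b \<in> E" and x: "x \<in> N" for b x
  proof -
    have bN: "b \<in> N" using b E_sub_N by blast
    have 0: "?H b c = 0" if "c \<in> ER" for c
      using HR[OF that bN] hermitian_zero_sym[OF H, of b c] by simp
    have "?H b x = ?H b ((\<Sum>b\<in>ER. \<chi> b x *s b) + (\<Sum>b\<in>E. \<chi> b x *s b))"
      using \<chi>N[OF x] by simp
    also have "\<dots> = (\<Sum>c\<in>E. \<chi> c x * ?H b c)"
      by (simp add: hermitianD[OF H] 0)
    also have "\<dots> = (\<Sum>c\<in>E. \<chi> c x * M b c)" by (rule sum.cong) (simp_all add: \<theta>(2)[OF b])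
    also have "\<dots> = (\<Sum>c\<in>E. (if c = b then of_real (w b) * \<chi> b x else 0) +
        (if \<mu> c = \<mu> b then of_real (s (\<mu> b)) * \<chi> c x else 0))"
      by (rule sum.cong) (auto simp: M_def algebra_simps)
    also have "\<dots> = of_real (w b) * \<chi> b x + (\<Sum>c\<in>E. if \<mu> c = \<mu> b then of_real (s (\<mu> b)) * \<chi> c x else 0)"
      using b finE by (simp add: sum.distrib sum.delta)
    also have "(\<Sum>c\<in>E. if \<mu> c = \<mu> b then of_real (s (\<mu> b)) * \<chi> c x else 0)
        = (\<Sum>c | c \<in> E \<and> \<mu> c = \<mu> b. of_real (s (\<mu> b)) * \<chi> c x)"
      using finE by (subst sum.inter_filter[symmetric]) auto
    finally show ?thesis by (simp add: sum_distrib_left)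
  qed
  show ?thesis
  proof (rule that[OF \<theta>(1) \<chi>(1) \<chi>N \<chi>(2) HE])
    fix x assume x: "x \<in> N"
    let ?F = "\<lambda>k. \<Sum>c | c \<in> E \<and> \<mu> c = k. \<chi> c x"
    have nn: "cnj z * (of_real r * z) = of_real (r * (cmod z)\<^sup>2)" for z r
      using complex_norm_square[of z] by (simp add: mult_ac)
    have "?H x x = ?H ((\<Sum>b\<in>ER. \<chi> b x *s b) + (\<Sum>b\<in>E. \<chi> b x *s b)) x"
      using \<chi>N[OF x] by simp
    also have "\<dots> = (\<Sum>b\<in>E. cnj (\<chi> b x) * ?H b x)"
      by (simp add: hermitianD[OF H] HR[OF _ x])
    also have "\<dots> = (\<Sum>b\<in>E. of_real (w b * (cmod (\<chi> b x))\<^sup>2) + cnj (\<chi> b x) * (of_real (s (\<mu> b)) * ?F (\<mu> b)))"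
      by (rule sum.cong[OF refl], subst HE[OF _ x]) (simp_all only: distrib_left nn)
    also have "\<dots> = of_real (\<Sum>b\<in>E. w b * (cmod (\<chi> b x))\<^sup>2) + (\<Sum>b\<in>E. cnj (\<chi> b x) * (of_real (s (\<mu> b)) * ?F (\<mu> b)))"
      by (simp add: sum.distrib)
    also have "(\<Sum>b\<in>E. cnj (\<chi> b x) * (of_real (s (\<mu> b)) * ?F (\<mu> b))) =
        (\<Sum>k\<in>\<mu> ` E. \<Sum>b | b \<in> E \<and> \<mu> b = k. cnj (\<chi> b x) * (of_real (s (\<mu> b)) * ?F (\<mu> b)))"
      by (rule sum.image_gen[OF finE])
    also have "\<dots> = (\<Sum>k\<in>\<mu> ` E. cnj (?F k) * (of_real (s k) * ?F k))"
      by (rule sum.cong[OF refl]) (simp add: sum_distrib_right)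
    also have "\<dots> = of_real (\<Sum>k\<in>\<mu> ` E. s k * (cmod (?F k))\<^sup>2)"
      unfolding nn by simp
    finally show "Re (?H x x) = (\<Sum>b\<in>E. w b * (cmod (\<chi> b x))\<^sup>2) + (\<Sum>k\<in>\<mu> ` E. s k * (cmod (?F k))\<^sup>2)"
      by simp
  qed
qed

text \<open>Positive vectors are numbered upwards from 1, negative ones downwards from -1, null
  vectors get 0. Numbering \<open>E2\<close> in the same way pairs vectors of equal sign as far as
  possible.\<close>

lemma sign_labels:
  obtains \<mu> :: "'v \<Rightarrow> int" where "\<And>b. b \<in> E1 \<Longrightarrow> h b b = of_int (sgn (\<mu> b))"
    "\<And>b c. b \<in> E1 \<Longrightarrow> c \<in> E1 \<Longrightarrow> b \<noteq> c \<Longrightarrow> \<mu> b = \<mu> c \<Longrightarrow> \<mu> b = 0"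
    "\<And>b. b \<in> E1 \<Longrightarrow> \<mu> b \<in> {- int (neg h N1)..int (pos h N1)}"
proof -
  let ?P = "{e \<in> E1. h e e = 1}" and ?Q = "{e \<in> E1. h e e = -1}"
  obtain g where g: "bij_betw g ?P {1..int (card ?P)}" using int_labels[of ?P] fin by auto
  obtain f where f: "bij_betw f ?Q {1..int (card ?Q)}" using int_labels[of ?Q] fin by auto
  define \<mu> where "\<mu> b = (if h b b = 1 then g b else if h b b = -1 then - f b else 0)" for b
  have gP: "g b \<in> {1..int (card ?P)}" if "b \<in> E1" "h b b = 1" for b
    using bij_betwE[OF g] that by blast
  have fP: "f b \<in> {1..int (card ?Q)}" if "b \<in> E1" "h b b = -1" for b
    using bij_betwE[OF f] that by blast
  show ?thesis
  proof (rule that[of \<mu>])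
    show "h b b = of_int (sgn (\<mu> b))" if "b \<in> E1" for b
      using gP[OF that] fP[OF that] unit1[OF that] by (auto simp: \<mu>_def sgn_if)
    show "\<mu> b \<in> {- int (neg h N1)..int (pos h N1)}" if "b \<in> E1" for b
      using gP[OF that] fP[OF that] by (auto simp: \<mu>_def pos_N1 neg_N1)
    fix b c assume b: "b \<in> E1" and c: "c \<in> E1" and n: "b \<noteq> c" and e: "\<mu> b = \<mu> c"
    show "\<mu> b = 0"
    proof (rule ccontr)
      assume "\<mu> b \<noteq> 0"
      then consider "h b b = 1" "h c c = 1" "g b = g c" | "h b b = -1" "h c c = -1" "f b = f c"
        using e gP[OF b] gP[OF c] fP[OF b] fP[OF c] by (auto simp: \<mu>_def split: if_splits)
      then show False
        using n b c bij_betw_imp_inj_on[OF g] bij_betw_imp_inj_on[OF f] by cases (auto dest: inj_onD)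
    qed
  qed
qed

text \<open>With \<open>w = 0\<close> and \<open>s = sgn\<close> the perturbed form has one square
  per label, with the sign of the label. Labels of \<open>E1\<close> and \<open>E2\<close> overlap,
  so there are at most \<open>p\<close> positive and \<open>n\<close> negative ones, and the same
  \<open>\<theta>\<close> serves both indices.\<close>

lemma exists_min_inertia:
  obtains \<theta> where "adm K1 K2 \<theta>" "pos (herm_add h \<theta>) N \<le> max (pos h N1) (pos h N2)"
    "neg (herm_add h \<theta>) N \<le> max (neg h N1) (neg h N2)"
proof -
  obtain \<mu>1 where 1: "\<And>b. b \<in> E1 \<Longrightarrow> h b b = of_int (sgn (\<mu>1 b))"
    "\<And>b c. b \<in> E1 \<Longrightarrow> c \<in> E1 \<Longrightarrow> b \<noteq> c \<Longrightarrow> \<mu>1 b = \<mu>1 c \<Longrightarrow> \<mu>1 b = 0"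
    "\<And>b. b \<in> E1 \<Longrightarrow> \<mu>1 b \<in> {- int (neg h N1)..int (pos h N1)}"
    using sign_labels by blast
  obtain \<mu>2 where 2: "\<And>b. b \<in> E2 \<Longrightarrow> h b b = of_int (sgn (\<mu>2 b))"
    "\<And>b c. b \<in> E2 \<Longrightarrow> c \<in> E2 \<Longrightarrow> b \<noteq> c \<Longrightarrow> \<mu>2 b = \<mu>2 c \<Longrightarrow> \<mu>2 b = 0"
    "\<And>b. b \<in> E2 \<Longrightarrow> \<mu>2 b \<in> {- int (neg h N2)..int (pos h N2)}"
    using frame.sign_labels[OF frame_swap] by blast
  \<comment> \<open>Vectors of \<open>EW\<close> get the label 0, whose coefficient
    \<open>sgn 0\<close> is zero, so they add nothing to either index.\<close>
  define \<mu> where "\<mu> b = (if b \<in> E1 then \<mu>1 b else if b \<in> E2 then \<mu>2 b else 0)" for b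
  define p n where "p = max (pos h N1) (pos h N2)" and "n = max (neg h N1) (neg h N2)"
  have \<mu>1: "\<mu> b = \<mu>1 b" if "b \<in> E1" for b using that by (simp add: \<mu>_def)
  have \<mu>2: "\<mu> b = \<mu>2 b" if "b \<in> E2" for b using that disj by (auto simp: \<mu>_def)
  have \<mu>r: "\<mu> b \<in> {- int n..int p}" if "b \<in> E" for b
    using 1(3)[of b] 2(3)[of b] by (auto simp: \<mu>_def p_def n_def)
  obtain \<theta> \<chi> where T: "adm K1 K2 \<theta>" "\<And>b. functional (\<chi> b)"
    "\<And>x. x \<in> N \<Longrightarrow> Re (herm_add h \<theta> x x) = (\<Sum>b\<in>E. 0 * (cmod (\<chi> b x))\<^sup>2) +
       (\<Sum>k\<in>\<mu> ` E. of_int (sgn k) * (cmod (\<Sum>c | c \<in> E \<and> \<mu> c = k. \<chi> c x))\<^sup>2)"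
  proof (rule realize_labelled[of "\<lambda>_. 0" "\<lambda>k. of_int (sgn k)" \<mu>])
    show "h b b = complex_of_real (0 + real_of_int (sgn (\<mu> b)))" if "b \<in> E1" for b
      using 1(1)[OF that] by (simp add: \<mu>1 that)
    show "h b b = complex_of_real (0 + real_of_int (sgn (\<mu> b)))" if "b \<in> E2" for b
      using 2(1)[OF that] by (simp add: \<mu>2 that)
    show "real_of_int (sgn (\<mu> b)) = 0" if "b \<in> E1" "c \<in> E1" "b \<noteq> c" "\<mu> b = \<mu> c" for b c
      using 1(2)[OF that(1-3)] that by (simp add: \<mu>1)
    show "real_of_int (sgn (\<mu> b)) = 0" if "b \<in> E2" "c \<in> E2" "b \<noteq> c" "\<mu> b = \<mu> c" for b c
      using 2(2)[OF that(1-3)] that by (simp add: \<mu>2)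
  qed blast
  define F where "F k x = (\<Sum>c | c \<in> E \<and> \<mu> c = k. \<chi> c x)" for k x
  have F: "functional (F k)" for k
    using T(2) by (simp add: functional_def F_def sum.distrib sum_distrib_left)
  have Q: "Re (herm_add h \<theta> x x) = (\<Sum>k\<in>\<mu> ` E. of_int (sgn k) * (cmod (F k x))\<^sup>2)" if "x \<in> N" for x
    using T(3)[OF that] by (simp add: F_def)
  have fE: "finite (\<mu> ` E)" using finE by simp
  have "{k \<in> \<mu> ` E. 0 < real_of_int (sgn k)} \<subseteq> {1..int p}"
    using \<mu>r by (force simp: sgn_if split: if_splits)
  then have "pos (herm_add h \<theta>) N \<le> p"
    using pos_le_card_squares[where F = F and h = "herm_add h \<theta>" and c = "\<lambda>k. of_int (sgn k)", OF fdN fE F] Q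
      card_mono[of "{1..int p}" "{k \<in> \<mu> ` E. 0 < real_of_int (sgn k)}"] by simp
  moreover have "{k \<in> \<mu> ` E. 0 < real_of_int (- sgn k)} \<subseteq> {- int n..-1}"
    using \<mu>r by (force simp: sgn_if split: if_splits)
  then have "neg (herm_add h \<theta>) N \<le> n"
    using pos_le_card_squares[where F = F and h = "\<lambda>x y. - herm_add h \<theta> x y" and c = "\<lambda>k. of_int (- sgn k)", OF fdN fE F] Q
      card_mono[of "{- int n..-1}" "{k \<in> \<mu> ` E. 0 < real_of_int (- sgn k)}"]
    by (simp add: sum_negf)
  ultimately show ?thesis using that[OF T(1)] by (simp add: p_def n_def)
qed

text \<open>Only the vectors that obstruct positivity are numbered; the positive ones keep the label
  0, which will carry no square.\<close>

lemma nonpos_labels: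
  obtains \<mu> :: "'v \<Rightarrow> int" where "\<And>b. b \<in> E1 \<Longrightarrow> \<mu> b = 0 \<longleftrightarrow> h b b = 1"
    "\<And>b c. b \<in> E1 \<Longrightarrow> c \<in> E1 \<Longrightarrow> b \<noteq> c \<Longrightarrow> \<mu> b = \<mu> c \<Longrightarrow> \<mu> b = 0"
    "\<And>b. b \<in> E1 \<Longrightarrow> \<mu> b \<in> {0..int (card E1 - pos h N1)}"
proof -
  let ?Q = "{e \<in> E1. h e e \<noteq> 1}"
  have "?Q = E1 - {e \<in> E1. h e e = 1}" by blast
  then have c: "card ?Q = card E1 - pos h N1"
    using fin card_Diff_subset[of "{e \<in> E1. h e e = 1}" E1] by (simp add: pos_N1)
  obtain f where f: "bij_betw f ?Q {1..int (card ?Q)}" using int_labels[of ?Q] fin by auto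
  have fQ: "f b \<in> {1..int (card ?Q)}" if "b \<in> E1" "h b b \<noteq> 1" for b
    using bij_betwE[OF f] that by blast
  show ?thesis
  proof (rule that[of "\<lambda>b. if h b b = 1 then 0 else f b"])
    show "(if h b b = 1 then 0 else f b) = 0 \<longleftrightarrow> h b b = 1" if "b \<in> E1" for b
      using fQ[OF that] by auto
    show "(if h b b = 1 then 0 else f b) \<in> {0..int (card E1 - pos h N1)}" if "b \<in> E1" for b
      using fQ[OF that] unfolding c by auto
    fix b c assume b: "b \<in> E1" and c: "c \<in> E1" and n: "b \<noteq> c"
      and e: "(if h b b = 1 then 0 else f b) = (if h c c = 1 then 0 else f c)"
    show "(if h b b = 1 then 0 else f b) = 0"
    proof (rule ccontr)
      assume "\<not> ?thesis"
      then have "h b b \<noteq> 1" "h c c \<noteq> 1" "f b = f c"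
        using e fQ[OF b] by (auto split: if_splits)
      then show False
        using n b c bij_betw_imp_inj_on[OF f] by (auto dest: inj_onD)
    qed
  qed
qed

text \<open>The perturbed form is a positive definite sum of squares of the
  \<open>E\<close>-coordinates minus one square per nonzero label. Nonpositive vectors of
  \<open>E1\<close> and \<open>E2\<close> share their labels, so only \<open>q\<close> squares are
  subtracted, and a subspace of codimension at most \<open>q\<close> in \<open>span E\<close> is
  positive definite. The disjunction records which of the two numbers is \<open>q\<close>.\<close>

lemma exists_max_pos:
  obtains \<theta> where "adm K1 K2 \<theta>"
    "dim N + pos h N1 \<le> pos (herm_add h \<theta>) N + dim N1 \<or> dim N + pos h N2 \<le> pos (herm_add h \<theta>) N + dim N2"
proof -
  obtain \<mu>1 where 1: "\<And>b. b \<in> E1 \<Longrightarrow> \<mu>1 b = 0 \<longleftrightarrow> h b b = 1"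
    "\<And>b c. b \<in> E1 \<Longrightarrow> c \<in> E1 \<Longrightarrow> b \<noteq> c \<Longrightarrow> \<mu>1 b = \<mu>1 c \<Longrightarrow> \<mu>1 b = 0"
    "\<And>b. b \<in> E1 \<Longrightarrow> \<mu>1 b \<in> {0..int (card E1 - pos h N1)}"
    using nonpos_labels by blast
  obtain \<mu>2 where 2: "\<And>b. b \<in> E2 \<Longrightarrow> \<mu>2 b = 0 \<longleftrightarrow> h b b = 1"
    "\<And>b c. b \<in> E2 \<Longrightarrow> c \<in> E2 \<Longrightarrow> b \<noteq> c \<Longrightarrow> \<mu>2 b = \<mu>2 c \<Longrightarrow> \<mu>2 b = 0"
    "\<And>b. b \<in> E2 \<Longrightarrow> \<mu>2 b \<in> {0..int (card E2 - pos h N2)}"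
    using frame.nonpos_labels[OF frame_swap] by blast
  define \<mu> where "\<mu> b = (if b \<in> E1 then \<mu>1 b else if b \<in> E2 then \<mu>2 b else 0)" for b
  define q where "q = max (card E1 - pos h N1) (card E2 - pos h N2)"
  have \<mu>1: "\<mu> b = \<mu>1 b" if "b \<in> E1" for b using that by (simp add: \<mu>_def)
  have \<mu>2: "\<mu> b = \<mu>2 b" if "b \<in> E2" for b using that disj by (auto simp: \<mu>_def)
  have \<mu>W: "\<mu> b = 0" if "b \<in> EW" for b using that disj by (auto simp: \<mu>_def)
  have \<mu>r: "\<mu> b \<in> {0..int q}" if "b \<in> E" for b
    using 1(3)[of b] 2(3)[of b] by (auto simp: \<mu>_def q_def)
  \<comment> \<open>With -2 the remaining weight of a nonpositive vector is
    \<open>h b b + 2\<close>, which is at least 1 as \<open>h b b\<close> is 0 or -1.\<close>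
  define s where "s k = (if k = 0 then 0 else - 2 :: real)" for k :: int
  define w where "w b = (if b \<in> EW then 1 else Re (h b b) - s (\<mu> b))" for b
  have w1: "1 \<le> w b" if "b \<in> E" for b
    using that 1(1)[of b] 2(1)[of b] \<mu>1[of b] \<mu>2[of b] unit1[of b] unit2[of b]
    by (auto simp: w_def s_def)
  have wE: "w b = Re (h b b) - s (\<mu> b)" if "b \<in> E1 \<or> b \<in> E2" for b
    using that disj by (auto simp: w_def)
  obtain \<theta> \<chi> where T: "adm K1 K2 \<theta>" "\<And>b. functional (\<chi> b)"
    "\<And>x. x \<in> N \<Longrightarrow> x = (\<Sum>b\<in>ER. \<chi> b x *s b) + (\<Sum>b\<in>E. \<chi> b x *s b)"
    "\<And>b c. b \<in> ER \<union> E \<Longrightarrow> c \<in> ER \<union> E \<Longrightarrow> \<chi> b c = (if b = c then 1 else 0)"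
    "\<And>x. x \<in> N \<Longrightarrow> Re (herm_add h \<theta> x x) = (\<Sum>b\<in>E. w b * (cmod (\<chi> b x))\<^sup>2) +
       (\<Sum>k\<in>\<mu> ` E. s k * (cmod (\<Sum>c | c \<in> E \<and> \<mu> c = k. \<chi> c x))\<^sup>2)"
  proof (rule realize_labelled[of w s \<mu>])
    show "h b b = complex_of_real (w b + s (\<mu> b))" if "b \<in> E1" for b
      using unit1[OF that] that by (auto simp: wE)
    show "h b b = complex_of_real (w b + s (\<mu> b))" if "b \<in> E2" for b
      using unit2[OF that] that by (auto simp: wE)
    show "s (\<mu> b) = 0" if "b \<in> E1" "c \<in> E1" "b \<noteq> c" "\<mu> b = \<mu> c" for b c
      using 1(2)[OF that(1-3)] that by (simp add: \<mu>1 s_def)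
    show "s (\<mu> b) = 0" if "b \<in> E2" "c \<in> E2" "b \<noteq> c" "\<mu> b = \<mu> c" for b c
      using 2(2)[OF that(1-3)] that by (simp add: \<mu>2 s_def)
  qed blast
  define F where "F k x = (\<Sum>c | c \<in> E \<and> \<mu> c = k. \<chi> c x)" for k x
  have F: "functional (F k)" for k
    using T(2) by (simp add: functional_def F_def sum.distrib sum_distrib_left)
  have EN: "span E \<subseteq> N" unfolding spanN[symmetric] by (rule span_mono) blast
  have fE: "fd (span E)" by (rule fd_span[OF finE])
  \<comment> \<open>The search takes place in \<open>span E\<close> and not in \<open>N\<close>,
    since the vectors of \<open>ER\<close> stay in the radical and would spoil definiteness.\<close>
  let ?P = "{x \<in> span E. \<forall>k\<in>{1..int q}. F k x = 0}"
  have d: "dim (span E) \<le> dim ?P + card {1..int q}" and sP: "subspace ?P"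
    by (rule dim_kernel_functionals[OF fE]; use F in auto)+
  have dE: "dim (span E) = card E1 + card E2 + card EW"
  proof -
    have "independent E" by (rule independent_mono[OF indep]) blast
    then show ?thesis using fin by (simp add: dim_eq_card_independent card_Un_disjoint disj Int_Un_distrib2)
  qed
  have "posdef (herm_add h \<theta>) ?P"
    unfolding posdef_def
  proof (intro ballI impI)
    fix x assume x: "x \<in> ?P" and "x \<noteq> 0"
    have xN: "x \<in> N" using x EN by blast
    have R: "\<chi> b x = 0" if "b \<in> ER" for b
    proof -
      have "\<chi> b c = 0" if c: "c \<in> E" for c
        using T(4)[of b c] \<open>b \<in> ER\<close> c disj by auto
      then have "E \<subseteq> {x \<in> UNIV. \<chi> b x = 0}" by blast
      then have "span E \<subseteq> {x \<in> UNIV. \<chi> b x = 0}"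
        by (intro span_minimal subspace_kernel T(2)) auto
      then show ?thesis using x by blast
    qed
    have "\<exists>b\<in>E. \<chi> b x \<noteq> 0"
    proof (rule ccontr)
      assume "\<not> ?thesis"
      then show False using T(3)[OF xN] R \<open>x \<noteq> 0\<close> by simp
    qed
    then obtain b where b: "b \<in> E" "\<chi> b x \<noteq> 0" by blast
    have "s k * (cmod (F k x))\<^sup>2 = 0" if k: "k \<in> \<mu> ` E" for k
    proof (cases "k = 0")
      case False
      obtain c where "c \<in> E" "k = \<mu> c" using k by blast
      then have "k \<in> {1..int q}" using \<mu>r[of c] False by simp
      then show ?thesis using x by simp
    qed (simp add: s_def)
    then have "(\<Sum>k\<in>\<mu> ` E. s k * (cmod (F k x))\<^sup>2) = 0" by (intro sum.neutral) blast
    then have "Re (herm_add h \<theta> x x) = (\<Sum>b\<in>E. w b * (cmod (\<chi> b x))\<^sup>2)"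
      using T(5)[OF xN] by (simp add: F_def)
    also have "\<dots> > 0"
    proof (rule sum_pos2[OF finE b(1)])
      show "0 < w b * (cmod (\<chi> b x))\<^sup>2" using w1[OF b(1)] b(2) by simp
      show "0 \<le> w c * (cmod (\<chi> c x))\<^sup>2" if "c \<in> E" for c using w1[OF that] by simp
    qed
    finally show "0 < Re (herm_add h \<theta> x x)" .
  qed
  then have "dim ?P \<le> pos (herm_add h \<theta>) N"
    using pos_ge[OF fdN sP] EN by blast
  moreover have "pos h N1 \<le> card E1" "pos h N2 \<le> card E2"
    unfolding pos_N1 pos_N2 using fin by (auto intro: card_mono)
  ultimately have "dim N + pos h N1 \<le> pos (herm_add h \<theta>) N + dim N1 \<or>
      dim N + pos h N2 \<le> pos (herm_add h \<theta>) N + dim N2"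
    using d dE unfolding dimN dimN1 dimN2 q_def by (simp add: max_def split: if_splits) linarith+
  then show ?thesis using that[OF T(1)] by blast
qed

text \<open>A null vector of \<open>E1\<close> is paired with a vector outside \<open>E1\<close> by
  an off-diagonal entry 1: the block with rows (0, 1) and (1, t) is nonsingular for every t. By the
  assumption, all null vectors of \<open>E2\<close> can be used up as partners; what survives in the
  radical besides \<open>ER\<close> are the unpaired null vectors of \<open>E1\<close>.\<close>

lemma exists_min_nullity_ordered:
  assumes le: "dim (perp h N2 N2) \<le> dim (perp h N1 N1)"
  obtains \<theta> where "adm K1 K2 \<theta>"
    "dim (perp (herm_add h \<theta>) N N) \<le> card ER \<or>
     dim (perp (herm_add h \<theta>) N N) + dim N \<le> dim N1 + dim (perp h N1 N1)"
proof -
  let ?Z1 = "{e \<in> E1. h e e = 0}" and ?Z2 = "{e \<in> E2. h e e = 0}"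
  \<comment> \<open>The number of pairs: limited by the null vectors of \<open>E1\<close> and by the
    possible partners. The first limit leaves only \<open>ER\<close> in the radical, the second one
    gives the other alternative of the conclusion.\<close>
  define c where "c = min (card ?Z1) (card (E2 \<union> EW))"
  have z: "card ?Z2 \<le> card ?Z1" using le unfolding nul_N1 nul_N2 by simp
  have "card ?Z2 \<le> card (E2 \<union> EW)" using fin by (intro card_mono) auto
  then obtain Y where Y: "?Z2 \<subseteq> Y" "Y \<subseteq> E2 \<union> EW" "card Y = c"
    using exists_subset_between[of ?Z2 c "E2 \<union> EW"] z fin by (auto simp: c_def)
  obtain Z where Z: "Z \<subseteq> ?Z1" "card Z = c"
    using exists_subset_between[of "{}" c ?Z1] fin by (auto simp: c_def)
  have fY: "finite Y" using finite_subset[OF Y(2)] fin by simp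
  have fZ: "finite Z" using finite_subset[OF Z(1)] fin by simp
  obtain g where g: "bij_betw g Z {1..int c}" using int_labels[OF fZ] Z by auto
  obtain f where f: "bij_betw f Y {1..int c}" using int_labels[OF fY] Y by auto
  have dZY: "b \<notin> Y" if "b \<in> Z" for b
    using that subsetD[OF Z(1)] subsetD[OF Y(2)] disj by blast
  have dE: "b \<notin> E1" if "b \<in> E2 \<or> b \<in> EW" for b using that disj by auto
  have dW: "b \<notin> EW" if "b \<in> E1 \<or> b \<in> E2" for b using that disj by auto
  define \<mu> where "\<mu> b = (if b \<in> Z then g b else if b \<in> Y then f b else 0)" for b
  define s where "s k = (if k = 0 then 0 else 1 :: real)" for k :: int
  \<comment> \<open>The diagonal entry is \<open>w b + s (\<mu> b)\<close>, so subtracting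
    \<open>s\<close> restores the prescribed value \<open>h b b\<close>; on \<open>EW\<close> it is
    free, and 1 makes unpaired vectors nondegenerate.\<close>
  define w where "w b = (if b \<in> EW then 1 else Re (h b b)) - s (\<mu> b)" for b
  have gr: "g b \<in> {1..int c}" if "b \<in> Z" for b using bij_betwE[OF g] that by blast
  have fr: "f b \<in> {1..int c}" if "b \<in> Y" for b using bij_betwE[OF f] that by blast
  have sZ: "s (\<mu> b) = 1" if "b \<in> Z" for b using gr[OF that] that by (auto simp: s_def \<mu>_def)
  have sY: "s (\<mu> b) = 1" if "b \<in> Y" for b using fr[OF that] that dZY by (auto simp: s_def \<mu>_def)
  have \<mu>0: "\<mu> b = 0" if "b \<notin> Z" "b \<notin> Y" for b using that by (simp add: \<mu>_def)
  have \<mu>Z: "\<mu> b = g b" if "b \<in> Z" for b using that by (simp add: \<mu>_def)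
  have \<mu>Y: "\<mu> b = f b" if "b \<in> Y" for b using that dZY by (auto simp: \<mu>_def)
  have injg: "b = b'" if "b \<in> Z" "b' \<in> Z" "g b = g b'" for b b'
    using bij_betw_imp_inj_on[OF g] that by (auto dest: inj_onD)
  have injf: "b = b'" if "b \<in> Y" "b' \<in> Y" "f b = f b'" for b b'
    using bij_betw_imp_inj_on[OF f] that by (auto dest: inj_onD)
  obtain \<theta> \<chi> where T: "adm K1 K2 \<theta>" "\<And>b. functional (\<chi> b)"
    "\<And>x. x \<in> N \<Longrightarrow> x = (\<Sum>b\<in>ER. \<chi> b x *s b) + (\<Sum>b\<in>E. \<chi> b x *s b)"
    "\<And>b x. b \<in> E \<Longrightarrow> x \<in> N \<Longrightarrow> herm_add h \<theta> b x =
       of_real (w b) * \<chi> b x + of_real (s (\<mu> b)) * (\<Sum>c | c \<in> E \<and> \<mu> c = \<mu> b. \<chi> c x)"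
  proof (rule realize_labelled[of w s \<mu>])
    show "h b b = complex_of_real (w b + s (\<mu> b))" if "b \<in> E1" for b
      using unit1[OF that] dW[of b] that by (auto simp: w_def)
    show "h b b = complex_of_real (w b + s (\<mu> b))" if "b \<in> E2" for b
      using unit2[OF that] dW[of b] that by (auto simp: w_def)
    show "s (\<mu> b) = 0" if "b \<in> E1" "c \<in> E1" "b \<noteq> c" "\<mu> b = \<mu> c" for b c
    proof -
      have Y: "b \<notin> Y" "c \<notin> Y" using that(1,2) subsetD[OF Y(2)] disj by blast+
      have "b \<notin> Z"
      proof
        assume b: "b \<in> Z"
        then have "c \<in> Z" using that(4) gr[OF b] \<mu>Z[OF b] \<mu>0[of c] Y(2) by fastforce
        then show False using injg[OF b] that(3,4) \<mu>Z b by simp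
      qed
      then show ?thesis using \<mu>0 Y by (simp add: s_def)
    qed
    show "s (\<mu> b) = 0" if "b \<in> E2" "c \<in> E2" "b \<noteq> c" "\<mu> b = \<mu> c" for b c
    proof -
      have Z: "b \<notin> Z" "c \<notin> Z" using that(1,2) subsetD[OF Z(1)] disj by blast+
      have "b \<notin> Y"
      proof
        assume b: "b \<in> Y"
        then have "c \<in> Y" using that(4) fr[OF b] \<mu>Y[OF b] \<mu>0[of c] Z(2) by fastforce
        then show False using injf[OF b] that(3,4) \<mu>Y b by simp
      qed
      then show ?thesis using \<mu>0 Z by (simp add: s_def)
    qed
  qed blast
  have ZE: "Z \<subseteq> E" and YE: "Y \<subseteq> E" using Z(1) Y(2) by blast+
  have "perp (herm_add h \<theta>) N N \<subseteq> span (ER \<union> (?Z1 - Z))"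
  proof
    fix x assume x: "x \<in> perp (herm_add h \<theta>) N N"
    then have xN: "x \<in> N" by (simp add: perp_def)
    have eq: "of_real (w b) * \<chi> b x + of_real (s (\<mu> b)) * (\<Sum>c | c \<in> E \<and> \<mu> c = \<mu> b. \<chi> c x) = 0"
      if b: "b \<in> E" for b
    proof -
      have "b \<in> N" using b E_sub_N by blast
      then show ?thesis using x T(4)[OF b xN] by (simp add: perp_def)
    qed
    have pair: "\<chi> a x = 0 \<and> \<chi> b x = 0" if a: "a \<in> Z" and b: "b \<in> Y" and ab: "g a = f b" for a b
    proof -
      have aE: "a \<in> E" "b \<in> E" using a b ZE YE by auto
      have ne: "a \<noteq> b" using dZY a b by blast
      have "{c \<in> E. \<mu> c = g a} = {a, b}"
      proof (intro equalityI subsetI)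
        fix d assume "d \<in> {c \<in> E. \<mu> c = g a}"
        then have d: "\<mu> d = g a" by simp
        have "\<mu> d \<noteq> 0" using d gr[OF a] by simp
        then consider "d \<in> Z" | "d \<in> Y" using \<mu>0 by blast
        then show "d \<in> {a, b}"
        proof cases
          case 1
          then show ?thesis using d \<mu>Z[OF 1] injg[OF 1 a] by simp
        next
          case 2
          then show ?thesis using d \<mu>Y[OF 2] injf[OF 2 b] ab by simp
        qed
      next
        fix d assume "d \<in> {a, b}"
        then show "d \<in> {c \<in> E. \<mu> c = g a}" using aE \<mu>Z[OF a] \<mu>Y[OF b] ab by fastforce
      qed
      then have S: "(\<Sum>c | c \<in> E \<and> \<mu> c = g a. \<chi> c x) = \<chi> a x + \<chi> b x" using ne by simp
      have "h a a = 0" "a \<notin> EW" using a Z(1) dW by auto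
      then have "w a = - 1" using sZ[OF a] by (simp add: w_def)
      \<comment> \<open>As \<open>w a = -1\<close>, the equation of \<open>a\<close> cancels its own
        coordinate and leaves that of its partner \<open>b\<close>; with this zero, the equation of
        \<open>b\<close> leaves the coordinate of \<open>a\<close>.\<close>
      then have "\<chi> b x = 0" using eq[OF aE(1)] S sZ[OF a] \<mu>Z[OF a] by simp
      moreover from this have "\<chi> a x = 0" using eq[OF aE(2)] S sY[OF b] \<mu>Y[OF b] ab by simp
      ultimately show ?thesis by simp
    qed
    have zero: "\<chi> b x = 0" if b: "b \<in> E" "b \<notin> ?Z1 - Z" for b
    proof -
      consider "b \<in> Z" | "b \<in> Y" | "b \<notin> Z" "b \<notin> Y" by blast
      then show ?thesis
      proof cases
        case 1
        then have "g b \<in> f ` Y" using gr f by (auto simp: bij_betw_def)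
        then show ?thesis using pair 1 by blast
      next
        case 2
        then have "f b \<in> g ` Z" using fr g by (auto simp: bij_betw_def)
        then obtain a where "a \<in> Z" "f b = g a" by blast
        then show ?thesis using pair[of a b] 2 by simp
      next
        case 3
        have "b \<notin> ?Z1" using b(2) 3 by blast
        moreover have "b \<notin> ?Z2" using 3(2) Y(1) by blast
        ultimately have nz: "h b b \<noteq> 0" if "b \<notin> EW" using b(1) that by blast
        have "h b b \<in> {1, -1, 0}" if "b \<notin> EW" using unit1 unit2 b(1) that by blast
        then have "Re (h b b) \<noteq> 0" if "b \<notin> EW" using nz that by auto
        then have "w b \<noteq> 0"
          using \<mu>0[OF 3] by (simp add: w_def s_def)
        then show ?thesis using eq[OF b(1)] \<mu>0[OF 3] by (simp add: s_def)
      qed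
    qed
    have "(\<Sum>b\<in>E. \<chi> b x *s b) = (\<Sum>b\<in>?Z1 - Z. \<chi> b x *s b)"
    proof (rule sum.mono_neutral_right[OF finE])
      show "?Z1 - Z \<subseteq> E" by blast
      show "\<forall>b\<in>E - (?Z1 - Z). \<chi> b x *s b = 0" using zero by simp
    qed
    then have "x = (\<Sum>b\<in>ER. \<chi> b x *s b) + (\<Sum>b\<in>?Z1 - Z. \<chi> b x *s b)"
      using T(3)[OF xN] by simp
    moreover have "(\<Sum>b\<in>ER. \<chi> b x *s b) + (\<Sum>b\<in>?Z1 - Z. \<chi> b x *s b) \<in> span (ER \<union> (?Z1 - Z))"
      by (intro span_add span_sum span_scale span_base) auto
    ultimately show "x \<in> span (ER \<union> (?Z1 - Z))" by simp
  qed
  then have "dim (perp (herm_add h \<theta>) N N) \<le> card (ER \<union> (?Z1 - Z))"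
    by (rule dim_le_card) (use fin in simp)
  also have "\<dots> \<le> card ER + card (?Z1 - Z)" by (rule card_Un_le)
  also have "card (?Z1 - Z) = card ?Z1 - c" using Z fZ by (simp add: card_Diff_subset)
  finally have "dim (perp (herm_add h \<theta>) N N) \<le> card ER + (card ?Z1 - c)" .
  moreover have "card (E2 \<union> EW) = card E2 + card EW" using fin disj by (simp add: card_Un_disjoint)
  ultimately have "dim (perp (herm_add h \<theta>) N N) \<le> card ER \<or>
     dim (perp (herm_add h \<theta>) N N) + dim N \<le> dim N1 + dim (perp h N1 N1)"
    unfolding nul_N1 dimN dimN1 c_def by linarith
  then show ?thesis using that[OF T(1)] by blast
qed

text \<open>The side with the larger radical supplies the null vectors to be paired; the other
  ordering follows by exchanging \<open>K1\<close> and \<open>K2\<close>.\<close>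

lemma exists_min_nullity:
  obtains \<theta> where "adm K1 K2 \<theta>"
    "dim (perp (herm_add h \<theta>) N N) \<le> card ER \<or>
     dim (perp (herm_add h \<theta>) N N) + dim N \<le> dim N1 + dim (perp h N1 N1) \<or>
     dim (perp (herm_add h \<theta>) N N) + dim N \<le> dim N2 + dim (perp h N2 N2)"
proof (cases "dim (perp h N2 N2) \<le> dim (perp h N1 N1)")
  case True
  then obtain \<theta> where t: "adm K1 K2 \<theta>"
    "dim (perp (herm_add h \<theta>) N N) \<le> card ER \<or>
     dim (perp (herm_add h \<theta>) N N) + dim N \<le> dim N1 + dim (perp h N1 N1)"
    using exists_min_nullity_ordered by blast
  show ?thesis by (rule that[OF t(1)]) (use t(2) in auto)
next
  case False
  then have le: "dim (perp h N1 N1) \<le> dim (perp h N2 N2)" by simp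
  obtain \<theta> where t: "adm K2 K1 \<theta>"
    "dim (perp (herm_add h \<theta>) N N) \<le> card ER \<or>
     dim (perp (herm_add h \<theta>) N N) + dim N \<le> dim N2 + dim (perp h N2 N2)"
    using frame.exists_min_nullity_ordered[OF frame_swap le] by blast
  show ?thesis
    by (rule that[OF adm_swap(1)[OF t(1)]]) (use t(2) adm_swap(2)[OF t(1)] in auto)
qed

end

section \<open>Bounds on the whole space and their attainment\<close>

context complex_vs
begin

text \<open>The form is diagonalised on an arbitrary complement of \<open>span B\<close>.
  Orthogonality to \<open>B\<close> is not claimed; in the application \<open>B\<close> lies in the
  radical.\<close>

lemma orthogonal_extension:
  assumes h: "hermitian h" and L: "fd L" and B: "finite B" "independent B" "B \<subseteq> L"
  obtains E where "finite E" "B \<inter> E = {}" "independent (B \<union> E)" "span (B \<union> E) = L"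
    "\<forall>x\<in>E. \<forall>y\<in>E. x \<noteq> y \<longrightarrow> h x y = 0" "\<forall>x\<in>E. h x x \<in> {1, -1, 0}"
proof -
  obtain C where C: "finite C" "B \<inter> C = {}" "independent (B \<union> C)" "span (B \<union> C) = L" "C \<subseteq> L"
    "dim L = card B + card C"
    by (rule basis_extend[OF L B(3,2)])
  obtain E where E: "orth_basis h (span C) E" "\<And>e. e \<in> E \<Longrightarrow> h e e \<in> {1, -1, 0}"
    using orth_basis_exists[OF h fd_span[OF C(1)]] by blast
  have E': "finite E" "independent E" "span E = span C" "\<forall>x\<in>E. \<forall>y\<in>E. x \<noteq> y \<longrightarrow> h x y = 0"
    using E(1) by (simp_all add: orth_basis_def)
  have "span B \<inter> span E \<subseteq> {0}" using span_Int_span_diff[OF C(3,2)] unfolding E'(3) by simp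
  note u = independent_UnI[OF B(2) E'(2) this B(1) E'(1)]
  have "span (B \<union> E) = span (B \<union> C)" unfolding span_Un E'(3) by simp
  then show ?thesis using that[OF E'(1) u(2,1) _ E'(4)] E(2) C(4) by simp
qed

lemma frame_exists:
  assumes h: "hermitian h" and N: "fd N" and K: "fd K1" "fd K2"
    and N1: "N1 = K1 \<inter> N" and N2: "N2 = K2 \<inter> N"
    and R: "\<And>x y. x \<in> N1 \<inter> N2 \<Longrightarrow> y \<in> N \<Longrightarrow> h x y = 0"
  obtains ER E1 E2 EW where "frame scale h N N1 N2 K1 K2 ER E1 E2 EW" "dim (N1 \<inter> N2) = card ER"
proof -
  have s1: "subspace N1" unfolding N1 by (rule subspace_inter[OF fd_subspace[OF K(1)] fd_subspace[OF N]])
  have s2: "subspace N2" unfolding N2 by (rule subspace_inter[OF fd_subspace[OF K(2)] fd_subspace[OF N]])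
  have fN1: "fd N1" by (rule fd_mono[OF N s1]) (simp add: N1)
  have fN2: "fd N2" by (rule fd_mono[OF N s2]) (simp add: N2)
  have fR: "fd (N1 \<inter> N2)" by (rule fd_mono[OF fN1 subspace_inter[OF s1 s2]]) simp
  obtain ER where ER: "finite ER" "independent ER" "span ER = N1 \<inter> N2" "dim (N1 \<inter> N2) = card ER" "ER \<subseteq> N1 \<inter> N2"
    by (rule fd_basis[OF fR])
  have ER12: "ER \<subseteq> N1" "ER \<subseteq> N2" using ER(5) by simp_all
  obtain E1 where E1: "finite E1" "ER \<inter> E1 = {}" "independent (ER \<union> E1)" "span (ER \<union> E1) = N1"
    "\<forall>x\<in>E1. \<forall>y\<in>E1. x \<noteq> y \<longrightarrow> h x y = 0" "\<forall>x\<in>E1. h x x \<in> {1, -1, 0}"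
    by (rule orthogonal_extension[OF h fN1 ER(1,2) ER12(1)])
  obtain E2 where E2: "finite E2" "ER \<inter> E2 = {}" "independent (ER \<union> E2)" "span (ER \<union> E2) = N2"
    "\<forall>x\<in>E2. \<forall>y\<in>E2. x \<noteq> y \<longrightarrow> h x y = 0" "\<forall>x\<in>E2. h x x \<in> {1, -1, 0}"
    by (rule orthogonal_extension[OF h fN2 ER(1,2) ER12(2)])
  have iE2: "independent E2" by (rule independent_mono[OF E2(3)]) simp
  have sE2: "span E2 \<subseteq> N2" unfolding E2(4)[symmetric] by (rule span_mono) simp
  have "span (ER \<union> E1) \<inter> span E2 \<subseteq> span ER \<inter> span E2" unfolding E1(4) ER(3) using sE2 by blast
  also have "\<dots> = {0}" by (rule span_Int_span_diff[OF E2(3,2)])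
  finally have "span (ER \<union> E1) \<inter> span E2 \<subseteq> {0}" .
  note u = independent_UnI[OF E1(3) iE2 this finite_UnI[OF ER(1) E1(1)] E2(1)]
  have "E1 \<subseteq> span (ER \<union> E1)" "E2 \<subseteq> span (ER \<union> E2)" by (rule subsetI, rule span_base, simp)+
  then have sub: "ER \<union> E1 \<union> E2 \<subseteq> N" using ER12(1) E1(4) E2(4) N1 N2 by auto
  obtain EW where EW: "finite EW" "(ER \<union> E1 \<union> E2) \<inter> EW = {}" "independent (ER \<union> E1 \<union> E2 \<union> EW)"
    "span (ER \<union> E1 \<union> E2 \<union> EW) = N" "EW \<subseteq> N" "dim N = card (ER \<union> E1 \<union> E2) + card EW"
    by (rule basis_extend[OF N sub u(1)])
  have "frame scale h N N1 N2 K1 K2 ER E1 E2 EW"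
  proof (rule frame.intro[OF complex_vs_axioms frame_axioms.intro])
    show "E1 \<inter> E2 = {}" using u(2) by blast
    show "ER \<inter> EW = {}" "E1 \<inter> EW = {}" "E2 \<inter> EW = {}" using EW(2) by blast+
    show "h x y = 0" if "x \<in> ER" "y \<in> N" for x y using R that ER(5) by blast
    show "h x y = 0" if "x \<in> E1" "y \<in> E1" "x \<noteq> y" for x y using that E1(5) by blast
    show "h x y = 0" if "x \<in> E2" "y \<in> E2" "x \<noteq> y" for x y using that E2(5) by blast
    show "h x x \<in> {1, -1, 0}" if "x \<in> E1" for x using that E1(6) by blast
    show "h x x \<in> {1, -1, 0}" if "x \<in> E2" for x using that E2(6) by blast
  qed (fact h K N1 N2 ER E1 E2 EW)+
  then show ?thesis using ER(4) that by blast
qed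

text \<open>All that the bounds need to know about a form of the family: what no admissible
  perturbation can change.\<close>

definition agrees :: "('v \<Rightarrow> 'v \<Rightarrow> complex) \<Rightarrow> ('v \<Rightarrow> 'v \<Rightarrow> complex) \<Rightarrow> 'v set \<Rightarrow> 'v set \<Rightarrow> 'v set \<Rightarrow> bool" where
  "agrees h H K1 K2 V \<longleftrightarrow> (\<forall>x\<in>K1. \<forall>y\<in>K1. H x y = h x y) \<and> (\<forall>x\<in>K2. \<forall>y\<in>K2. H x y = h x y) \<and>
     (\<forall>x\<in>K1 \<inter> K2. \<forall>y\<in>V. H x y = h x y)"

lemma agrees_uminus: "agrees h H K1 K2 V \<Longrightarrow> agrees (\<lambda>x y. - h x y) (\<lambda>x y. - H x y) K1 K2 V"
  by (simp add: agrees_def)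

lemma agrees_swap: "agrees h H K1 K2 V \<Longrightarrow> agrees h H K2 K1 V"
  by (auto simp: agrees_def)

lemma adm_agrees: "adm K1 K2 \<theta> \<Longrightarrow> agrees h (herm_add h \<theta>) K1 K2 V"
  by (simp add: agrees_def adm_def herm_add_def)

text \<open>The sum of \<open>pos_perp\<close> for \<open>h\<close> and for \<open>-h\<close>, with
  the indices traded for nullities by \<open>inertia_sum\<close>.\<close>

lemma nul_perp:
  assumes h: "hermitian h" and V: "fd V" and K: "subspace K" "K \<subseteq> V"
  shows "dim (perp h V V) + dim (perp h K K) = dim (perp h (perp h K V) (perp h K V)) + dim (perp h V K)"
proof -
  have fK: "fd K" and fN: "fd (perp h K V)" using fd_mono[OF V K] fd_perp[OF h V] by auto
  show ?thesis
    using inertia_sum[OF h V] inertia_sum[OF h fK] inertia_sum[OF h fN] dim_perp[OF h fK V]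
      pos_perp[OF assms] pos_perp[OF hermitian_uminus[OF h] V K]
    unfolding perp_uminus by linarith
qed

context
  fixes h H :: "'v \<Rightarrow> 'v \<Rightarrow> complex" and V K1 K2 :: "'v set"
  assumes h: "hermitian h" and H: "hermitian H" and V: "fd V"
    and K: "subspace K1" "subspace K2" "K1 \<subseteq> V" "K2 \<subseteq> V"
    and ag: "agrees h H K1 K2 V"
begin

lemma agrees_perp:
  "perp H (K1 \<inter> K2) V = perp h (K1 \<inter> K2) V" "perp H V (K1 \<inter> K2) = perp h V (K1 \<inter> K2)"
  "perp H (K1 \<inter> K2) (K1 \<inter> K2) = perp h (K1 \<inter> K2) (K1 \<inter> K2)"
proof -
  have e: "H x y = h x y" if "x \<in> K1 \<inter> K2" "y \<in> V" for x y using ag that by (simp add: agrees_def)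
  have e': "H y x = h y x" if "x \<in> K1 \<inter> K2" "y \<in> V" for x y
    unfolding hermitian_sym[OF H, of y x] hermitian_sym[OF h, of y x] e[OF that] ..
  show "perp H (K1 \<inter> K2) V = perp h (K1 \<inter> K2) V" "perp H V (K1 \<inter> K2) = perp h V (K1 \<inter> K2)"
    using e e' by (simp_all add: perp_def cong: conj_cong)
  show "perp H (K1 \<inter> K2) (K1 \<inter> K2) = perp h (K1 \<inter> K2) (K1 \<inter> K2)"
    using e K by (auto simp: perp_def)
qed

text \<open>Apart from the two values of \<open>pos H\<close>, every term depends on
  \<open>h\<close> alone, so extremising over \<open>V\<close> is the same as extremising over
  \<open>perp h (K1 \<inter> K2) V\<close>.\<close>

lemma pos_agrees_perp:
  "pos H V + dim (perp h V (K1 \<inter> K2)) =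
     pos h (K1 \<inter> K2) + pos H (perp h (K1 \<inter> K2) V) + dim (perp h (K1 \<inter> K2) (K1 \<inter> K2))"
proof -
  have s: "subspace (K1 \<inter> K2)" "K1 \<inter> K2 \<subseteq> V" using K by (auto simp: subspace_inter)
  have "pos H (K1 \<inter> K2) = pos h (K1 \<inter> K2)"
    by (rule pos_cong) (use ag in \<open>simp add: agrees_def\<close>)
  then show ?thesis using pos_perp[OF H V s] unfolding agrees_perp by simp
qed

lemma pos_upper: "pos H V + dim K1 \<le> dim V + pos h K1"
proof -
  have "pos H K1 = pos h K1" by (rule pos_cong) (use ag in \<open>simp add: agrees_def\<close>)
  then show ?thesis using pos_codim[OF H V K(1,3)] by simp
qed

text \<open>Plain monotonicity would only give \<open>pos h K1 \<le> pos H V\<close>. The sharper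
  bound compares the orthogonal complements of \<open>K1 \<inter> K2\<close> in \<open>K1\<close>
  and in \<open>V\<close>; applying \<open>pos_perp\<close> in both spaces, the terms that belong to
  \<open>K1 \<inter> K2\<close> alone cancel.\<close>

lemma pos_lower: "pos h K1 + dim (perp h K1 (K1 \<inter> K2)) \<le> pos H V + dim (perp h V (K1 \<inter> K2))"
proof -
  let ?K = "K1 \<inter> K2"
  have s: "subspace ?K" "?K \<subseteq> K1" using K by (auto simp: subspace_inter)
  have f1: "fd K1" using fd_mono[OF V K(1,3)] .
  have "pos h (perp h ?K K1) = pos H (perp h ?K K1)"
    by (rule pos_cong) (use ag in \<open>simp add: agrees_def perp_def\<close>)
  also have "\<dots> \<le> pos H (perp h ?K V)"
    using subspace_perp[OF h K(1)] K(3) by (intro pos_mono fd_perp[OF h V]) (auto simp: perp_def)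
  finally show ?thesis using pos_perp[OF h f1 s] pos_agrees_perp by linarith
qed

text \<open>A vector of \<open>K1 \<inter> K2\<close> that is orthogonal to \<open>V\<close> for
  \<open>h\<close> is so for \<open>H\<close> as well, hence lies in the radical of
  \<open>H\<close>.\<close>

lemma rank_upper: "pos H V + neg H V + dim (perp h V (K1 \<inter> K2)) \<le> dim V"
proof -
  have "perp H V (K1 \<inter> K2) \<subseteq> perp H V V" using K by (auto simp: perp_def)
  then have "dim (perp h V (K1 \<inter> K2)) \<le> dim (perp H V V)"
    using dim_mono[OF fd_perp[OF H V]] unfolding agrees_perp by blast
  then show ?thesis using inertia_sum[OF H V] by simp
qed

end

context
  fixes h :: "'v \<Rightarrow> 'v \<Rightarrow> complex" and V K1 K2 :: "'v set"
  assumes h: "hermitian h" and V: "fd V"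
    and K: "subspace K1" "subspace K2" "K1 \<subseteq> V" "K2 \<subseteq> V"
begin

lemma frame_perp:
  obtains ER E1 E2 EW where
    "frame scale h (perp h (K1 \<inter> K2) V) (perp h (K1 \<inter> K2) K1) (perp h (K1 \<inter> K2) K2) K1 K2 ER E1 E2 EW"
    "dim (perp h (K1 \<inter> K2) (K1 \<inter> K2)) = card ER"
proof -
  let ?K = "K1 \<inter> K2"
  have f: "fd K1" "fd K2" using fd_mono[OF V] K by blast+
  have e: "perp h ?K K1 = K1 \<inter> perp h ?K V" "perp h ?K K2 = K2 \<inter> perp h ?K V"
    "perp h ?K K1 \<inter> perp h ?K K2 = perp h ?K ?K"
    using K by (auto simp: perp_def)
  show ?thesis
  proof (rule frame_exists[OF h fd_perp[OF h V] f e(1,2)])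
    fix x y assume x: "x \<in> perp h ?K K1 \<inter> perp h ?K K2" and y: "y \<in> perp h ?K V"
    show "h x y = 0" using x y by (simp add: perp_def)
  qed (use that e(3) in auto)
qed

text \<open>Carries the frame result from \<open>perp h (K1 \<inter> K2) V\<close> to
  \<open>V\<close>: \<open>pos_perp\<close> is applied in \<open>V\<close>, \<open>K1\<close> and
  \<open>K2\<close> with the same subspace \<open>K1 \<inter> K2\<close>, whose own contributions
  drop out. The next two lemmas proceed alike.\<close>

lemma min_inertia_attained:
  obtains \<theta> where "adm K1 K2 \<theta>"
    "pos (herm_add h \<theta>) V + dim (perp h V (K1 \<inter> K2)) \<le>
       max (pos h K1 + dim (perp h K1 (K1 \<inter> K2))) (pos h K2 + dim (perp h K2 (K1 \<inter> K2)))"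
    "neg (herm_add h \<theta>) V + dim (perp h V (K1 \<inter> K2)) \<le>
       max (neg h K1 + dim (perp h K1 (K1 \<inter> K2))) (neg h K2 + dim (perp h K2 (K1 \<inter> K2)))"
proof -
  let ?K = "K1 \<inter> K2"
  obtain ER E1 E2 EW where fr: "frame scale h (perp h ?K V) (perp h ?K K1) (perp h ?K K2) K1 K2 ER E1 E2 EW"
    by (rule frame_perp)
  obtain \<theta> where t: "adm K1 K2 \<theta>"
    "pos (herm_add h \<theta>) (perp h ?K V) \<le> max (pos h (perp h ?K K1)) (pos h (perp h ?K K2))"
    "neg (herm_add h \<theta>) (perp h ?K V) \<le> max (neg h (perp h ?K K1)) (neg h (perp h ?K K2))"
    by (rule frame.exists_min_inertia[OF fr])
  have H: "hermitian (herm_add h \<theta>)" using t(1) hermitian_herm_add[OF h] by (simp add: adm_def)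
  note ag = adm_agrees[OF t(1), of h V]
  have f: "fd K1" "fd K2" using fd_mono[OF V] K by blast+
  have s: "subspace ?K" "?K \<subseteq> K1" "?K \<subseteq> K2" using K by (auto simp: subspace_inter)
  note u = hermitian_uminus[OF h]
  show ?thesis
  proof (rule that[OF t(1)])
    show "pos (herm_add h \<theta>) V + dim (perp h V ?K) \<le>
       max (pos h K1 + dim (perp h K1 ?K)) (pos h K2 + dim (perp h K2 ?K))"
      using t(2) pos_agrees_perp[OF h H V K ag] pos_perp[OF h f(1) s(1,2)] pos_perp[OF h f(2) s(1,3)]
      by linarith
    show "neg (herm_add h \<theta>) V + dim (perp h V ?K) \<le>
       max (neg h K1 + dim (perp h K1 ?K)) (neg h K2 + dim (perp h K2 ?K))"
      using t(3) pos_agrees_perp[OF u hermitian_uminus[OF H] V K agrees_uminus[OF ag]]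
        pos_perp[OF u f(1) s(1,2)] pos_perp[OF u f(2) s(1,3)]
      unfolding perp_uminus by linarith
  qed
qed

lemma max_pos_attained:
  obtains \<theta> where "adm K1 K2 \<theta>"
    "dim V + pos h K1 \<le> pos (herm_add h \<theta>) V + dim K1 \<or> dim V + pos h K2 \<le> pos (herm_add h \<theta>) V + dim K2"
proof -
  let ?K = "K1 \<inter> K2"
  obtain ER E1 E2 EW where fr: "frame scale h (perp h ?K V) (perp h ?K K1) (perp h ?K K2) K1 K2 ER E1 E2 EW"
    by (rule frame_perp)
  obtain \<theta> where t: "adm K1 K2 \<theta>"
    "dim (perp h ?K V) + pos h (perp h ?K K1) \<le> pos (herm_add h \<theta>) (perp h ?K V) + dim (perp h ?K K1) \<or>
     dim (perp h ?K V) + pos h (perp h ?K K2) \<le> pos (herm_add h \<theta>) (perp h ?K V) + dim (perp h ?K K2)"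
    by (rule frame.exists_max_pos[OF fr])
  have H: "hermitian (herm_add h \<theta>)" using t(1) hermitian_herm_add[OF h] by (simp add: adm_def)
  note ag = adm_agrees[OF t(1), of h V]
  have f: "fd K1" "fd K2" using fd_mono[OF V] K by blast+
  have s: "subspace ?K" "?K \<subseteq> K1" "?K \<subseteq> K2" using K by (auto simp: subspace_inter)
  have fK: "fd ?K" using fd_mono[OF f(1) s(1,2)] .
  show ?thesis
    by (rule that[OF t(1)])
      (use t(2) pos_agrees_perp[OF h H V K ag] pos_perp[OF h f(1) s(1,2)] pos_perp[OF h f(2) s(1,3)]
        dim_perp[OF h fK V] dim_perp[OF h fK f(1)] dim_perp[OF h fK f(2)] in linarith)
qed

lemma min_nullity_attained:
  obtains \<theta> where "adm K1 K2 \<theta>"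
    "dim (perp (herm_add h \<theta>) V V) \<le> dim (perp h V (K1 \<inter> K2)) \<or>
     dim (perp (herm_add h \<theta>) V V) + dim V \<le> dim K1 + dim (perp h K1 K1) \<or>
     dim (perp (herm_add h \<theta>) V V) + dim V \<le> dim K2 + dim (perp h K2 K2)"
proof -
  let ?K = "K1 \<inter> K2"
  obtain ER E1 E2 EW where fr: "frame scale h (perp h ?K V) (perp h ?K K1) (perp h ?K K2) K1 K2 ER E1 E2 EW"
      "dim (perp h ?K ?K) = card ER"
    by (rule frame_perp)
  obtain \<theta> where t: "adm K1 K2 \<theta>"
    "dim (perp (herm_add h \<theta>) (perp h ?K V) (perp h ?K V)) \<le> card ER \<or>
     dim (perp (herm_add h \<theta>) (perp h ?K V) (perp h ?K V)) + dim (perp h ?K V) \<le>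
       dim (perp h ?K K1) + dim (perp h (perp h ?K K1) (perp h ?K K1)) \<or>
     dim (perp (herm_add h \<theta>) (perp h ?K V) (perp h ?K V)) + dim (perp h ?K V) \<le>
       dim (perp h ?K K2) + dim (perp h (perp h ?K K2) (perp h ?K K2))"
    by (rule frame.exists_min_nullity[OF fr(1)])
  have H: "hermitian (herm_add h \<theta>)" using t(1) hermitian_herm_add[OF h] by (simp add: adm_def)
  note ag = adm_agrees[OF t(1), of h V]
  have f: "fd K1" "fd K2" using fd_mono[OF V] K by blast+
  have s: "subspace ?K" "?K \<subseteq> K1" "?K \<subseteq> K2" "?K \<subseteq> V" using K by (auto simp: subspace_inter)
  have fK: "fd ?K" using fd_mono[OF f(1) s(1,2)] .
  \<comment> \<open>Since \<open>card ER\<close> is the dimension of the radical of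
    \<open>K1 \<inter> K2\<close>, this identity turns nullity \<open>card ER\<close> on the
    complement into nullity \<open>dim (perp h V ?K)\<close> on \<open>V\<close>.\<close>
  have n: "dim (perp (herm_add h \<theta>) V V) + dim (perp h ?K ?K) =
      dim (perp (herm_add h \<theta>) (perp h ?K V) (perp h ?K V)) + dim (perp h V ?K)"
    using nul_perp[OF H V s(1,4)] unfolding agrees_perp[OF h H V K ag] .
  show ?thesis
    by (rule that[OF t(1)])
      (use t(2) n nul_perp[OF h f(1) s(1,2)] nul_perp[OF h f(2) s(1,3)] fr(2)
        dim_perp[OF h fK V] dim_perp[OF h fK f(1)] dim_perp[OF h fK f(2)] in linarith)
qed

end

end

section \<open>Matrices as sesquilinear forms\<close>

text \<open>Vectors of every length are functions on nat that vanish from some index on. Spaces of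
  dimension m and m + m and the maps between them then live in one type, as \<open>linmap\<close>
  demands.\<close>

definition cscale :: "complex \<Rightarrow> (nat \<Rightarrow> complex) \<Rightarrow> nat \<Rightarrow> complex" where
  "cscale c f = (\<lambda>i. c * f i)"

lemma cscale_apply [simp]: "cscale c f i = c * f i"
  by (simp add: cscale_def)

interpretation fv: complex_vs cscale
  by unfold_locales (auto simp: fun_eq_iff algebra_simps)

definition space :: "nat \<Rightarrow> (nat \<Rightarrow> complex) set" where
  "space n = {x. \<forall>i\<ge>n. x i = 0}"

definition e_vec :: "nat \<Rightarrow> nat \<Rightarrow> complex" where
  "e_vec i = (\<lambda>j. if j = i then 1 else 0)"

lemma sum_fun_apply: "(sum f I :: nat \<Rightarrow> complex) i = (\<Sum>k\<in>I. f k i)"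
  by (induction I rule: infinite_finite_induct) auto

lemma subspace_space: "fv.subspace (space n)"
  by (auto simp: fv.subspace_def space_def)

lemma e_vec_space: "i < n \<Longrightarrow> e_vec i \<in> space n"
  by (auto simp: e_vec_def space_def)

lemma space_expand: "x \<in> space n \<Longrightarrow> x = (\<Sum>i<n. cscale (x i) (e_vec i))"
  by (auto simp: fun_eq_iff sum_fun_apply e_vec_def space_def if_distrib[of "(*) _"] cong: if_cong)

lemma inj_e_vec: "inj_on e_vec A"
  by (auto simp: inj_on_def e_vec_def fun_eq_iff split: if_splits)

lemma fd_space: "fv.fd (space n)" and dim_space: "fv.dim (space n) = n"
proof -
  have sub: "e_vec ` {..<n} \<subseteq> space n" using e_vec_space by blast
  have sp: "space n \<subseteq> fv.span (e_vec ` {..<n})"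
  proof
    fix x assume "x \<in> space n"
    then have x: "x = (\<Sum>i<n. cscale (x i) (e_vec i))" by (rule space_expand)
    show "x \<in> fv.span (e_vec ` {..<n})"
      by (subst x, intro fv.span_sum fv.span_scale fv.span_base imageI)
  qed
  then show "fv.fd (space n)"
    unfolding fv.fd_def using subspace_space by blast
  have "fv.independent (e_vec ` {..<n})"
  proof (rule fv.independent_if_scalars_zero)
    fix f x assume s: "(\<Sum>x\<in>e_vec ` {..<n}. cscale (f x) x) = 0" and "x \<in> e_vec ` {..<n}"
    then obtain i where i: "i < n" "x = e_vec i" by blast
    have "0 = (\<Sum>x\<in>e_vec ` {..<n}. cscale (f x) x) i" using s by simp
    also have "\<dots> = (\<Sum>j<n. f (e_vec j) * e_vec j i)"
      by (simp add: sum.reindex[OF inj_e_vec] sum_fun_apply)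
    also have "\<dots> = f x" using i by (simp add: e_vec_def if_distrib[of "(*) _"] cong: if_cong)
    finally show "f x = 0" by simp
  qed simp
  then show "fv.dim (space n) = n"
    using fv.dim_unique[OF sub sp] card_image[OF inj_e_vec, of "{..<n}"] by simp
qed

definition ip :: "nat \<Rightarrow> (nat \<Rightarrow> complex) \<Rightarrow> (nat \<Rightarrow> complex) \<Rightarrow> complex" where
  "ip n x y = (\<Sum>i<n. cnj (x i) * y i)"

lemma hermitian_ip: "fv.hermitian (ip n)"
  by (simp add: fv.hermitian_def fv.functional_def ip_def distrib_left sum.distrib sum_distrib_left mult.left_commute)
    (simp add: mult.commute)

lemma ip_self: "ip n x x = of_real (\<Sum>i<n. (cmod (x i))\<^sup>2)"
  by (simp add: ip_def complex_norm_square mult.commute del: of_real_power)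

lemma ip_self_pos:
  assumes "x \<in> space n" "x \<noteq> 0"
  shows "0 < Re (ip n x x)"
proof -
  obtain i where i: "x i \<noteq> 0" using assms(2) by (auto simp: fun_eq_iff)
  then have "i < n" using assms(1) by (auto simp: space_def not_le[symmetric])
  then have "0 < (\<Sum>i<n. (cmod (x i))\<^sup>2)" using i by (intro sum_pos2[of _ i]) auto
  then show ?thesis unfolding ip_self by simp
qed

text \<open>The inner product is definite, so the correction term \<open>perp (ip n) V K\<close> in
  \<open>dim_perp\<close> is zero.\<close>

lemma dim_ip_perp:
  assumes "fv.fd K" "fv.fd V" "K \<subseteq> V" "V \<subseteq> space n"
  shows "fv.dim V = fv.dim K + fv.dim (fv.perp (ip n) K V)"
proof -
  have "x = 0" if "x \<in> fv.perp (ip n) V K" for x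
  proof (rule ccontr)
    assume "x \<noteq> 0"
    moreover have "x \<in> V" "ip n x x = 0" using that assms by (auto simp: fv.perp_def)
    ultimately show False using ip_self_pos[of x n] assms(4) by auto
  qed
  then have "fv.perp (ip n) V K \<subseteq> fv.span {}" by auto
  then have "fv.dim (fv.perp (ip n) V K) = 0" using fv.dim_le_card[of _ "{}"] by fastforce
  then show ?thesis using fv.dim_perp[OF hermitian_ip assms(1,2), of n] by simp
qed

text \<open>The row vector \<open>x\<^sup>* M\<close>, the adjoint action \<open>M\<^sup>* x\<close> and the form \<open>x\<^sup>* M y\<close>.\<close>

definition lmul :: "(nat \<Rightarrow> complex) \<Rightarrow> complex mat \<Rightarrow> nat \<Rightarrow> complex" where
  "lmul x M j = (\<Sum>i<dim_row M. cnj (x i) * M $$ (i, j))"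

definition adj :: "complex mat \<Rightarrow> (nat \<Rightarrow> complex) \<Rightarrow> nat \<Rightarrow> complex" where
  "adj M x j = (if j < dim_col M then cnj (lmul x M j) else 0)"

definition form :: "complex mat \<Rightarrow> (nat \<Rightarrow> complex) \<Rightarrow> (nat \<Rightarrow> complex) \<Rightarrow> complex" where
  "form M x y = (\<Sum>j<dim_col M. lmul x M j * y j)"

lemma lmul_add: "lmul (x + y) M j = lmul x M j + lmul y M j"
  by (simp add: lmul_def algebra_simps sum.distrib)

lemma lmul_zero: "lmul 0 M j = 0"
  by (simp add: lmul_def)

lemma lmul_scale: "lmul (cscale c x) M j = cnj c * lmul x M j"
  by (simp add: lmul_def algebra_simps sum_distrib_left)

lemma linmap_adj: "fv.linmap (adj M)"
  by (auto simp: fv.linmap_def adj_def fun_eq_iff lmul_add lmul_scale)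

lemma adj_space: "adj M x \<in> space (dim_col M)"
  by (simp add: adj_def space_def)

lemma form_as_ip: "form M x y = ip (dim_col M) (adj M x) y"
  by (simp add: form_def ip_def adj_def)

lemma mat_adjoint_index [simp]:
  "i < dim_col M \<Longrightarrow> j < dim_row M \<Longrightarrow> mat_adjoint M $$ (i, j) = cnj (M $$ (j, i))"
  "dim_row (mat_adjoint M) = dim_col M" "dim_col (mat_adjoint M) = dim_row M"
  by (simp_all add: mat_adjoint_def mat_of_rows_def)

lemma form_sym: "form (mat_adjoint M) y x = cnj (form M x y)"
proof -
  have "form (mat_adjoint M) y x = (\<Sum>j<dim_row M. \<Sum>i<dim_col M. cnj (y i) * cnj (M $$ (j, i)) * x j)"
    by (simp add: form_def lmul_def sum_distrib_right)
  also have "\<dots> = (\<Sum>i<dim_col M. \<Sum>j<dim_row M. cnj (y i) * cnj (M $$ (j, i)) * x j)"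
    by (rule sum.swap)
  also have "\<dots> = cnj (form M x y)"
    by (simp add: form_def lmul_def sum_distrib_left mult_ac)
  finally show ?thesis .
qed

lemma form_adjoint: "form (mat_adjoint M) y x = ip (dim_col M) y (adj M x)"
  using fv.hermitian_sym[OF hermitian_ip, of "dim_col M" y "adj M x"] form_sym[of M y x]
  by (simp add: form_as_ip[of M])

lemma functional_form: "fv.functional (form M x)"
  by (simp add: fv.functional_def form_def algebra_simps sum.distrib sum_distrib_left)

lemma herm_matsD: "M \<in> herm_mats n \<Longrightarrow> M \<in> carrier_mat n n" "M \<in> herm_mats n \<Longrightarrow> mat_adjoint M = M"
  by (simp_all add: herm_mats_def)

lemma hermitian_form:
  assumes "M \<in> herm_mats n"
  shows "fv.hermitian (form M)"
  unfolding fv.hermitian_def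
proof (intro conjI allI functional_form)
  show "form M y x = cnj (form M x y)" for x y
    using form_sym[of M y x] unfolding herm_matsD(2)[OF assms] .
qed

lemma lmul_mult:
  assumes "M \<in> carrier_mat n k" "N \<in> carrier_mat k l" "j < l"
  shows "lmul x (M * N) j = lmul (adj M x) N j"
proof -
  have "lmul x (M * N) j = (\<Sum>i<n. \<Sum>t<k. cnj (x i) * M $$ (i, t) * N $$ (t, j))"
    using assms by (simp add: lmul_def scalar_prod_def sum_distrib_left mult.assoc atLeast0LessThan)
  also have "\<dots> = (\<Sum>t<k. \<Sum>i<n. cnj (x i) * M $$ (i, t) * N $$ (t, j))" by (rule sum.swap)
  also have "\<dots> = lmul (adj M x) N j"
    using assms by (simp add: lmul_def adj_def sum_distrib_right)
  finally show ?thesis .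
qed

lemma form_mult_left:
  assumes "M \<in> carrier_mat n k" "N \<in> carrier_mat k l"
  shows "form (M * N) x y = form N (adj M x) y"
  using assms lmul_mult[OF assms] by (simp add: form_def)

lemma form_mult_adjoint:
  assumes "N \<in> carrier_mat l k" "M \<in> carrier_mat n k"
  shows "form (N * mat_adjoint M) x y = form N x (adj M y)"
proof -
  have c: "mat_adjoint M \<in> carrier_mat k n" using assms by (intro carrier_matI) auto
  have "form (N * mat_adjoint M) x y = form (mat_adjoint M) (adj N x) y"
    by (rule form_mult_left[OF assms(1) c])
  also have "\<dots> = form N x (adj M y)"
    using assms by (simp add: form_adjoint form_as_ip[of N])
  finally show ?thesis .
qed

lemma lmul_minus:
  assumes "M \<in> carrier_mat n k" "N \<in> carrier_mat n k" "j < k"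
  shows "lmul x (M - N) j = lmul x M j - lmul x N j"
  using assms by (simp add: lmul_def algebra_simps sum_subtractf)

lemma form_minus:
  assumes "M \<in> carrier_mat n k" "N \<in> carrier_mat n k"
  shows "form (M - N) x y = form M x y - form N x y"
proof -
  have "form (M - N) x y = (\<Sum>j<k. lmul x (M - N) j * y j)" using assms by (simp add: form_def)
  also have "\<dots> = (\<Sum>j<k. lmul x M j * y j - lmul x N j * y j)"
    by (rule sum.cong) (simp_all add: lmul_minus[OF assms] left_diff_distrib)
  finally show ?thesis using assms by (simp add: form_def sum_subtractf)
qed

lemma lmul_e_vec: "i < dim_row M \<Longrightarrow> lmul (e_vec i) M j = M $$ (i, j)"
proof -
  assume "i < dim_row M"
  have "lmul (e_vec i) M j = (\<Sum>t<dim_row M. if t = i then M $$ (t, j) else 0)"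
    unfolding lmul_def by (rule sum.cong) (simp_all add: e_vec_def)
  then show ?thesis using \<open>i < dim_row M\<close> by simp
qed

lemma form_right_e_vec: "j < dim_col M \<Longrightarrow> form M x (e_vec j) = lmul x M j"
  by (simp add: form_def e_vec_def if_distrib[of "(*) _"] cong: if_cong)

lemma form_e_vec: "i < dim_row M \<Longrightarrow> j < dim_col M \<Longrightarrow> form M (e_vec i) (e_vec j) = M $$ (i, j)"
  by (simp add: form_right_e_vec lmul_e_vec)

lemma lmul_zero_iff:
  assumes "dim_col M = k"
  shows "(\<forall>j<k. lmul x M j = 0) \<longleftrightarrow> (\<forall>y\<in>space k. form M x y = 0)"
proof
  assume "\<forall>y\<in>space k. form M x y = 0"
  then show "\<forall>j<k. lmul x M j = 0" using form_right_e_vec[of _ M x] e_vec_space assms by metis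
qed (use assms in \<open>simp add: form_def\<close>)

lemma adj_zero_iff: "adj M x = 0 \<longleftrightarrow> (\<forall>j<dim_col M. lmul x M j = 0)"
  by (auto simp: adj_def fun_eq_iff)

lemma mat_eq_form:
  assumes "M \<in> carrier_mat n n" "N \<in> carrier_mat n n"
    and "\<And>x y. x \<in> space n \<Longrightarrow> y \<in> space n \<Longrightarrow> form M x y = form N x y"
  shows "M = N"
proof (rule eq_matI)
  fix i j assume "i < dim_row N" "j < dim_col N"
  then have ij: "i < n" "j < n" using assms by auto
  show "M $$ (i, j) = N $$ (i, j)"
    using assms(3)[OF e_vec_space[OF ij(1)] e_vec_space[OF ij(2)]] assms(1,2) ij
    by (simp add: form_e_vec)
qed (use assms in auto)

lemma form_of_sesq:
  assumes "fv.sesq \<theta>" "x \<in> space n" "y \<in> space n"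
  shows "form (mat n n (\<lambda>(i, j). \<theta> (e_vec i) (e_vec j))) x y = \<theta> x y"
proof -
  have r: "fv.functional (\<theta> u)" and l: "fv.functional (\<lambda>u. cnj (\<theta> u v))" for u v
    using assms(1) by (auto simp: fv.sesq_def)
  have "\<theta> x y = \<theta> x (\<Sum>j<n. cscale (y j) (e_vec j))" using space_expand[OF assms(3)] by simp
  also have "\<dots> = (\<Sum>j<n. y j * \<theta> x (e_vec j))"
    by (simp add: fv.functionalD[OF r])
  also have "\<dots> = (\<Sum>j<n. (\<Sum>i<n. cnj (x i) * \<theta> (e_vec i) (e_vec j)) * y j)"
  proof (rule sum.cong[OF refl])
    fix j
    have "cnj (\<theta> x (e_vec j)) = cnj (\<theta> (\<Sum>i<n. cscale (x i) (e_vec i)) (e_vec j))"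
      using space_expand[OF assms(2)] by simp
    also have "\<dots> = (\<Sum>i<n. x i * cnj (\<theta> (e_vec i) (e_vec j)))"
      by (simp add: fv.functionalD[OF l])
    finally have "cnj (cnj (\<theta> x (e_vec j))) = cnj (\<Sum>i<n. x i * cnj (\<theta> (e_vec i) (e_vec j)))"
      by (rule arg_cong)
    then show "y j * \<theta> x (e_vec j) = (\<Sum>i<n. cnj (x i) * \<theta> (e_vec i) (e_vec j)) * y j" by simp
  qed
  finally show ?thesis by (simp add: form_def lmul_def)
qed

section \<open>Rank and inertia of matrices\<close>

definition of_vec :: "complex vec \<Rightarrow> nat \<Rightarrow> complex" where
  "of_vec v i = (if i < dim_vec v then v $ i else 0)"

lemma of_vec_space: "v \<in> carrier_vec n \<Longrightarrow> of_vec v \<in> space n"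
  by (auto simp: of_vec_def space_def)

lemma inj_of_vec: "A \<subseteq> carrier_vec n \<Longrightarrow> inj_on of_vec A"
proof (rule inj_onI)
  fix v w assume A: "A \<subseteq> carrier_vec n" and vw: "v \<in> A" "w \<in> A" "of_vec v = of_vec w"
  then have "dim_vec v = n" "dim_vec w = n" by auto
  then show "v = w" using vw(3) by (intro eq_vecI) (auto simp: of_vec_def fun_eq_iff split: if_splits)
qed

lemma of_vec_lincomb:
  assumes "A \<subseteq> carrier_vec n" "finite A"
  shows "of_vec (module.lincomb (module_vec TYPE(complex) n) a A) = (\<Sum>v\<in>A. cscale (a v) (of_vec v))"
proof -
  interpret vec_space "TYPE(complex)" n .
  have d: "dim_vec (lincomb a A) = n" using lincomb_dim[OF assms(2,1)] .
  show ?thesis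
  proof
    fix i
    have dv: "dim_vec v = n" if "v \<in> A" for v using assms(1) that by auto
    show "of_vec (lincomb a A) i = (\<Sum>v\<in>A. cscale (a v) (of_vec v)) i"
    proof (cases "i < n")
      case True
      then show ?thesis
        using dv by (simp add: of_vec_def d lincomb_index[OF True assms(1)] sum_fun_apply)
    next
      case False
      then show ?thesis using dv by (simp add: of_vec_def d sum_fun_apply)
    qed
  qed
qed

lemma lin_dep_of_vec:
  assumes "S \<subseteq> carrier_vec n"
  shows "module.lin_dep class_ring (module_vec TYPE(complex) n) S \<longleftrightarrow> fv.dependent (of_vec ` S)"
proof -
  interpret vec_space "TYPE(complex)" n .
  have z: "lincomb a A = 0\<^sub>v n \<longleftrightarrow> (\<Sum>v\<in>A. cscale (a v) (of_vec v)) = 0"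
    if "A \<subseteq> S" "finite A" for a A
  proof -
    have "lincomb a A \<in> carrier_vec n" using that assms by (intro lincomb_closed) auto
    moreover have "of_vec (0\<^sub>v n) = 0" by (auto simp: of_vec_def fun_eq_iff)
    moreover have "inj_on of_vec (carrier_vec n)" by (rule inj_of_vec[OF order_refl])
    ultimately have "lincomb a A = 0\<^sub>v n \<longleftrightarrow> of_vec (lincomb a A) = 0"
      using inj_on_eq_iff[of of_vec "carrier_vec n" "lincomb a A" "0\<^sub>v n"] by simp
    also have "of_vec (lincomb a A) = (\<Sum>v\<in>A. cscale (a v) (of_vec v))"
      using that assms by (intro of_vec_lincomb) auto
    finally show ?thesis .
  qed
  show ?thesis
  proof
    assume "lin_dep S"
    then obtain A a v where A: "finite A" "A \<subseteq> S" "lincomb a A = 0\<^sub>v n" "v \<in> A" "a v \<noteq> 0"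
      unfolding lin_dep_def by auto
    have inj: "inj_on of_vec A" using inj_of_vec A(2) assms by blast
    let ?u = "\<lambda>w. a (inv_into A of_vec w)"
    have "(\<Sum>w\<in>of_vec ` A. cscale (?u w) w) = 0"
      using z[OF A(2,1)] A(3) inj by (simp add: sum.reindex)
    moreover have "?u (of_vec v) \<noteq> 0" using A inj by simp
    ultimately show "fv.dependent (of_vec ` S)"
      unfolding fv.dependent_explicit using A by (intro exI[of _ "of_vec ` A"] exI[of _ ?u]) auto
  next
    assume "fv.dependent (of_vec ` S)"
    then obtain t u where t: "finite t" "t \<subseteq> of_vec ` S" "(\<Sum>v\<in>t. cscale (u v) v) = 0" "\<exists>v\<in>t. u v \<noteq> 0"
      unfolding fv.dependent_explicit by blast
    obtain A where A: "A \<subseteq> S" "finite A" "t = of_vec ` A" using finite_subset_image[OF t(1,2)] by blast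
    have inj: "inj_on of_vec A" using inj_of_vec A(1) assms by blast
    have "(\<Sum>v\<in>A. cscale (u (of_vec v)) (of_vec v)) = 0"
      using t(3) unfolding A(3) sum.reindex[OF inj] by simp
    then have "lincomb (\<lambda>v. u (of_vec v)) A = 0\<^sub>v n" using z[OF A(1,2)] by blast
    moreover obtain v where "v \<in> A" "u (of_vec v) \<noteq> 0" using t(4) A(3) by blast
    ultimately show "lin_dep S"
      unfolding lin_dep_def using A by (intro exI[of _ A] exI[of _ "\<lambda>v. u (of_vec v)"] exI[of _ v]) auto
  qed
qed

text \<open>The rank equals the size of a maximal independent set of columns; by maximality its
  image under \<open>of_vec\<close> spans all columns.\<close>

lemma rank_dim_cols:
  assumes M: "M \<in> carrier_mat n k"
  shows "rank_mat M = fv.dim (fv.span (of_vec ` set (cols M)))"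
proof -
  interpret vec_space "TYPE(complex)" n .
  let ?P = "\<lambda>T. T \<subseteq> set (cols M) \<and> lin_indpt T"
  have C: "set (cols M) \<subseteq> carrier_vec n" using cols_dim M by blast
  have "?P {}" using lin_dep_of_vec[of "{}" n] fv.independent_empty by auto
  then obtain S where S: "finite S" "maximal S ?P"
    using maximal_exists_superset[of "set (cols M)" ?P "{}"] by blast
  have SC: "S \<subseteq> set (cols M)" "lin_indpt S" using S(2) by (auto simp: maximal_def)
  have i: "fv.independent (of_vec ` S)" using lin_dep_of_vec[of S n] SC C by auto
  have sp: "of_vec ` set (cols M) \<subseteq> fv.span (of_vec ` S)"
  proof
    fix x assume "x \<in> of_vec ` set (cols M)"
    then obtain c where c: "c \<in> set (cols M)" "x = of_vec c" by blast
    show "x \<in> fv.span (of_vec ` S)"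
    proof (rule ccontr)
      assume x: "x \<notin> fv.span (of_vec ` S)"
      then have "fv.independent (of_vec ` insert c S)"
        using fv.independent_insertI[OF _ i] c by simp
      then have "?P (insert c S)" using lin_dep_of_vec[of "insert c S" n] SC C c by auto
      then have "insert c S = S" using S(2) unfolding maximal_def by blast
      then have "x \<in> of_vec ` S" using c by blast
      then show False using x fv.span_base by blast
    qed
  qed
  have "card (of_vec ` S) = card S"
    by (rule card_image[OF inj_of_vec[of S n]]) (use SC C in blast)
  then have "fv.dim (of_vec ` set (cols M)) = card S"
    using fv.dim_unique[OF _ sp i] SC by blast
  moreover have "rank M = card S" by (rule rank_card_indpt[OF M S(2)])
  ultimately show ?thesis using M by simp
qed

text \<open>The left kernel is the orthogonal complement of the column space. Left kernels are
  preferred because they are stated with the adjoint action, hence with \<open>L\<close>.\<close>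

lemma rank_left_kernel:
  assumes M: "M \<in> carrier_mat n k"
  shows "rank_mat M + fv.dim {x \<in> space n. \<forall>j<k. lmul x M j = 0} = n"
proof -
  let ?C = "of_vec ` set (cols M)" and ?K = "fv.span (of_vec ` set (cols M))"
  have "?C \<subseteq> space n" using of_vec_space cols_dim[of M] M by auto
  then have K: "?K \<subseteq> space n" by (intro fv.span_minimal subspace_space)
  have fK: "fv.fd ?K" by (rule fv.fd_span) simp
  have c: "ip n (of_vec (col M j)) x = cnj (lmul x M j)" if "j < k" for j x
    using that M by (simp add: ip_def lmul_def of_vec_def mult.commute)
  have C: "set (cols M) = col M ` {..<k}" using M by (auto simp: cols_def)
  have "fv.perp (ip n) ?K (space n) = {x \<in> space n. \<forall>j<k. lmul x M j = 0}"
  proof (intro equalityI subsetI)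
    fix x assume "x \<in> fv.perp (ip n) ?K (space n)"
    then have x: "x \<in> space n" "\<And>v. v \<in> ?K \<Longrightarrow> ip n v x = 0" by (auto simp: fv.perp_def)
    have "lmul x M j = 0" if "j < k" for j
      using c[OF that, of x] x(2)[OF fv.span_base, of "of_vec (col M j)"] that by (auto simp: C)
    then show "x \<in> {x \<in> space n. \<forall>j<k. lmul x M j = 0}" using x by blast
  next
    fix x assume x: "x \<in> {x \<in> space n. \<forall>j<k. lmul x M j = 0}"
    have "?C \<subseteq> {v. ip n v x = 0}" using x c by (auto simp: C)
    then have "?K \<subseteq> {v. ip n v x = 0}"
      by (intro fv.span_minimal) (auto simp: fv.subspace_def fv.hermitianD[OF hermitian_ip])
    then show "x \<in> fv.perp (ip n) ?K (space n)" using x by (auto simp: fv.perp_def)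
  qed
  then show ?thesis
    using dim_ip_perp[OF fK fd_space K order_refl] rank_dim_cols[OF M] dim_space[of n] by simp
qed

section \<open>Eigenvalue counts and indices of forms\<close>

lemma order_prod_linear:
  "order a (\<Prod>e\<leftarrow>es. [:- e, 1:]) = card {i. i < length es \<and> es ! i = (a :: complex)}"
proof (induction es)
  case (Cons e es)
  have nz: "(\<Prod>e\<leftarrow>es. [:- e, 1:]) \<noteq> (0 :: complex poly)" by (auto simp: prod_list_zero_iff)
  have "order a (\<Prod>e\<leftarrow>e # es. [:- e, 1:]) = order a [:- e, 1:] + order a (\<Prod>e\<leftarrow>es. [:- e, 1:])"
    using nz by (simp add: order_mult del: mult_pCons_left)
  also have "order a [:- e, 1:] = (if e = a then 1 else 0)"
  proof (cases "e = a")
    case False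
    then have "poly [:- e, 1:] a \<noteq> 0" by simp
    then show ?thesis using order_root[of "[:- e, 1:]" a] False by simp
  qed simp
  finally have o: "order a (\<Prod>e\<leftarrow>e # es. [:- e, 1:]) =
      (if e = a then 1 else 0) + order a (\<Prod>e\<leftarrow>es. [:- e, 1:])" .
  have "{i. i < length (e # es) \<and> (e # es) ! i = a} =
      (if e = a then {0} else {}) \<union> Suc ` {i. i < length es \<and> es ! i = a}"
    by (auto simp: less_Suc_eq_0_disj split: if_splits)
  then have "card {i. i < length (e # es) \<and> (e # es) ! i = a} =
      (if e = a then 1 else 0) + card {i. i < length es \<and> es ! i = a}"
    by (auto simp: card_image card_insert_if)
  then show ?case unfolding o Cons.IH by simp
qed (simp add: order_0I)

text \<open>Each order counts the positions of \<open>es\<close> that hold the given value. These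
  sets of positions are disjoint, and since the entries are real they exhaust the positions selected
  by \<open>Q\<close>.\<close>

lemma sum_order_eigenvalues:
  assumes M: "M \<in> carrier_mat n n" and c: "char_poly M = (\<Prod>e\<leftarrow>es. [:- e, 1:])"
    and re: "\<And>e. e \<in> set es \<Longrightarrow> Im e = 0"
  shows "(\<Sum>x\<in>{x :: real. Q x \<and> eigenvalue M (complex_of_real x)}. order (complex_of_real x) (char_poly M)) =
    card {i. i < length es \<and> Q (Re (es ! i))}"
proof -
  let ?X = "{x :: real. Q x \<and> eigenvalue M (complex_of_real x)}"
  let ?I = "\<lambda>x. {i. i < length es \<and> es ! i = complex_of_real x}"
  have ev: "eigenvalue M a \<longleftrightarrow> a \<in> set es" for a
    unfolding eigenvalue_root_char_poly[OF M] c poly_prod_list by (auto simp: prod_list_zero_iff)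
  have "?X \<subseteq> Re ` set es" using ev by force
  then have fX: "finite ?X" by (rule finite_subset) simp
  have "(\<Sum>x\<in>?X. order (complex_of_real x) (char_poly M)) = (\<Sum>x\<in>?X. card (?I x))"
    unfolding c order_prod_linear ..
  also have "\<dots> = card (\<Union>x\<in>?X. ?I x)"
    by (rule card_UN_disjoint[symmetric]) (use fX in auto)
  also have "(\<Union>x\<in>?X. ?I x) = {i. i < length es \<and> Q (Re (es ! i))}"
  proof (intro equalityI subsetI)
    fix i assume "i \<in> {i. i < length es \<and> Q (Re (es ! i))}"
    then have i: "i < length es" "Q (Re (es ! i))" by auto
    then have "es ! i = complex_of_real (Re (es ! i))" using re by (simp add: complex_eq_iff)
    then show "i \<in> (\<Union>x\<in>?X. ?I x)" using i ev nth_mem[OF i(1)] by auto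
  qed auto
  finally show ?thesis .
qed

definition mv :: "complex mat \<Rightarrow> (nat \<Rightarrow> complex) \<Rightarrow> nat \<Rightarrow> complex" where
  "mv M y i = (if i < dim_row M then \<Sum>j<dim_col M. M $$ (i, j) * y j else 0)"

lemma form_mv: "form M x y = ip (dim_row M) x (mv M y)"
proof -
  have "form M x y = (\<Sum>j<dim_col M. \<Sum>i<dim_row M. cnj (x i) * M $$ (i, j) * y j)"
    by (simp add: form_def lmul_def sum_distrib_right)
  also have "\<dots> = (\<Sum>i<dim_row M. \<Sum>j<dim_col M. cnj (x i) * M $$ (i, j) * y j)" by (rule sum.swap)
  finally show ?thesis by (simp add: ip_def mv_def sum_distrib_left mult.assoc)
qed

lemma linmap_mv: "fv.linmap (mv M)"
  by (auto simp: fv.linmap_def mv_def fun_eq_iff algebra_simps sum.distrib sum_distrib_left)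

lemma mv_mult:
  assumes "M \<in> carrier_mat n k" "N \<in> carrier_mat k l"
  shows "mv (M * N) x = mv M (mv N x)"
proof
  fix i
  show "mv (M * N) x i = mv M (mv N x) i"
  proof (cases "i < n")
    case True
    have "mv (M * N) x i = (\<Sum>j<l. \<Sum>t<k. M $$ (i, t) * N $$ (t, j) * x j)"
      using assms True by (simp add: mv_def scalar_prod_def atLeast0LessThan sum_distrib_right)
    also have "\<dots> = (\<Sum>t<k. \<Sum>j<l. M $$ (i, t) * N $$ (t, j) * x j)" by (rule sum.swap)
    finally show ?thesis using assms True by (simp add: mv_def sum_distrib_left mult.assoc)
  qed (use assms in \<open>simp add: mv_def\<close>)
qed

lemma mv_cols: "M \<in> carrier_mat n k \<Longrightarrow> mv M y = (\<Sum>j<k. cscale (y j) (of_vec (col M j)))"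
  by (auto simp: fun_eq_iff mv_def of_vec_def sum_fun_apply mult.commute)

lemma mv_one: "x \<in> space n \<Longrightarrow> mv (1\<^sub>m n) x = x"
  by (auto simp: fun_eq_iff mv_def space_def if_distrib[of "\<lambda>z. z * _"] cong: if_cong)

lemma mv_e_vec: "j < dim_col T \<Longrightarrow> mv T (e_vec j) i = (if i < dim_row T then T $$ (i, j) else 0)"
  by (simp add: mv_def e_vec_def if_distrib[of "(*) _"] cong: if_cong)

text \<open>A basis chosen among the vectors of \<open>B\<close> already has \<open>dim V\<close>
  elements, so nothing can have been discarded.\<close>

lemma (in complex_vs) independent_if_card_le_dim:
  assumes "finite B" "V \<subseteq> span B" "B \<subseteq> V" "card B \<le> dim V"
  shows "independent B" "card B = dim V"
proof -
  obtain C where C: "C \<subseteq> B" "independent C" "B \<subseteq> span C"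
    using maximal_independent_subset[of B] by blast
  have "V \<subseteq> span C" using assms(2) span_minimal[OF C(3) subspace_span] by blast
  then have d: "dim V = card C" using C(1,2) assms(3) by (intro dim_unique[of C]) auto
  then have "C = B" using C(1) assms(1,4) by (intro card_seteq) auto
  then show "independent B" "card B = dim V" using C(2) d by auto
qed

text \<open>Gram-Schmidt along the flag of invariant subspaces given by a Schur decomposition: in the
  resulting basis the form of a Hermitian matrix is diagonal with the signs of the eigenvalues.\<close>
lemma eigenvalue_orth_basis:
  assumes M: "M \<in> herm_mats n" and c: "char_poly M = (\<Prod>e\<leftarrow>es. [:- e, 1:])"
  obtains E where "fv.orth_basis (form M) (space n) E" "\<And>i. i < n \<Longrightarrow> Im (es ! i) = 0" "length es = n"
    "card {e \<in> E. 0 < Re (form M e e)} = card {i. i < n \<and> 0 < Re (es ! i)}"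
    "card {e \<in> E. Re (form M e e) < 0} = card {i. i < n \<and> Re (es ! i) < 0}"
proof -
  have Mc: "M \<in> carrier_mat n n" using herm_matsD(1)[OF M] .
  have h: "fv.hermitian (form M)" by (rule hermitian_form[OF M])
  obtain T P Q where "schur_decomposition M es = (T, P, Q)" by (cases "schur_decomposition M es") auto
  from schur_decomposition[OF Mc c this]
  have sim: "similar_mat_wit M T P Q" and ut: "upper_triangular T" and dg: "diag_mat T = es" by auto
  note w = similar_mat_witD2[OF Mc sim]
  have len: "length es = n" using dg w(5) by (auto simp: diag_mat_def)
  have Tii: "T $$ (i, i) = es ! i" if "i < n" for i using dg w(5) that by (auto simp: diag_mat_def)
  have MP: "M * P = P * T"
  proof -
    have "M * P = P * T * (Q * P)"
      unfolding w(3) using w(5-7) by (simp add: assoc_mult_mat[of _ n n _ n _ n])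
    then show ?thesis using w(2,5,6) by simp
  qed
  define p where "p j = of_vec (col P j)" for j
  have ps: "p j \<in> space n" for j using of_vec_space[of "col P j" n] w(6) by (simp add: p_def carrier_vecI)
  have Pe: "p j = mv P (e_vec j)" if "j < n" for j
    using w(6) that by (auto simp: p_def fun_eq_iff mv_e_vec of_vec_def)
  \<comment> \<open>Column \<open>j\<close> of the identity between \<open>M P\<close> and
    \<open>P T\<close>. Upper triangularity of \<open>T\<close> ends the sum at
    \<open>i = j\<close>, so the spans of initial columns of \<open>P\<close> form a flag invariant
    under \<open>M\<close>.\<close>
  have mvp: "mv M (p j) = (\<Sum>i<n. cscale (if i \<le> j then T $$ (i, j) else 0) (p i))" if j: "j < n" for j
  proof -
    have "mv M (p j) = mv P (mv T (e_vec j))"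
      using mv_mult[OF Mc w(6), of "e_vec j"] mv_mult[OF w(6,5), of "e_vec j"] MP Pe[OF j] by simp
    also have "\<dots> = (\<Sum>i<n. cscale (mv T (e_vec j) i) (p i))"
      unfolding mv_cols[OF w(6)] p_def ..
    also have "\<dots> = (\<Sum>i<n. cscale (if i \<le> j then T $$ (i, j) else 0) (p i))"
      using w(5) j ut by (intro sum.cong refl) (auto simp: mv_e_vec upper_triangular_def)
    finally show ?thesis .
  qed
  have spn: "space n \<subseteq> fv.span (p ` {..<n})"
  proof
    fix x assume x: "x \<in> space n"
    have "x = mv P (mv Q x)" using mv_mult[OF w(6,7), of x] w(1) mv_one[OF x] by simp
    then have x: "x = (\<Sum>j<n. cscale (mv Q x j) (p j))" unfolding mv_cols[OF w(6)] p_def .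
    show "x \<in> fv.span (p ` {..<n})"
      by (subst x, intro fv.span_sum fv.span_scale fv.span_base imageI)
  qed
  have sub: "p ` {..<n} \<subseteq> space n" using ps by blast
  have cle: "card (p ` {..<n}) \<le> fv.dim (space n)"
    unfolding dim_space using card_image_le[of "{..<n}" p] by simp
  note ind = fv.independent_if_card_le_dim[OF _ spn sub cle, simplified]
  have inj: "inj_on p {..<n}" using ind(2) by (intro eq_card_imp_inj_on) (simp_all add: dim_space)
  define W where "W k = fv.span (p ` {..<k})" for k
  have dW: "fv.dim (W k) = k" if "k \<le> n" for k
  proof -
    have "fv.independent (p ` {..<k})" by (rule fv.independent_mono[OF ind(1)]) (use that in auto)
    then have "fv.dim (W k) = card (p ` {..<k})" unfolding W_def by (rule fv.dim_span_eq_card_independent)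
    also have "\<dots> = k" using inj that by (subst card_image) (auto intro: inj_on_subset)
    finally show ?thesis .
  qed
  have fW: "fv.fd (W k)" for k unfolding W_def by (rule fv.fd_span) simp
  have sW: "fv.subspace (W k)" for k unfolding W_def by simp
  have Wmono: "W k \<subseteq> W (Suc k)" for k unfolding W_def by (rule fv.span_mono) auto
  have Wsp: "W k \<subseteq> space n" for k
    unfolding W_def using ps by (intro fv.span_minimal subspace_space) auto
  have inv: "mv M x \<in> W k" if k: "k \<le> n" and x: "x \<in> W k" for k x
  proof -
    have "p ` {..<k} \<subseteq> {x. mv M x \<in> W k}"
    proof
      fix y assume "y \<in> p ` {..<k}"
      then obtain j where j: "j < k" "y = p j" by blast
      have "mv M (p j) \<in> W k"
      proof (subst mvp)
        show "j < n" using j k by simp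
        show "(\<Sum>i<n. cscale (if i \<le> j then T $$ (i, j) else 0) (p i)) \<in> W k"
        proof (intro fv.subspace_sum[OF sW])
          fix i assume "i \<in> {..<n}"
          show "cscale (if i \<le> j then T $$ (i, j) else 0) (p i) \<in> W k"
          proof (cases "i \<le> j")
            case True
            then have "p i \<in> W k" unfolding W_def using j by (intro fv.span_base) auto
            then show ?thesis by (intro fv.subspace_scale[OF sW])
          qed (use fv.subspace_0[OF sW] in simp)
        qed
      qed
      then show "y \<in> {x. mv M x \<in> W k}" using j by simp
    qed
    moreover have "fv.subspace {x. mv M x \<in> W k}"
      using sW[of k] fv.linmapD[OF linmap_mv] by (auto simp: fv.subspace_def)
    ultimately have "W k \<subseteq> {x. mv M x \<in> W k}" unfolding W_def[of k] by (intro fv.span_minimal) (simp_all flip: W_def)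
    then show ?thesis using x by blast
  qed
  have fm: "form M x y = ip n x (mv M y)" for x y using form_mv[of M] Mc by simp
  note hi = hermitian_ip[of n]
  have "k \<le> n \<Longrightarrow> \<exists>E. fv.orth_basis (form M) (W k) E \<and> (\<forall>i<k. Im (es ! i) = 0) \<and>
      card {e \<in> E. 0 < Re (form M e e)} = card {i. i < k \<and> 0 < Re (es ! i)} \<and>
      card {e \<in> E. Re (form M e e) < 0} = card {i. i < k \<and> Re (es ! i) < 0}" for k
  proof (induction k)
    case 0
    then show ?case by (intro exI[of _ "{}"]) (auto simp: fv.orth_basis_def W_def fv.independent_empty simp del: cscale_apply)
  next
    case (Suc k)
    then obtain E where E: "fv.orth_basis (form M) (W k) E" "\<forall>i<k. Im (es ! i) = 0"
      "card {e \<in> E. 0 < Re (form M e e)} = card {i. i < k \<and> 0 < Re (es ! i)}"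
      "card {e \<in> E. Re (form M e e) < 0} = card {i. i < k \<and> Re (es ! i) < 0}" by (auto simp del: cscale_apply)
    have kn: "k < n" using Suc.prems by simp
    have "fv.dim (W (Suc k)) = fv.dim (W k) + fv.dim (fv.perp (ip n) (W k) (W (Suc k)))"
      by (rule dim_ip_perp[OF fW fW Wmono Wsp])
    then have "fv.dim (fv.perp (ip n) (W k) (W (Suc k))) \<noteq> 0" using dW[of k] dW[of "Suc k"] kn by simp
    then have "\<not> fv.perp (ip n) (W k) (W (Suc k)) \<subseteq> fv.span {}" using fv.dim_le_card[of _ "{}"] by fastforce
    \<comment> \<open>The Gram-Schmidt vector, obtained by a dimension count instead of a formula;
      it is left unnormalised, as only signs matter.\<close>
    then obtain q where q: "q \<in> W (Suc k)" "\<And>w. w \<in> W k \<Longrightarrow> ip n w q = 0" "q \<noteq> 0"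
      by (auto simp: fv.perp_def)
    have q': "ip n q w = 0" if "w \<in> W k" for w
      using fv.hermitian_zero_sym[OF hi, of q w] q(2)[OF that] by blast
    have qpos: "0 < Re (ip n q q)" using ip_self_pos q Wsp by blast
    have "q \<in> fv.span (insert (p k) (p ` {..<k}))" using q(1) by (simp add: W_def lessThan_Suc)
    then obtain a where a: "q - cscale a (p k) \<in> W k" unfolding fv.span_breakdown_eq W_def by blast
    define v where "v = q - cscale a (p k)"
    have qv: "q = cscale a (p k) + v" by (simp add: v_def)
    have mvpk: "mv M (p k) - cscale (es ! k) (p k) \<in> W k"
    proof -
      have "mv M (p k) = cscale (es ! k) (p k) + (\<Sum>i\<in>{..<n} - {k}. cscale (if i \<le> k then T $$ (i, k) else 0) (p i))"
        unfolding mvp[OF kn] using kn by (subst sum.remove[of _ k]) (simp_all add: Tii)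
      moreover have "(\<Sum>i\<in>{..<n} - {k}. cscale (if i \<le> k then T $$ (i, k) else 0) (p i)) \<in> W k"
      proof (intro fv.subspace_sum[OF sW])
        fix i assume i: "i \<in> {..<n} - {k}"
        show "cscale (if i \<le> k then T $$ (i, k) else 0) (p i) \<in> W k"
        proof (cases "i \<le> k")
          case True
          then have "p i \<in> W k" unfolding W_def using i by (intro fv.span_base) auto
          then show ?thesis by (intro fv.subspace_scale[OF sW])
        qed (use fv.subspace_0[OF sW] in simp)
      qed
      ultimately show ?thesis by simp
    qed
    \<comment> \<open>Modulo \<open>W k\<close> the vector \<open>q\<close> is a multiple of
      \<open>p k\<close>, on which \<open>M\<close> acts as the scalar \<open>es ! k\<close>; and
      \<open>W k\<close> is invariant.\<close>
    have mvq: "mv M q - cscale (es ! k) q \<in> W k"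
    proof -
      have "mv M q - cscale (es ! k) q =
          cscale a (mv M (p k) - cscale (es ! k) (p k)) + (mv M v - cscale (es ! k) v)"
        unfolding qv by (simp add: fv.linmapD[OF linmap_mv] fun_eq_iff algebra_simps)
      also have "\<dots> \<in> W k"
      proof (intro fv.subspace_add[OF sW] fv.subspace_scale[OF sW] mvpk)
        have "v \<in> W k" using a by (simp only: v_def)
        then show "mv M v - cscale (es ! k) v \<in> W k"
          using inv[of k v] kn by (intro fv.subspace_diff[OF sW] fv.subspace_scale[OF sW]) auto
      qed
      finally show ?thesis .
    qed
    have fqq: "form M q q = es ! k * ip n q q"
      using q'[OF mvq] unfolding fm fv.hermitianD[OF hi] by simp
    have "complex_of_real (Re (ip n q q)) = ip n q q" using fv.hermitian_eq_Re[OF hi, of q] by (rule sym)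
    then have "form M q q = es ! k * complex_of_real (Re (ip n q q))" using fqq by simp
    then have R: "Re (form M q q) = Re (es ! k) * Re (ip n q q)" "Im (form M q q) = Im (es ! k) * Re (ip n q q)"
      by simp_all
    \<comment> \<open>Reality of the eigenvalue comes for free: \<open>form M q q\<close> is real
      and is \<open>es ! k\<close> times a positive number.\<close>
    have Im0: "Im (es ! k) = 0" using R(2) fv.hermitian_Im[OF h, of q] qpos by simp
    have sgn: "0 < Re (form M q q) \<longleftrightarrow> 0 < Re (es ! k)" "Re (form M q q) < 0 \<longleftrightarrow> Re (es ! k) < 0"
      unfolding R(1) using qpos by (simp_all add: zero_less_mult_iff mult_less_0_iff)
    \<comment> \<open>\<open>M\<close> maps \<open>W k\<close> into itself, so orthogonality to
      \<open>W k\<close> for the inner product implies orthogonality for the form of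
      \<open>M\<close>.\<close>
    have orth: "form M q w = 0" "form M w q = 0" if "w \<in> W k" for w
    proof -
      show "form M q w = 0" unfolding fm using q' inv[of k w] that kn by simp
      then show "form M w q = 0" using fv.hermitian_zero_sym[OF h, of w q] by blast
    qed
    have E': "finite E" "fv.independent E" "fv.span E = W k" "\<forall>x\<in>E. \<forall>y\<in>E. x \<noteq> y \<longrightarrow> form M x y = 0"
      using E(1) by (simp_all add: fv.orth_basis_def)
    have EW: "E \<subseteq> W k" using fv.span_superset[of E] E'(3) by simp
    have qn: "q \<notin> W k" using q(2)[of q] qpos by auto
    have ind': "fv.independent (insert q E)" using fv.independent_insertI[OF _ E'(2)] qn E'(3) by simp
    have cE: "card E = k" using fv.dim_span_eq_card_independent[OF E'(2)] E'(3) dW[of k] kn by simp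
    have qE: "q \<notin> E" using qn EW by blast
    have "fv.span (insert q E) = W (Suc k)"
    proof (rule fv.dim_subspace_eq[OF fW fv.subspace_span])
      show "fv.span (insert q E) \<subseteq> W (Suc k)"
        using q(1) EW Wmono by (intro fv.span_minimal sW) blast
      show "fv.dim (W (Suc k)) \<le> fv.dim (fv.span (insert q E))"
        using fv.dim_span_eq_card_independent[OF ind'] dW[of "Suc k"] kn E'(1) qE cE by simp
    qed
    then have ob: "fv.orth_basis (form M) (W (Suc k)) (insert q E)"
      using ind' E' orth EW by (auto simp: fv.orth_basis_def)
    have cnt: "card {e \<in> insert q E. A e} = card {i. i < Suc k \<and> B i}"
      if "card {e \<in> E. A e} = card {i. i < k \<and> B i}" "A q \<longleftrightarrow> B k" for A B
    proof -
      have "{e \<in> insert q E. A e} = (if A q then insert q {e \<in> E. A e} else {e \<in> E. A e})" by auto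
      moreover have "{i. i < Suc k \<and> B i} = (if B k then insert k {i. i < k \<and> B i} else {i. i < k \<and> B i})"
        by (auto simp: less_Suc_eq)
      ultimately show ?thesis using that E'(1) qE by simp
    qed
    show ?case
      using ob E(2) Im0 cnt[OF E(3) sgn(1)] cnt[OF E(4) sgn(2)]
      by (intro exI[of _ "insert q E"] conjI) (simp_all add: less_Suc_eq del: cscale_apply)
  qed
  from this[of n] obtain E where E: "fv.orth_basis (form M) (W n) E" "\<forall>i<n. Im (es ! i) = 0"
    "card {e \<in> E. 0 < Re (form M e e)} = card {i. i < n \<and> 0 < Re (es ! i)}"
    "card {e \<in> E. Re (form M e e) < 0} = card {i. i < n \<and> Re (es ! i) < 0}" by (auto simp del: cscale_apply)
  have "W n = space n" using Wsp[of n] spn by (auto simp: W_def)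
  then show ?thesis using that E len by auto
qed

text \<open>Both sides count positions of one eigenvalue list by sign, the left through the
  characteristic polynomial, the right through an orthogonal basis.\<close>

lemma inertia_eq:
  assumes M: "M \<in> herm_mats n"
  shows "i_plus M = fv.pos (form M) (space n)" "i_minus M = fv.neg (form M) (space n)"
proof -
  have Mc: "M \<in> carrier_mat n n" using herm_matsD(1)[OF M] .
  obtain es where c: "char_poly M = (\<Prod>e\<leftarrow>es. [:- e, 1:])" using char_poly_factorized[OF Mc] by blast
  obtain E where E: "fv.orth_basis (form M) (space n) E" "\<And>i. i < n \<Longrightarrow> Im (es ! i) = 0" "length es = n"
    "card {e \<in> E. 0 < Re (form M e e)} = card {i. i < n \<and> 0 < Re (es ! i)}"
    "card {e \<in> E. Re (form M e e) < 0} = card {i. i < n \<and> Re (es ! i) < 0}"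
    using eigenvalue_orth_basis[OF M c] by blast
  have re: "Im e = 0" if "e \<in> set es" for e using that E(2,3) by (auto simp: in_set_conv_nth)
  have h: "fv.hermitian (form M)" by (rule hermitian_form[OF M])
  have o: "fv.orth_basis (\<lambda>x y. - form M x y) (space n) E" using E(1) by (simp add: fv.orth_basis_def)
  have "i_plus M = card {i. i < n \<and> 0 < Re (es ! i)}"
    unfolding i_plus_def using sum_order_eigenvalues[OF Mc c, of "\<lambda>x. 0 < x"] re E(3) by simp
  then show "i_plus M = fv.pos (form M) (space n)"
    using fv.orth_basis_pos[OF h E(1)] E(4) by simp
  have "i_minus M = card {i. i < n \<and> Re (es ! i) < 0}"
    unfolding i_minus_def using sum_order_eigenvalues[OF Mc c, of "\<lambda>x. x < 0"] re E(3) by simp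
  then show "i_minus M = fv.neg (form M) (space n)"
    using fv.orth_basis_pos[OF fv.hermitian_uminus[OF h] o] E(5) by simp
qed

text \<open>For a Hermitian matrix the left kernel is the radical of its form, so this is
  \<open>inertia_sum\<close>.\<close>

lemma rank_hermitian:
  assumes M: "M \<in> herm_mats n"
  shows "rank_mat M = i_plus M + i_minus M"
proof -
  have Mc: "M \<in> carrier_mat n n" using herm_matsD(1)[OF M] .
  have h: "fv.hermitian (form M)" by (rule hermitian_form[OF M])
  have "{x \<in> space n. \<forall>j<n. lmul x M j = 0} = fv.perp (form M) (space n) (space n)"
    using lmul_zero_iff[of M n] Mc fv.hermitian_zero_sym[OF h] by (auto simp: fv.perp_def)
  then show ?thesis
    using rank_left_kernel[OF Mc] fv.inertia_sum[OF h fd_space, of n] inertia_eq[OF M] dim_space[of n] by simp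
qed

section \<open>The equation B X B* = C\<close>

text \<open>The solution set may be infinite, and \<open>Max\<close> is meaningful only for finite
  sets; integer values confined between 0 and \<open>c\<close> form one.\<close>

lemma Max_image_eqI:
  fixes f :: "'a \<Rightarrow> int"
  assumes "x \<in> S" "f x = c" "\<And>y. y \<in> S \<Longrightarrow> f y \<le> c" "\<And>y. y \<in> S \<Longrightarrow> 0 \<le> f y"
  shows "Max (f ` S) = c"
proof (rule Max_eqI)
  show "finite (f ` S)" by (rule finite_subset[of _ "{0..c}"]) (use assms(3,4) in auto)
qed (use assms in auto)

lemma Min_image_eqI:
  fixes f :: "'a \<Rightarrow> int"
  assumes "x \<in> S" "f x = c" "\<And>y. y \<in> S \<Longrightarrow> c \<le> f y" "\<And>y. y \<in> S \<Longrightarrow> f y \<le> b"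
  shows "Min (f ` S) = c"
proof (rule Min_eqI)
  show "finite (f ` S)" by (rule finite_subset[of _ "{c..b}"]) (use assms(3,4) in auto)
qed (use assms in auto)

lemma sum_lessThan_add: "(\<Sum>i<m + n. f i) = (\<Sum>i<m. f i) + (\<Sum>i<n. f (m + i :: nat) :: 'a::comm_monoid_add)"
  by (induction n) (simp_all add: add.assoc)

lemma lessThan_add_cases: "(\<forall>j<m + n. Q j) \<longleftrightarrow> (\<forall>j<m. Q j) \<and> (\<forall>j<n. Q (m + j :: nat))"
proof (intro iffI conjI allI impI)
  fix j assume Q: "(\<forall>j<m. Q j) \<and> (\<forall>j<n. Q (m + j))" and "j < m + n"
  then show "Q j" by (cases "j < m") (auto dest: spec[of _ "j - m"])
qed auto

definition top_part :: "nat \<Rightarrow> (nat \<Rightarrow> complex) \<Rightarrow> nat \<Rightarrow> complex" where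
  "top_part m z i = (if i < m then z i else 0)"

definition bot_part :: "nat \<Rightarrow> (nat \<Rightarrow> complex) \<Rightarrow> nat \<Rightarrow> complex" where
  "bot_part m z i = (if i < m then z (m + i) else 0)"

definition join :: "nat \<Rightarrow> (nat \<Rightarrow> complex) \<Rightarrow> (nat \<Rightarrow> complex) \<Rightarrow> nat \<Rightarrow> complex" where
  "join m x y i = (if i < m then x i else if i < m + m then y (i - m) else 0)"

lemma linmap_parts: "fv.linmap (top_part m)" "fv.linmap (bot_part m)"
  by (auto simp: fv.linmap_def top_part_def bot_part_def fun_eq_iff)

lemma parts_space: "top_part m z \<in> space m" "bot_part m z \<in> space m"
  by (auto simp: space_def top_part_def bot_part_def)

lemma join_space: "join m x y \<in> space (m + m)"
  by (simp add: join_def space_def)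

lemma parts_join: "x \<in> space m \<Longrightarrow> top_part m (join m x y) = x" "y \<in> space m \<Longrightarrow> bot_part m (join m x y) = y"
  by (auto simp: space_def top_part_def bot_part_def join_def fun_eq_iff)

lemma parts_zero:
  assumes "z \<in> space (m + m)" "top_part m z = 0" "bot_part m z = 0"
  shows "z = 0"
proof
  fix i
  show "z i = 0 i"
  proof (cases "i < m")
    case True
    then show ?thesis using fun_cong[OF assms(2), of i] by (simp add: top_part_def)
  next
    case False
    then have "m + (i - m) = i" by simp
    then show ?thesis
      using fun_cong[OF assms(3), of "i - m"] assms(1) False
      by (cases "i < m + m") (simp_all add: bot_part_def space_def less_diff_conv2)
  qed
qed

lemma lmul_four_block:
  assumes "P \<in> carrier_mat m m" "Q \<in> carrier_mat m m" "R \<in> carrier_mat m m" "S \<in> carrier_mat m m" "j < m"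
  shows "lmul z (four_block_mat P Q R S) j = lmul (top_part m z) P j + lmul (bot_part m z) R j"
    and "lmul z (four_block_mat P Q R S) (m + j) = lmul (top_part m z) Q j + lmul (bot_part m z) S j"
  using assms by (simp_all add: lmul_def sum_lessThan_add top_part_def bot_part_def)

lemma form_four_block:
  assumes "P \<in> carrier_mat m m" "Q \<in> carrier_mat m m" "R \<in> carrier_mat m m" "S \<in> carrier_mat m m"
  shows "form (four_block_mat P Q R S) z z' =
    form P (top_part m z) (top_part m z') + form R (bot_part m z) (top_part m z') +
    form Q (top_part m z) (bot_part m z') + form S (bot_part m z) (bot_part m z')"
  using assms
  by (simp add: form_def sum_lessThan_add lmul_four_block[OF assms] top_part_def[of m z'] bot_part_def[of m z']
      distrib_right sum.distrib add.assoc)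

lemma append_cols_kernel:
  assumes "P \<in> carrier_mat m m" "Q \<in> carrier_mat m m"
  shows "rank_mat (P @\<^sub>c Q) +
    fv.dim {x \<in> space m. (\<forall>j<m. lmul x P j = 0) \<and> (\<forall>j<m. lmul x Q j = 0)} = m"
proof -
  have c: "P @\<^sub>c Q \<in> carrier_mat m (m + m)"
    using assms by (auto simp: append_cols_def)
  have "lmul x (P @\<^sub>c Q) j = lmul x P j" "lmul x (P @\<^sub>c Q) (m + j) = lmul x Q j" if "j < m" for x j
    using assms that by (simp_all add: append_cols_def lmul_def)
  then have "{x \<in> space m. \<forall>j<m + m. lmul x (P @\<^sub>c Q) j = 0} =
      {x \<in> space m. (\<forall>j<m. lmul x P j = 0) \<and> (\<forall>j<m. lmul x Q j = 0)}"
    by (auto simp: lessThan_add_cases)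
  then show ?thesis using rank_left_kernel[OF c] by simp
qed

lemma herm_matsI:
  assumes "M \<in> carrier_mat n n" "\<And>x y. x \<in> space n \<Longrightarrow> y \<in> space n \<Longrightarrow> form M y x = cnj (form M x y)"
  shows "M \<in> herm_mats n"
proof -
  have "mat_adjoint M \<in> carrier_mat n n" using assms(1) by (intro carrier_matI) auto
  then have "mat_adjoint M = M"
    using assms(1)
  proof (rule mat_eq_form)
    fix x y assume x: "x \<in> space n" and y: "y \<in> space n"
    show "form (mat_adjoint M) x y = form M x y"
      unfolding form_sym assms(2)[OF x y] by (rule complex_cnj_cnj)
  qed
  then show ?thesis using assms(1) by (simp add: herm_mats_def)
qed

lemma herm_mats_four_block:
  assumes A: "A \<in> herm_mats m" and B: "B \<in> carrier_mat m m"
  shows "four_block_mat A B (mat_adjoint B) (0\<^sub>m m m) \<in> herm_mats (m + m)"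
proof -
  have c: "A \<in> carrier_mat m m" "mat_adjoint B \<in> carrier_mat m m" "0\<^sub>m m m \<in> carrier_mat m m"
    using herm_matsD(1)[OF A] B by (auto intro!: carrier_matI)
  have z: "form (0\<^sub>m m m) x y = 0" for x y by (simp add: form_def lmul_def)
  show ?thesis
  proof (rule herm_matsI)
    show "four_block_mat A B (mat_adjoint B) (0\<^sub>m m m) \<in> carrier_mat (m + m) (m + m)"
      using c B by simp
    fix x y
    let ?f = "form (four_block_mat A B (mat_adjoint B) (0\<^sub>m m m))"
    have "form B (top_part m y) (bot_part m x) = cnj (form (mat_adjoint B) (bot_part m x) (top_part m y))"
      unfolding form_sym by simp
    then show "?f y x = cnj (?f x y)"
      using fv.hermitian_sym[OF hermitian_form[OF A], of "top_part m y" "top_part m x"]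
      by (simp add: form_four_block[OF c(1) B c(2,3)] z form_sym)
  qed
qed

locale hermitian_equation =
  fixes m :: nat and A B X0 :: "complex mat"
  assumes A: "A \<in> herm_mats m" and B: "B \<in> carrier_mat m m" and X0: "X0 \<in> herm_mats m"
begin

abbreviation "L \<equiv> adj B"
abbreviation "V \<equiv> space m"

definition res :: "complex mat \<Rightarrow> complex mat" where
  "res X = A - B * X - X * mat_adjoint B"

text \<open>Taking the right-hand side from \<open>X0\<close> builds solvability into the locale;
  the given matrix is put back at the end.\<close>

definition "C = B * X0 * mat_adjoint B"

definition "K1 = {x \<in> V. L x = 0}"
definition "K2 = L ` V"
abbreviation "h \<equiv> form (res X0)"
abbreviation "K0 \<equiv> K1 \<inter> K2"

lemma Ac: "A \<in> carrier_mat m m" and X0c: "X0 \<in> carrier_mat m m" and Bs: "mat_adjoint B \<in> carrier_mat m m"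
  using A X0 B by (auto simp: herm_mats_def intro!: carrier_matI)

lemma LV: "L x \<in> V" using adj_space[of B x] B by simp

lemma L_zero: "L 0 = 0" by (rule fv.linmapD(3)[OF linmap_adj])

lemma form_zero: "form M 0 y = 0" "form M x 0 = 0"
  by (simp_all add: form_def lmul_def)

lemma form_res:
  assumes "X \<in> carrier_mat m m"
  shows "form (res X) x y = form A x y - form X (L x) y - form X x (L y)"
proof -
  have c: "B * X \<in> carrier_mat m m" "X * mat_adjoint B \<in> carrier_mat m m" "A - B * X \<in> carrier_mat m m"
    by (intro minus_carrier_mat mult_carrier_mat[of _ m m _ m] Ac B Bs assms)+
  show ?thesis
    unfolding res_def form_minus[OF c(3,2)] form_minus[OF Ac c(1)]
      form_mult_left[OF B assms] form_mult_adjoint[OF assms B] ..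
qed

lemma form_BXB:
  assumes "X \<in> carrier_mat m m"
  shows "form (B * X * mat_adjoint B) x y = form X (L x) (L y)"
proof -
  have c: "B * X \<in> carrier_mat m m" by (rule mult_carrier_mat[OF B assms])
  show ?thesis unfolding form_mult_adjoint[OF c B] form_mult_left[OF B assms] ..
qed

lemma res_herm:
  assumes X: "X \<in> herm_mats m"
  shows "res X \<in> herm_mats m"
proof (rule herm_matsI)
  have Xc: "X \<in> carrier_mat m m" using X by (simp add: herm_mats_def)
  show "res X \<in> carrier_mat m m" unfolding res_def
    by (intro minus_carrier_mat mult_carrier_mat[of _ m m _ m] Ac B Bs Xc)
  fix x y
  show "form (res X) y x = cnj (form (res X) x y)"
    unfolding form_res[OF Xc] fv.hermitian_sym[OF hermitian_form[OF A], of y x]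
      fv.hermitian_sym[OF hermitian_form[OF X], of "L y" x] fv.hermitian_sym[OF hermitian_form[OF X], of y "L x"]
    by simp
qed

lemma hh: "fv.hermitian h" by (rule hermitian_form[OF res_herm[OF X0]])

lemma subspaces: "fv.subspace K1" "fv.subspace K2" "K1 \<subseteq> V" "K2 \<subseteq> V" "K0 \<subseteq> V"
proof -
  show "fv.subspace K1"
    using subspace_space[of m] fv.linmapD[OF linmap_adj[of B]] by (simp add: K1_def fv.subspace_def)
  show "fv.subspace K2" unfolding K2_def by (rule fv.subspace_image[OF linmap_adj subspace_space])
  show K: "K1 \<subseteq> V" unfolding K1_def by blast
  show "K2 \<subseteq> V" unfolding K2_def using LV by blast
  show "K0 \<subseteq> V" using K by blast
qed

lemma subspace_K0: "fv.subspace K0"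
  by (rule fv.subspace_inter[OF subspaces(1,2)])

lemma fds: "fv.fd K1" "fv.fd K2" "fv.fd K0"
  by (rule fv.fd_mono[OF fd_space]; fact subspaces subspace_K0)+

section \<open>The matrices of the theorem in terms of K0, K1 and K2\<close>

lemma dim_K1: "rank_mat B + fv.dim K1 = m" and dim_K2: "fv.dim K2 = rank_mat B"
proof -
  have "K1 = {x \<in> V. \<forall>j<m. lmul x B j = 0}" using B by (auto simp: K1_def adj_zero_iff)
  then show 1: "rank_mat B + fv.dim K1 = m" using rank_left_kernel[OF B] by simp
  show "fv.dim K2 = rank_mat B"
    using fv.dim_image_kernel[OF linmap_adj fd_space, of B m] 1 dim_space[of m] by (simp add: K1_def K2_def)
qed

text \<open>Rank-nullity for \<open>L\<close>, with kernel \<open>K1\<close>. The left kernels of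
  the row block matrices will turn out to be such preimages.\<close>

lemma dim_preimage:
  assumes U: "fv.subspace U" "U \<subseteq> K2"
  shows "fv.dim {x \<in> V. L x \<in> U} = fv.dim U + fv.dim K1"
proof -
  have s: "fv.subspace {x \<in> V. L x \<in> U}"
    using U(1) subspace_space[of m] fv.linmapD[OF linmap_adj[of B]] by (simp add: fv.subspace_def)
  have f: "fv.fd {x \<in> V. L x \<in> U}" by (rule fv.fd_mono[OF fd_space s]) blast
  have "L ` {x \<in> V. L x \<in> U} = U" using U(2) by (auto simp: K2_def)
  moreover have "{x \<in> {x \<in> V. L x \<in> U}. L x = 0} = K1"
    using fv.subspace_0[OF U(1)] by (auto simp: K1_def)
  ultimately show ?thesis using fv.dim_image_kernel[OF linmap_adj f, of B] by simp
qed

text \<open>The three defects. They are exactly the amounts by which the ranks of [B^2, C - BA], of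
  \<open>M2\<close> and of [B^2, BAB^* - CB^*] stay below r(B), 2r(B) and r(B).\<close>

abbreviation "d \<equiv> fv.dim (fv.perp h V K0)"
abbreviation "d1 \<equiv> fv.dim (fv.perp h K1 K0)"
abbreviation "d2 \<equiv> fv.dim (fv.perp h K2 K0)"

lemma perp_K0: "fv.subspace (fv.perp h U K0)" "fv.perp h U K0 \<subseteq> K2"
  by (rule fv.subspace_perp[OF hh subspace_K0]) (auto simp: fv.perp_def)

lemma Cc: "C \<in> carrier_mat m m" unfolding C_def by (intro mult_carrier_mat[of _ m m _ m] B X0c Bs)

lemma form_C: "form C x y = form X0 (L x) (L y)"
  unfolding C_def by (rule form_BXB[OF X0c])

lemma lmul_BB: "(\<forall>j<m. lmul x (B * B) j = 0) \<longleftrightarrow> L (L x) = 0"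
  using B lmul_mult[OF B B] by (auto simp: adj_zero_iff)

lemma perp_iff: "x \<in> fv.perp h U K0 \<longleftrightarrow> x \<in> K0 \<and> (\<forall>u\<in>U. h x u = 0)"
  unfolding fv.perp_def by (simp add: fv.hermitian_zero_sym[OF hh, of x])

text \<open>For x in the left kernel put u = L x. The block B^2 says L u = 0, so u is in
  \<open>K0\<close>; then the block C - BA takes (x, y) to -h(u, y), because one of the two
  \<open>X0\<close> terms of \<open>h\<close> vanishes. The kernel is therefore the preimage of
  \<open>perp h V K0\<close>.\<close>

lemma rank_N1: "rank_mat ((B * B) @\<^sub>c (C - B * A)) + d = rank_mat B"
proof -
  have c: "B * B \<in> carrier_mat m m" "B * A \<in> carrier_mat m m" "C - B * A \<in> carrier_mat m m"
    by (intro minus_carrier_mat mult_carrier_mat[of _ m m _ m] B Ac)+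
  have "((\<forall>j<m. lmul x (B * B) j = 0) \<and> (\<forall>j<m. lmul x (C - B * A) j = 0)) \<longleftrightarrow> L x \<in> fv.perp h V K0"
    if x: "x \<in> V" for x
  proof -
    have *: "form (C - B * A) x y = - h (L x) y" if "L (L x) = 0" for y
      unfolding form_minus[OF Cc c(2)] form_mult_left[OF B Ac] form_C form_res[OF X0c] that
      by (simp add: form_zero)
    have "(\<forall>j<m. lmul x (C - B * A) j = 0) \<longleftrightarrow> (\<forall>y\<in>V. form (C - B * A) x y = 0)"
      using c(3) Ac by (intro lmul_zero_iff) simp
    then show ?thesis
      unfolding lmul_BB perp_iff using * x LV[of x] by (auto simp: K1_def K2_def)
  qed
  then have "{x \<in> V. (\<forall>j<m. lmul x (B * B) j = 0) \<and> (\<forall>j<m. lmul x (C - B * A) j = 0)}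
      = {x \<in> V. L x \<in> fv.perp h V K0}" by blast
  then show ?thesis
    using append_cols_kernel[OF c(1,3)] dim_preimage[OF perp_K0, of V] dim_K1 by simp
qed

text \<open>As for \<open>rank_N1\<close>, but the second argument is now L y, so orthogonality is
  tested on \<open>K2\<close> only. Just the zeros of the form of \<open>D\<close> matter, which
  covers both signs of BAB^* - CB^* at once.\<close>

lemma rank_N2:
  assumes D: "D \<in> carrier_mat m m"
    and Df: "\<And>x y. (form D x y = 0) \<longleftrightarrow> (form A (L x) (L y) = form C x (L y))"
  shows "rank_mat ((B * B) @\<^sub>c D) + d2 = rank_mat B"
proof -
  have c: "B * B \<in> carrier_mat m m" by (rule mult_carrier_mat[OF B B])
  have "((\<forall>j<m. lmul x (B * B) j = 0) \<and> (\<forall>j<m. lmul x D j = 0)) \<longleftrightarrow> L x \<in> fv.perp h K2 K0"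
    if x: "x \<in> V" for x
  proof -
    have *: "form D x y = 0 \<longleftrightarrow> h (L x) (L y) = 0" if "L (L x) = 0" for y
      unfolding Df form_C form_res[OF X0c] that by (simp add: form_zero)
    have "(\<forall>j<m. lmul x D j = 0) \<longleftrightarrow> (\<forall>y\<in>V. form D x y = 0)"
      using D by (intro lmul_zero_iff) simp
    then show ?thesis
      unfolding lmul_BB perp_iff using * x LV[of x] by (auto simp: K1_def K2_def)
  qed
  then have "{x \<in> V. (\<forall>j<m. lmul x (B * B) j = 0) \<and> (\<forall>j<m. lmul x D j = 0)}
      = {x \<in> V. L x \<in> fv.perp h K2 K0}" by blast
  then show ?thesis
    using append_cols_kernel[OF c D] dim_preimage[OF perp_K0, of K2] dim_K1 by simp
qed

lemma rank_N2a: "rank_mat ((B * B) @\<^sub>c (B * A * mat_adjoint B - C * mat_adjoint B)) + d2 = rank_mat B"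
  and rank_N2b: "rank_mat ((B * B) @\<^sub>c (C * mat_adjoint B - B * A * mat_adjoint B)) + d2 = rank_mat B"
proof -
  have c: "B * A * mat_adjoint B \<in> carrier_mat m m" "C * mat_adjoint B \<in> carrier_mat m m"
    by (intro mult_carrier_mat[of _ m m _ m] B Ac Cc Bs)+
  show "rank_mat ((B * B) @\<^sub>c (B * A * mat_adjoint B - C * mat_adjoint B)) + d2 = rank_mat B"
    by (rule rank_N2[OF minus_carrier_mat[OF c(2)]])
      (simp add: form_minus[OF c] form_BXB[OF Ac] form_mult_adjoint[OF Cc B])
  show "rank_mat ((B * B) @\<^sub>c (C * mat_adjoint B - B * A * mat_adjoint B)) + d2 = rank_mat B"
    by (rule rank_N2[OF minus_carrier_mat[OF c(1)]])
      (auto simp: form_minus[OF c(2,1)] form_BXB[OF Ac] form_mult_adjoint[OF Cc B])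
qed

definition "M1 = four_block_mat A B (mat_adjoint B) (0\<^sub>m m m)"
definition "M2 = four_block_mat (B * A) (B * B) (mat_adjoint B) (0\<^sub>m m m)"
definition "M3 = B * A * mat_adjoint B - B * C - C * mat_adjoint B"

lemma form_adjB: "form (mat_adjoint B) y x = ip m y (L x)" and form_B: "form B x y = ip m (L x) y"
  using B form_adjoint[of B y x] form_as_ip[of B x y] by simp_all

lemma form_M1: "form M1 z z' = form A (top_part m z) (top_part m z') +
    ip m (bot_part m z) (L (top_part m z')) + ip m (L (top_part m z)) (bot_part m z')"
proof -
  have "form (0\<^sub>m m m) x y = 0" for x y by (simp add: form_def lmul_def)
  then show ?thesis
    unfolding M1_def form_four_block[OF Ac B Bs zero_carrier_mat] form_adjB form_B by simp
qed

lemma M1_herm: "M1 \<in> herm_mats (m + m)"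
  unfolding M1_def by (rule herm_mats_four_block[OF A B])

lemma ip_zero: "ip n 0 y = 0" "ip n x 0 = 0"
  by (simp_all add: ip_def)

lemma ip_V_zero:
  assumes "x \<in> V" "ip m x x = 0"
  shows "x = 0"
proof (rule ccontr)
  assume "x \<noteq> 0"
  then have "0 < Re (ip m x x)" by (rule ip_self_pos[OF assms(1)])
  then show False using assms(2) by simp
qed

text \<open>Isotropic for \<open>M1\<close>, whose lower right block is zero; applying
  \<open>pos_perp\<close> to this subspace removes the border.\<close>

definition "bot_space = {z \<in> space (m + m). top_part m z = 0}"

lemma bot_space: "fv.subspace bot_space" "bot_space \<subseteq> space (m + m)" "fv.fd bot_space" "fv.dim bot_space = m"
proof -
  show s: "fv.subspace bot_space"
    using subspace_space[of "m + m"] fv.linmapD[OF linmap_parts(1)[of m]]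
    by (simp add: bot_space_def fv.subspace_def)
  show b: "bot_space \<subseteq> space (m + m)" by (auto simp: bot_space_def)
  show f: "fv.fd bot_space" by (rule fv.fd_mono[OF fd_space s b])
  have "bot_part m ` bot_space = V"
  proof
    show "V \<subseteq> bot_part m ` bot_space"
    proof
      fix y assume y: "y \<in> V"
      have "join m 0 y \<in> bot_space"
        using join_space[of m 0 y] parts_join(1)[OF fv.subspace_0[OF subspace_space], of m y] by (simp add: bot_space_def)
      then show "y \<in> bot_part m ` bot_space" using parts_join(2)[OF y, of 0]
        by (intro image_eqI[of _ _ "join m 0 y"]) simp_all
    qed
  qed (use parts_space in auto)
  moreover have "{z \<in> bot_space. bot_part m z = 0} \<subseteq> fv.span {}"
    using parts_zero by (auto simp: bot_space_def)
  then have "fv.dim {z \<in> bot_space. bot_part m z = 0} = 0" using fv.dim_le_card[of _ "{}"] by fastforce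
  ultimately show "fv.dim bot_space = m"
    using fv.dim_image_kernel[OF linmap_parts(2)[of m] f] dim_space[of m] by simp
qed

lemma dim_cokernel: "fv.dim (fv.perp (ip m) K2 V) = fv.dim K1"
  using dim_ip_perp[OF fds(2) fd_space subspaces(4) order_refl] dim_K1 dim_K2 dim_space[of m] by simp

lemma dim_bot_cokernel: "fv.dim {z \<in> bot_space. bot_part m z \<in> fv.perp (ip m) K2 V} = fv.dim K1"
proof -
  let ?U = "fv.perp (ip m) K2 V" and ?D = "{z \<in> bot_space. bot_part m z \<in> fv.perp (ip m) K2 V}"
  have sU: "fv.subspace ?U" by (rule fv.subspace_perp[OF hermitian_ip subspace_space])
  have s: "fv.subspace ?D"
    using bot_space(1) sU fv.linmapD[OF linmap_parts(2)[of m]] by (simp add: fv.subspace_def)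
  have f: "fv.fd ?D" by (rule fv.fd_mono[OF bot_space(3) s]) blast
  have "bot_part m ` ?D = ?U"
  proof
    show "?U \<subseteq> bot_part m ` ?D"
    proof
      fix y assume y: "y \<in> ?U"
      then have yV: "y \<in> V" by (simp add: fv.perp_def)
      have "join m 0 y \<in> bot_space"
        using join_space[of m 0 y] parts_join(1)[OF fv.subspace_0[OF subspace_space], of m y] by (simp add: bot_space_def)
      then have "join m 0 y \<in> ?D" using y parts_join(2)[OF yV, of 0] by simp
      then show "y \<in> bot_part m ` ?D" using parts_join(2)[OF yV, of 0]
        by (intro image_eqI[of _ _ "join m 0 y"]) simp_all
    qed
  qed (rule image_subsetI, simp)
  moreover have "z = 0" if "z \<in> ?D" "bot_part m z = 0" for z
    using parts_zero[of z m] that by (simp add: bot_space_def)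
  then have "{z \<in> ?D. bot_part m z = 0} \<subseteq> fv.span {}" by auto
  then have "fv.dim {z \<in> ?D. bot_part m z = 0} = 0" using fv.dim_le_card[of _ "{}"] by fastforce
  ultimately show ?thesis
    using fv.dim_image_kernel[OF linmap_parts(2)[of m] f] dim_cokernel by simp
qed

lemma M1_perp:
  "fv.perp (form M1) bot_space (space (m + m)) = {z \<in> space (m + m). top_part m z \<in> K1}"
  "fv.perp (form M1) (space (m + m)) bot_space = {z \<in> bot_space. bot_part m z \<in> fv.perp (ip m) K2 V}"
  "fv.perp (form M1) bot_space bot_space = bot_space"
proof -
  have b: "form M1 k z = ip m (bot_part m k) (L (top_part m z))" if "k \<in> bot_space" for k z
    using that by (simp add: form_M1 bot_space_def form_zero L_zero ip_zero)
  have b': "form M1 z k = ip m (L (top_part m z)) (bot_part m k)" if "k \<in> bot_space" for k z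
    using that by (simp add: form_M1 bot_space_def form_zero L_zero ip_zero)
  show "fv.perp (form M1) bot_space (space (m + m)) = {z \<in> space (m + m). top_part m z \<in> K1}"
  proof (intro equalityI subsetI)
    fix z assume z: "z \<in> fv.perp (form M1) bot_space (space (m + m))"
    \<comment> \<open>Testing orthogonality against the vector with this very bottom part makes its
      squared norm vanish.\<close>
    let ?y = "L (top_part m z)"
    have k: "join m 0 ?y \<in> bot_space"
      using join_space[of m 0 ?y] parts_join(1)[OF fv.subspace_0[OF subspace_space], of m ?y] by (simp add: bot_space_def)
    then have "form M1 (join m 0 ?y) z = 0" using z by (simp add: fv.perp_def)
    then have "ip m ?y ?y = 0" unfolding b[OF k] parts_join(2)[OF LV] .
    then have "?y = 0" by (rule ip_V_zero[OF LV])
    then show "z \<in> {z \<in> space (m + m). top_part m z \<in> K1}"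
      using z parts_space(1)[of m z] by (simp add: K1_def fv.perp_def)
  next
    fix z assume "z \<in> {z \<in> space (m + m). top_part m z \<in> K1}"
    then show "z \<in> fv.perp (form M1) bot_space (space (m + m))"
      by (simp add: fv.perp_def b K1_def ip_zero)
  qed
  show "fv.perp (form M1) (space (m + m)) bot_space = {z \<in> bot_space. bot_part m z \<in> fv.perp (ip m) K2 V}"
  proof (intro equalityI subsetI)
    fix k assume k: "k \<in> fv.perp (form M1) (space (m + m)) bot_space"
    then have kb: "k \<in> bot_space" by (simp add: fv.perp_def)
    have "ip m (L x) (bot_part m k) = 0" if "x \<in> V" for x
    proof -
      have "form M1 (join m x 0) k = 0" using k join_space by (simp add: fv.perp_def)
      then show ?thesis unfolding b'[OF kb] parts_join(1)[OF that] .
    qed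
    then show "k \<in> {z \<in> bot_space. bot_part m z \<in> fv.perp (ip m) K2 V}"
      using kb parts_space(2) by (auto simp: fv.perp_def K2_def)
  next
    fix k assume "k \<in> {z \<in> bot_space. bot_part m z \<in> fv.perp (ip m) K2 V}"
    then show "k \<in> fv.perp (form M1) (space (m + m)) bot_space"
      using parts_space(1) by (auto simp: fv.perp_def b' K2_def)
  qed
  show "fv.perp (form M1) bot_space bot_space = bot_space"
    by (auto simp: fv.perp_def b) (simp add: bot_space_def L_zero ip_zero)
qed

text \<open>In \<open>pos_perp\<close> the isotropic subspace contributes index 0 and radical m,
  while \<open>dim_bot_cokernel\<close> gives the correction \<open>dim K1\<close>; the difference
  is r(B). The complement of \<open>bot_space\<close> only sees top parts in \<open>K1\<close>.
  Stated for \<open>f\<close> and \<open>g\<close> so that it can be used with both signs.\<close>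

lemma bordered_pos:
  assumes f: "fv.hermitian f" and g: "fv.hermitian g"
    and p: "fv.perp f bot_space (space (m + m)) = {z \<in> space (m + m). top_part m z \<in> K1}"
      "fv.perp f (space (m + m)) bot_space = {z \<in> bot_space. bot_part m z \<in> fv.perp (ip m) K2 V}"
      "fv.perp f bot_space bot_space = bot_space"
    and e: "\<And>z. top_part m z \<in> K1 \<Longrightarrow> Re (f z z) = Re (g (top_part m z) (top_part m z))"
  shows "fv.pos f (space (m + m)) = rank_mat B + fv.pos g K1"
proof -
  have "f z z = 0" if "z \<in> bot_space" for z using p(3) that by (auto simp: fv.perp_def)
  then have "fv.nonpos f bot_space" by (simp add: fv.nonpos_def)
  then have 0: "fv.pos f bot_space = 0"
    using fv.pos_le[OF bot_space(3,1) order_refl] by simp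
  let ?N = "{z \<in> space (m + m). top_part m z \<in> K1}"
  have "fv.fd ?N" using fv.fd_perp[OF f fd_space, of bot_space "m + m"] unfolding p(1) .
  then have "fv.pos f ?N = fv.pos g (top_part m ` ?N)"
    by (rule fv.pos_pullback[OF linmap_parts(1) _ g]) (use e in simp)
  also have "top_part m ` ?N = K1"
  proof
    show "K1 \<subseteq> top_part m ` ?N"
    proof
      fix x assume x: "x \<in> K1"
      then have "x \<in> V" using subspaces by blast
      then have "top_part m (join m x 0) = x" by (rule parts_join)
      then show "x \<in> top_part m ` ?N" using x join_space by (intro image_eqI[of _ _ "join m x 0"]) auto
    qed
  qed blast
  finally have "fv.pos f ?N = fv.pos g K1" .
  then show ?thesis
    using fv.pos_perp[OF f fd_space bot_space(1,2)] 0 bot_space(4) dim_bot_cokernel dim_K1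
    unfolding p by simp
qed

text \<open>On \<open>K1\<close> both \<open>X0\<close> terms of \<open>h\<close> vanish, so
  \<open>h\<close> and \<open>A\<close> define the same form there.\<close>

lemma inertia_M1: "i_plus M1 = rank_mat B + fv.pos h K1" "i_minus M1 = rank_mat B + fv.neg h K1"
proof -
  have hM: "fv.hermitian (form M1)" by (rule hermitian_form[OF M1_herm])
  have e: "form M1 z z = h (top_part m z) (top_part m z)" if "top_part m z \<in> K1" for z
    using that by (simp add: form_M1 form_res[OF X0c] K1_def ip_zero form_zero)
  show "i_plus M1 = rank_mat B + fv.pos h K1"
    unfolding inertia_eq(1)[OF M1_herm]
    by (rule bordered_pos[OF hM hh M1_perp]) (simp add: e)
  show "i_minus M1 = rank_mat B + fv.neg h K1"
    unfolding inertia_eq(2)[OF M1_herm]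
    by (rule bordered_pos[OF fv.hermitian_uminus[OF hM] fv.hermitian_uminus[OF hh]])
      (simp_all add: fv.perp_uminus M1_perp e)
qed

lemma rank_M1: "rank_mat M1 = i_plus M1 + i_minus M1"
  by (rule rank_hermitian[OF M1_herm])

text \<open>Because C = B X0 B^*, the matrix \<open>M3\<close> is B times the residual of
  \<open>X0\<close> times B^*; hence its inertia is that of \<open>h\<close> on the range of
  \<open>L\<close>.\<close>

lemma form_M3: "form M3 x y = h (L x) (L y)"
proof -
  have c: "B * A * mat_adjoint B \<in> carrier_mat m m" "B * C \<in> carrier_mat m m" "C * mat_adjoint B \<in> carrier_mat m m"
    "B * A * mat_adjoint B - B * C \<in> carrier_mat m m"
    by (intro minus_carrier_mat mult_carrier_mat[of _ m m _ m] B Ac Cc Bs)+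
  show ?thesis
    unfolding M3_def form_minus[OF c(4,3)] form_minus[OF c(1,2)] form_BXB[OF Ac] form_mult_left[OF B Cc]
      form_mult_adjoint[OF Cc B] form_C form_res[OF X0c] ..
qed

lemma M3_herm: "M3 \<in> herm_mats m"
proof (rule herm_matsI)
  show "M3 \<in> carrier_mat m m" unfolding M3_def
    by (intro minus_carrier_mat mult_carrier_mat[of _ m m _ m] B Ac Cc Bs)
  show "form M3 y x = cnj (form M3 x y)" for x y
    unfolding form_M3 by (rule fv.hermitian_sym[OF hh])
qed

lemma inertia_M3: "i_plus M3 = fv.pos h K2" "i_minus M3 = fv.neg h K2"
  unfolding inertia_eq[OF M3_herm] K2_def
  by (rule fv.pos_pullback[OF linmap_adj fd_space], (rule hh fv.hermitian_uminus[OF hh]), simp add: form_M3)+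

lemma rank_M3: "rank_mat M3 = i_plus M3 + i_minus M3"
  by (rule rank_hermitian[OF M3_herm])

text \<open>The functional \<open>h u\<close> with \<open>u\<close> in \<open>K0\<close> factors through \<open>L\<close> exactly when it kills \<open>K1\<close>, the
  kernel of \<open>L\<close>; this is what makes the second block row of \<open>M2\<close> solvable.\<close>
lemma represent_functional:
  assumes g: "fv.functional g" and z: "\<And>v. v \<in> K1 \<Longrightarrow> g v = 0"
  obtains y where "y \<in> V" "\<And>v. v \<in> V \<Longrightarrow> g v = ip m y (L v)"
proof -
  obtain S where S: "fv.linmap S" "\<And>x. S x \<in> V" "\<And>y. y \<in> L ` V \<Longrightarrow> L (S y) = y"
    using fv.linmap_right_inverse[OF linmap_adj[of B] subspace_space[of m]] by blast
  define y where "y i = (if i < m then cnj (g (S (e_vec i))) else 0)" for i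
  have gS: "fv.functional (\<lambda>w. g (S w))"
    using g fv.linmapD[OF S(1)] by (simp add: fv.functional_def)
  show ?thesis
  proof (rule that)
    show "y \<in> V" by (simp add: y_def space_def)
    fix v assume v: "v \<in> V"
    have "v - S (L v) \<in> K1"
      using v S fv.subspace_diff[OF subspace_space] fv.linmapD[OF linmap_adj[of B]] by (simp add: K1_def)
    then have "g v = g (S (L v))" using z fv.functionalD(5)[OF g, of v "S (L v)"] by simp
    also have "\<dots> = g (S (\<Sum>i<m. cscale (L v i) (e_vec i)))" using space_expand[OF LV[of v]] by simp
    also have "\<dots> = (\<Sum>i<m. L v i * g (S (e_vec i)))" by (simp add: fv.functionalD[OF gS] del: cscale_apply)
    also have "\<dots> = ip m y (L v)" by (simp add: ip_def y_def mult.commute)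
    finally show "g v = ip m y (L v)" .
  qed
qed

text \<open>A pair (x, y) in the left kernel is mapped to u = L x. Here u is in \<open>K0\<close>,
  and a suitable y exists iff the functional of \<open>A\<close> at u factors through
  \<open>L\<close>, that is, iff it kills \<open>K1\<close>; so the image is
  \<open>perp h K1 K0\<close>. The fibre over 0 consists of x in \<open>K1\<close> and y orthogonal
  to \<open>K2\<close>, of dimension \<open>2 * dim K1\<close>.\<close>

lemma rank_M2: "rank_mat M2 + d1 = 2 * rank_mat B"
proof -
  have c: "B * A \<in> carrier_mat m m" "B * B \<in> carrier_mat m m"
    by (intro mult_carrier_mat[of _ m m _ m] B Ac)+
  have cM: "M2 \<in> carrier_mat (m + m) (m + m)" unfolding M2_def using c by simp
  let ?Z = "{z \<in> space (m + m). \<forall>j<m + m. lmul z M2 j = 0}"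
  have l0: "lmul x (0\<^sub>m m m) j = 0" if "j < m" for x j using that by (simp add: lmul_def)
  have Z: "?Z = {z \<in> space (m + m). L (L (top_part m z)) = 0 \<and>
      (\<forall>v\<in>V. form A (L (top_part m z)) v + ip m (bot_part m z) (L v) = 0)}" (is "_ = ?Z'")
  proof -
    have "(\<forall>j<m + m. lmul z M2 j = 0) \<longleftrightarrow> L (L (top_part m z)) = 0 \<and>
      (\<forall>v\<in>V. form A (L (top_part m z)) v + ip m (bot_part m z) (L v) = 0)" for z
    proof -
      let ?x = "top_part m z" and ?y = "bot_part m z"
      have "(\<forall>j<m. lmul ?x (B * A) j + lmul ?y (mat_adjoint B) j = 0) \<longleftrightarrow>
          (\<forall>v\<in>V. form (B * A) ?x v + form (mat_adjoint B) ?y v = 0)"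
      proof
        assume l: "\<forall>v\<in>V. form (B * A) ?x v + form (mat_adjoint B) ?y v = 0"
        show "\<forall>j<m. lmul ?x (B * A) j + lmul ?y (mat_adjoint B) j = 0"
        proof (intro allI impI)
          fix j assume j: "j < m"
          have "form (B * A) ?x (e_vec j) + form (mat_adjoint B) ?y (e_vec j) = 0"
            using l e_vec_space[OF j] by blast
          then show "lmul ?x (B * A) j + lmul ?y (mat_adjoint B) j = 0"
            using j Ac B form_right_e_vec[of j "B * A" ?x] form_right_e_vec[of j "mat_adjoint B" ?y] by simp
        qed
      next
        assume l: "\<forall>j<m. lmul ?x (B * A) j + lmul ?y (mat_adjoint B) j = 0"
        have "form (B * A) ?x v + form (mat_adjoint B) ?y v =
            (\<Sum>j<m. (lmul ?x (B * A) j + lmul ?y (mat_adjoint B) j) * v j)" for v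
          using Ac B by (simp add: form_def distrib_right sum.distrib)
        then show "\<forall>v\<in>V. form (B * A) ?x v + form (mat_adjoint B) ?y v = 0" using l by simp
      qed
      then have 1: "(\<forall>j<m. lmul ?x (B * A) j + lmul ?y (mat_adjoint B) j = 0) \<longleftrightarrow>
          (\<forall>v\<in>V. form A (L ?x) v + ip m ?y (L v) = 0)"
        unfolding form_mult_left[OF B Ac] form_adjB .
      have "(\<forall>j<m + m. lmul z M2 j = 0) \<longleftrightarrow>
          (\<forall>j<m. lmul ?x (B * A) j + lmul ?y (mat_adjoint B) j = 0) \<and> (\<forall>j<m. lmul ?x (B * B) j = 0)"
        unfolding lessThan_add_cases M2_def
        by (simp add: lmul_four_block[OF c Bs zero_carrier_mat] l0)
      then show ?thesis unfolding 1 lmul_BB by (simp only: conj_commute)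
    qed
    then show ?thesis by blast
  qed
  have sZ: "fv.subspace ?Z"
    using subspace_space[of "m + m"] by (simp add: fv.subspace_def lmul_add lmul_scale lmul_zero)
  have fZ: "fv.fd ?Z" by (rule fv.fd_mono[OF fd_space sZ]) blast
  define T where "T z = L (top_part m z)" for z
  have T: "fv.linmap T"
    using fv.linmapD[OF linmap_adj[of B]] fv.linmapD[OF linmap_parts(1)[of m]] by (simp add: fv.linmap_def T_def)
  \<comment> \<open>In particular \<open>h u\<close> and \<open>form A u\<close> agree on
    \<open>K1\<close>, where L v = 0.\<close>
  have hA: "h u v = form A u v - form X0 u (L v)" if "L u = 0" for u v
    using that by (simp add: form_res[OF X0c] form_zero)
  have img: "T ` ?Z = fv.perp h K1 K0"
  proof (intro equalityI subsetI)
    fix u assume "u \<in> T ` ?Z"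
    then obtain z where z: "u = L (top_part m z)" "L u = 0"
      "\<forall>v\<in>V. form A u v + ip m (bot_part m z) (L v) = 0" unfolding Z T_def by blast
    have "u \<in> K0" using z LV parts_space(1)[of m z] by (auto simp: K1_def K2_def)
    moreover have "h u v = 0" if "v \<in> K1" for v
    proof -
      have v: "v \<in> V" "L v = 0" using that by (simp_all add: K1_def)
      have "form A u v + ip m (bot_part m z) (L v) = 0" using z(3) v(1) by blast
      then show ?thesis unfolding hA[OF z(2)] v(2) by (simp add: ip_zero form_zero)
    qed
    ultimately show "u \<in> fv.perp h K1 K0" unfolding perp_iff by blast
  next
    fix u assume "u \<in> fv.perp h K1 K0"
    then have u: "u \<in> K0" "\<And>v. v \<in> K1 \<Longrightarrow> h u v = 0" unfolding perp_iff by auto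
    then obtain x where x: "x \<in> V" "u = L x" "L u = 0" by (auto simp: K1_def K2_def)
    have "fv.functional (\<lambda>v. - form A u v)"
      using functional_form[of A u] by (simp add: fv.functional_def)
    moreover have "- form A u v = 0" if "v \<in> K1" for v
      using u(2)[OF that] that unfolding hA[OF x(3)] by (simp add: K1_def form_zero)
    ultimately obtain y where y: "y \<in> V" "\<And>v. v \<in> V \<Longrightarrow> - form A u v = ip m y (L v)"
      using represent_functional[of "\<lambda>v. - form A u v"] by blast
    have "join m x y \<in> ?Z"
      unfolding Z using join_space parts_join(1)[OF x(1), of y] parts_join(2)[OF y(1), of x] x y(2)[symmetric] by simp
    moreover have "T (join m x y) = u" using parts_join(1)[OF x(1), of y] x(2) by (simp add: T_def)
    ultimately show "u \<in> T ` ?Z" by blast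
  qed
  have ker: "fv.dim {z \<in> ?Z. T z = 0} = fv.dim K1 + fv.dim K1"
  proof -
    let ?D = "{z \<in> ?Z. T z = 0}"
    have D: "?D = {z \<in> space (m + m). top_part m z \<in> K1 \<and> bot_part m z \<in> fv.perp (ip m) K2 V}"
    proof -
      have "y \<in> fv.perp (ip m) K2 V \<longleftrightarrow> (\<forall>v\<in>V. ip m y (L v) = 0)" if "y \<in> V" for y
        unfolding fv.perp_def K2_def using that by (simp add: fv.hermitian_zero_sym[OF hermitian_ip, of m y])
      then have "z \<in> ?D \<longleftrightarrow> z \<in> space (m + m) \<and> top_part m z \<in> K1 \<and> bot_part m z \<in> fv.perp (ip m) K2 V" for z
        unfolding Z T_def using parts_space[of m z]
        by (cases "L (top_part m z) = 0") (simp_all add: K1_def form_zero L_zero)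
      then show ?thesis by blast
    qed
    have sD: "fv.subspace ?D"
      using sZ fv.linmapD[OF T] by (simp add: fv.subspace_def)
    have fD: "fv.fd ?D" by (rule fv.fd_mono[OF fZ sD]) blast
    have "top_part m ` ?D = K1"
    proof
      show "K1 \<subseteq> top_part m ` ?D"
      proof
        fix x assume x: "x \<in> K1"
        then have xV: "x \<in> V" using subspaces by blast
        have "0 \<in> V" "0 \<in> fv.perp (ip m) K2 V"
          using fv.subspace_0[OF subspace_space] by (auto simp: fv.perp_def ip_zero)
        then have "join m x 0 \<in> ?D"
          unfolding D using x join_space parts_join(1)[OF xV, of 0] parts_join(2)[of 0 m x] by simp
        then show "x \<in> top_part m ` ?D" using parts_join(1)[OF xV, of 0]
          by (intro image_eqI[of _ _ "join m x 0"]) simp_all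
      qed
    qed (unfold D, rule image_subsetI, simp)
    moreover have "{z \<in> ?D. top_part m z = 0} = {z \<in> bot_space. bot_part m z \<in> fv.perp (ip m) K2 V}"
      unfolding D using fv.subspace_0[OF subspaces(1)] by (auto simp: bot_space_def)
    ultimately show ?thesis
      using fv.dim_image_kernel[OF linmap_parts(1)[of m] fD] dim_bot_cokernel by simp
  qed
  show ?thesis
    using rank_left_kernel[OF cM] fv.dim_image_kernel[OF T fZ] dim_K1 unfolding img ker by simp
qed

section \<open>Solutions and admissible perturbations\<close>

definition "sols = {X \<in> herm_mats m. B * X * mat_adjoint B = C}"

text \<open>The equation fixes the form of \<open>X\<close> exactly on pairs from the range of
  \<open>L\<close>, and on the three restrictions in question the residual involves no other values
  of it.\<close>

lemma sols_agree:
  assumes "X \<in> sols"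
  shows "fv.agrees h (form (res X)) K1 K2 V"
proof -
  have X: "X \<in> carrier_mat m m" "B * X * mat_adjoint B = C" using assms by (auto simp: sols_def herm_mats_def)
  have e: "form X (L x) (L y) = form X0 (L x) (L y)" for x y
    using form_BXB[OF X(1), of x y] form_C[of x y] unfolding X(2) by simp
  show ?thesis
    unfolding fv.agrees_def form_res[OF X(1)] form_res[OF X0c]
  proof (intro conjI ballI)
    fix x y assume "x \<in> K1" "y \<in> K1"
    then show "form A x y - form X (L x) y - form X x (L y) = form A x y - form X0 (L x) y - form X0 x (L y)"
      by (simp add: K1_def form_zero)
  next
    fix x y assume "x \<in> K2" "y \<in> K2"
    then obtain u v where "x = L u" "y = L v" by (auto simp: K2_def)
    then show "form A x y - form X (L x) y - form X x (L y) = form A x y - form X0 (L x) y - form X0 x (L y)"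
      by (simp only: e)
  next
    fix x y assume x: "x \<in> K0"
    then obtain u where "x = L u" "L x = 0" by (auto simp: K1_def K2_def)
    then show "form A x y - form X (L x) y - form X x (L y) = form A x y - form X0 (L x) y - form X0 x (L y)"
      by (simp only: e form_zero)
  qed
qed

text \<open>With a section \<open>R\<close> of \<open>L\<close>, the form
  \<open>Y u v = - \<theta> (R u) v\<close> undoes the factorisation through \<open>L\<close>, and
  \<open>X\<close> is \<open>X0\<close> plus \<open>Y\<close> plus its adjoint. As
  \<open>\<theta>\<close> kills \<open>K2\<close> on the right, neither \<open>Y\<close> nor its
  adjoint changes B X B^*.\<close>

lemma adm_attained:
  assumes t: "fv.adm K1 K2 \<theta>"
  obtains X where "X \<in> sols" "\<And>x y. x \<in> V \<Longrightarrow> y \<in> V \<Longrightarrow> form (res X) x y = fv.herm_add h \<theta> x y"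
proof -
  obtain R where R: "fv.linmap R" "\<And>x. R x \<in> V" "\<And>y. y \<in> L ` V \<Longrightarrow> L (R y) = y"
    using fv.linmap_right_inverse[OF linmap_adj[of B] subspace_space[of m]] by blast
  have st: "fv.sesq \<theta>" and t1: "\<And>x y. x \<in> K1 \<Longrightarrow> \<theta> x y = 0" and t2: "\<And>x y. y \<in> K2 \<Longrightarrow> \<theta> x y = 0"
    using t by (auto simp: fv.adm_def)
  have l: "fv.functional (\<lambda>u. cnj (\<theta> u v))" for v using st by (simp add: fv.sesq_def)
  \<comment> \<open>\<open>x\<close> and \<open>R (L x)\<close> have the same image under
    \<open>L\<close>, so they differ by an element of \<open>K1\<close>, where
    \<open>\<theta>\<close> vanishes.\<close>
  have tR: "\<theta> (R (L x)) y = \<theta> x y" if "x \<in> V" for x y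
  proof -
    have "x - R (L x) \<in> K1"
      using that R fv.subspace_diff[OF subspace_space] fv.linmapD[OF linmap_adj[of B]] by (simp add: K1_def)
    then have "cnj (\<theta> (x - R (L x)) y) = 0" using t1 by simp
    then have "cnj (\<theta> x y) = cnj (\<theta> (R (L x)) y)" using fv.functionalD(5)[OF l, of x "R (L x)" y] by simp
    then show ?thesis by simp
  qed
  define Y where "Y u v = - \<theta> (R u) v" for u v
  have sY: "fv.sesq Y"
    using st fv.linmapD[OF R(1)] by (simp add: fv.sesq_def fv.functional_def Y_def)
  define \<eta> where "\<eta> = fv.herm_add (form X0) Y"
  have he: "fv.hermitian \<eta>" unfolding \<eta>_def by (rule fv.hermitian_herm_add[OF hermitian_form[OF X0] sY])
  have "fv.functional (\<lambda>x. cnj (\<eta> x y))" for y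
    using fv.hermitian_functional[OF he, of y] unfolding fv.hermitian_sym[OF he, symmetric] .
  then have se: "fv.sesq \<eta>" using fv.hermitian_functional[OF he] by (simp add: fv.sesq_def)
  define X where "X = mat m m (\<lambda>(i, j). \<eta> (e_vec i) (e_vec j))"
  have Xc: "X \<in> carrier_mat m m" by (simp add: X_def)
  have fX: "form X x y = \<eta> x y" if "x \<in> V" "y \<in> V" for x y
    unfolding X_def by (rule form_of_sesq[OF se that])
  have Xh: "X \<in> herm_mats m"
  proof (rule herm_matsI[OF Xc])
    fix x y assume "x \<in> V" "y \<in> V"
    then show "form X y x = cnj (form X x y)"
      using fv.hermitian_sym[OF he, of y x] by (simp add: fX)
  qed
  have "B * X * mat_adjoint B = C"
  proof (rule mat_eq_form)
    show "B * X * mat_adjoint B \<in> carrier_mat m m" by (intro mult_carrier_mat[of _ m m _ m] B Xc Bs)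
    fix x y assume xy: "x \<in> V" "y \<in> V"
    have "L x \<in> K2" "L y \<in> K2" using xy by (auto simp: K2_def)
    then show "form (B * X * mat_adjoint B) x y = form C x y"
      unfolding form_BXB[OF Xc] form_C fX[OF LV LV] by (simp add: \<eta>_def fv.herm_add_def Y_def t2)
  qed (rule Cc)
  then have XS: "X \<in> sols" using Xh by (simp add: sols_def)
  show ?thesis
  proof (rule that[OF XS])
    fix x y assume x: "x \<in> V" and y: "y \<in> V"
    have "L x \<in> K2" "L y \<in> K2" using x y by (auto simp: K2_def)
    then show "form (res X) x y = fv.herm_add h \<theta> x y"
      unfolding form_res[OF Xc] fX[OF LV y] fX[OF x LV] fv.herm_add_def form_res[OF X0c]
      by (simp add: \<eta>_def fv.herm_add_def Y_def t2 tR[OF x] tR[OF y])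
  qed
qed

lemma inertia_res:
  assumes "X \<in> sols"
  shows "i_plus (res X) = fv.pos (form (res X)) V" "i_minus (res X) = fv.neg (form (res X)) V"
    "rank_mat (res X) = i_plus (res X) + i_minus (res X)" "res X \<in> herm_mats m"
proof -
  show "res X \<in> herm_mats m" using assms by (intro res_herm) (simp add: sols_def)
  then show "i_plus (res X) = fv.pos (form (res X)) V" "i_minus (res X) = fv.neg (form (res X)) V"
    "rank_mat (res X) = i_plus (res X) + i_minus (res X)"
    by (rule inertia_eq rank_hermitian)+
qed

lemma inertia_bounds:
  assumes X: "X \<in> sols"
  shows "i_plus (res X) + fv.dim K1 \<le> m + fv.pos h K1" "i_plus (res X) + fv.dim K2 \<le> m + fv.pos h K2"
    "i_minus (res X) + fv.dim K1 \<le> m + fv.neg h K1" "i_minus (res X) + fv.dim K2 \<le> m + fv.neg h K2"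
    "fv.pos h K1 + d1 \<le> i_plus (res X) + d" "fv.pos h K2 + d2 \<le> i_plus (res X) + d"
    "fv.neg h K1 + d1 \<le> i_minus (res X) + d" "fv.neg h K2 + d2 \<le> i_minus (res X) + d"
    "rank_mat (res X) + d \<le> m"
proof -
  note r = inertia_res[OF X]
  have H: "fv.hermitian (form (res X))" by (rule hermitian_form[OF r(4)])
  note ag = sols_agree[OF X]
  note u = fv.hermitian_uminus
  note s = subspaces(1-4) and s' = subspaces(2,1,4,3)
  show "i_plus (res X) + fv.dim K1 \<le> m + fv.pos h K1"
    using fv.pos_upper[OF hh H fd_space s ag] by (simp add: r(1) dim_space)
  show "i_plus (res X) + fv.dim K2 \<le> m + fv.pos h K2"
    using fv.pos_upper[OF hh H fd_space s' fv.agrees_swap[OF ag]] by (simp add: r(1) dim_space)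
  show "i_minus (res X) + fv.dim K1 \<le> m + fv.neg h K1"
    using fv.pos_upper[OF u[OF hh] u[OF H] fd_space s fv.agrees_uminus[OF ag]] by (simp add: r(2) dim_space)
  show "i_minus (res X) + fv.dim K2 \<le> m + fv.neg h K2"
    using fv.pos_upper[OF u[OF hh] u[OF H] fd_space s' fv.agrees_uminus[OF fv.agrees_swap[OF ag]]]
    by (simp add: r(2) dim_space)
  show "fv.pos h K1 + d1 \<le> i_plus (res X) + d"
    using fv.pos_lower[OF hh H fd_space s ag] unfolding r(1) .
  show "fv.pos h K2 + d2 \<le> i_plus (res X) + d"
    using fv.pos_lower[OF hh H fd_space s' fv.agrees_swap[OF ag]] unfolding r(1) Int_commute[of K2 K1] .
  show "fv.neg h K1 + d1 \<le> i_minus (res X) + d"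
    using fv.pos_lower[OF u[OF hh] u[OF H] fd_space s fv.agrees_uminus[OF ag]]
    unfolding r(2) fv.perp_uminus .
  show "fv.neg h K2 + d2 \<le> i_minus (res X) + d"
    using fv.pos_lower[OF u[OF hh] u[OF H] fd_space s' fv.agrees_uminus[OF fv.agrees_swap[OF ag]]]
    unfolding r(2) fv.perp_uminus Int_commute[of K2 K1] .
  show "rank_mat (res X) + d \<le> m"
    using fv.rank_upper[OF hh H fd_space s ag] unfolding r(3) r(1,2) dim_space .
qed

lemma inertia_attained:
  assumes t: "fv.adm K1 K2 \<theta>"
  obtains X where "X \<in> sols" "i_plus (res X) = fv.pos (fv.herm_add h \<theta>) V"
    "i_minus (res X) = fv.neg (fv.herm_add h \<theta>) V"
proof -
  obtain X where X: "X \<in> sols" "\<And>x y. x \<in> V \<Longrightarrow> y \<in> V \<Longrightarrow> form (res X) x y = fv.herm_add h \<theta> x y"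
    using adm_attained[OF t] by blast
  show ?thesis
  proof (rule that[OF X(1)])
    show "i_plus (res X) = fv.pos (fv.herm_add h \<theta>) V"
      unfolding inertia_res(1)[OF X(1)] by (rule fv.pos_cong) (simp only: X(2))
    show "i_minus (res X) = fv.neg (fv.herm_add h \<theta>) V"
      unfolding inertia_res(2)[OF X(1)] by (rule fv.pos_cong) (simp only: X(2))
  qed
qed

lemma min_attained:
  obtains X where "X \<in> sols" "i_plus (res X) + d \<le> max (fv.pos h K1 + d1) (fv.pos h K2 + d2)"
    "i_minus (res X) + d \<le> max (fv.neg h K1 + d1) (fv.neg h K2 + d2)"
proof -
  obtain \<theta> where t: "fv.adm K1 K2 \<theta>"
    "fv.pos (fv.herm_add h \<theta>) V + d \<le> max (fv.pos h K1 + d1) (fv.pos h K2 + d2)"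
    "fv.neg (fv.herm_add h \<theta>) V + d \<le> max (fv.neg h K1 + d1) (fv.neg h K2 + d2)"
    by (rule fv.min_inertia_attained[OF hh fd_space subspaces(1-4)])
  obtain X where "X \<in> sols" "i_plus (res X) = fv.pos (fv.herm_add h \<theta>) V"
    "i_minus (res X) = fv.neg (fv.herm_add h \<theta>) V" by (rule inertia_attained[OF t(1)])
  then show ?thesis using t(2,3) that[of X] by simp
qed

lemma max_plus_attained:
  obtains X where "X \<in> sols"
    "m + fv.pos h K1 \<le> i_plus (res X) + fv.dim K1 \<or> m + fv.pos h K2 \<le> i_plus (res X) + fv.dim K2"
proof -
  obtain \<theta> where t: "fv.adm K1 K2 \<theta>"
    "fv.dim V + fv.pos h K1 \<le> fv.pos (fv.herm_add h \<theta>) V + fv.dim K1 \<or>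
     fv.dim V + fv.pos h K2 \<le> fv.pos (fv.herm_add h \<theta>) V + fv.dim K2"
    by (rule fv.max_pos_attained[OF hh fd_space subspaces(1-4)])
  obtain X where "X \<in> sols" "i_plus (res X) = fv.pos (fv.herm_add h \<theta>) V"
    "i_minus (res X) = fv.neg (fv.herm_add h \<theta>) V" by (rule inertia_attained[OF t(1)])
  then show ?thesis using t(2) that[of X] by (simp add: dim_space)
qed

lemma max_minus_attained:
  obtains X where "X \<in> sols"
    "m + fv.neg h K1 \<le> i_minus (res X) + fv.dim K1 \<or> m + fv.neg h K2 \<le> i_minus (res X) + fv.dim K2"
proof -
  \<comment> \<open>The maximal positive index of the family of \<open>-h\<close> is used; negating
    the perturbation brings it back to the family of \<open>h\<close>.\<close>
  let ?h = "\<lambda>x y. - h x y"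
  obtain \<theta> where t: "fv.adm K1 K2 \<theta>"
    "fv.dim V + fv.pos ?h K1 \<le> fv.pos (fv.herm_add ?h \<theta>) V + fv.dim K1 \<or>
     fv.dim V + fv.pos ?h K2 \<le> fv.pos (fv.herm_add ?h \<theta>) V + fv.dim K2"
    by (rule fv.max_pos_attained[OF fv.hermitian_uminus[OF hh] fd_space subspaces(1-4)])
  obtain X where X: "X \<in> sols" "i_plus (res X) = fv.pos (fv.herm_add h (\<lambda>x y. - \<theta> x y)) V"
    "i_minus (res X) = fv.neg (fv.herm_add h (\<lambda>x y. - \<theta> x y)) V"
    by (rule inertia_attained[OF fv.adm_uminus(1)[OF t(1)]])
  have "i_minus (res X) = fv.pos (fv.herm_add ?h \<theta>) V"
    unfolding X(3) fv.adm_uminus(2)[OF t(1)] by simp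
  then show ?thesis using t(2) that[OF X(1)] by (simp add: dim_space)
qed

text \<open>The rank is m minus the nullity, so a perturbation of minimal nullity is needed;
  \<open>inertia_sum\<close> on \<open>K1\<close> and \<open>K2\<close> rewrites the two nullities
  of restrictions as indices.\<close>

lemma max_rank_attained:
  obtains X where "X \<in> sols"
    "m \<le> rank_mat (res X) + d \<or>
     2 * m + fv.pos h K1 + fv.neg h K1 \<le> rank_mat (res X) + 2 * fv.dim K1 \<or>
     2 * m + fv.pos h K2 + fv.neg h K2 \<le> rank_mat (res X) + 2 * fv.dim K2"
proof -
  obtain \<theta> where t: "fv.adm K1 K2 \<theta>"
    "fv.dim (fv.perp (fv.herm_add h \<theta>) V V) \<le> d \<or>
     fv.dim (fv.perp (fv.herm_add h \<theta>) V V) + fv.dim V \<le> fv.dim K1 + fv.dim (fv.perp h K1 K1) \<or>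
     fv.dim (fv.perp (fv.herm_add h \<theta>) V V) + fv.dim V \<le> fv.dim K2 + fv.dim (fv.perp h K2 K2)"
    by (rule fv.min_nullity_attained[OF hh fd_space subspaces(1-4)])
  obtain X where X: "X \<in> sols" "i_plus (res X) = fv.pos (fv.herm_add h \<theta>) V"
    "i_minus (res X) = fv.neg (fv.herm_add h \<theta>) V" by (rule inertia_attained[OF t(1)])
  have H: "fv.hermitian (fv.herm_add h \<theta>)"
    using t(1) fv.hermitian_herm_add[OF hh] by (simp add: fv.adm_def)
  show ?thesis
    by (rule that[OF X(1)])
      (use t(2) X(2,3) inertia_res(3)[OF X(1)] fv.inertia_sum[OF H fd_space[of m]] dim_space[of m]
        fv.inertia_sum[OF hh fds(1)] fv.inertia_sum[OF hh fds(2)] in linarith)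
qed

abbreviation "N1 \<equiv> (B * B) @\<^sub>c (C - B * A)"

section \<open>The extremal ranks and inertias\<close>

lemmas dims = rank_N1 rank_M1 rank_M2 rank_M3 inertia_M1 inertia_M3 dim_K1 dim_K2 rank_N2a rank_N2b

text \<open>The first entry is m - d, forced by the radical. The other two are the sums of the upper
  bounds for both indices that come from \<open>K1\<close>, where m - dim K1 = r(B), and from
  \<open>K2\<close>, where dim K2 = r(B).\<close>

lemma Max_rank:
  "Max ((\<lambda>X. int (rank_mat (res X))) ` sols) =
     Min {int m + int (rank_mat N1) - int (rank_mat B), int (rank_mat M1),
          2 * int m - 2 * int (rank_mat B) + int (rank_mat M3)}" (is "_ = ?c")
proof -
  obtain X where X: "X \<in> sols"
    "m \<le> rank_mat (res X) + d \<or>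
     2 * m + fv.pos h K1 + fv.neg h K1 \<le> rank_mat (res X) + 2 * fv.dim K1 \<or>
     2 * m + fv.pos h K2 + fv.neg h K2 \<le> rank_mat (res X) + 2 * fv.dim K2"
    by (rule max_rank_attained)
  have c: "?c = min (int m + int (rank_mat N1) - int (rank_mat B))
      (min (int (rank_mat M1)) (2 * int m - 2 * int (rank_mat B) + int (rank_mat M3)))"
    by simp
  have up: "int (rank_mat (res Y)) \<le> ?c" if "Y \<in> sols" for Y
    unfolding c using inertia_bounds[OF that] inertia_res(3)[OF that] dims by linarith
  have "?c \<le> int (rank_mat (res X))"
    unfolding c using X(2) dims by linarith
  then have "int (rank_mat (res X)) = ?c" using up[OF X(1)] by linarith
  then show ?thesis by (rule Max_image_eqI[OF X(1)]) (use up in simp_all)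
qed

lemma int_dims:
  "int (rank_mat N1) = int (rank_mat B) - int d"
  "int (rank_mat M1) = 2 * int (rank_mat B) + int (fv.pos h K1) + int (fv.neg h K1)"
  "int (i_plus M1) = int (rank_mat B) + int (fv.pos h K1)"
  "int (i_minus M1) = int (rank_mat B) + int (fv.neg h K1)"
  "int (rank_mat M2) = 2 * int (rank_mat B) - int d1"
  "int (rank_mat M3) = int (fv.pos h K2) + int (fv.neg h K2)"
  "int (i_plus M3) = int (fv.pos h K2)" "int (i_minus M3) = int (fv.neg h K2)"
  "int (rank_mat ((B * B) @\<^sub>c (B * A * mat_adjoint B - C * mat_adjoint B))) = int (rank_mat B) - int d2"
  "int (rank_mat ((B * B) @\<^sub>c (C * mat_adjoint B - B * A * mat_adjoint B))) = int (rank_mat B) - int d2"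
  using rank_N1 rank_M1 rank_M2 rank_M3 inertia_M1 inertia_M3 rank_N2a rank_N2b by simp_all

text \<open>Put p1 = \<open>pos h K1 + d1 - d\<close>, and likewise p2, n1, n2. One solution attains
  both minimal indices, so the minimal rank is max(p1, p2) + max(n1, n2), the largest of p1 + n1, p2
  + n2, p1 + n2 and n1 + p2, in the order of \<open>?a\<close>, \<open>?b\<close>,
  \<open>?c\<close>, \<open>?e\<close>.\<close>

lemma Min_rank:
  "Min ((\<lambda>X. int (rank_mat (res X))) ` sols) = Max {
     2 * int (rank_mat N1) + int (rank_mat M1) - 2 * int (rank_mat M2),
     2 * int (rank_mat N1) + int (rank_mat M3)
       - 2 * int (rank_mat ((B * B) @\<^sub>c (B * A * mat_adjoint B - C * mat_adjoint B))),
     2 * int (rank_mat N1) + int (i_plus M1) - int (rank_mat M2) + int (i_minus M3)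
       - int (rank_mat ((B * B) @\<^sub>c (C * mat_adjoint B - B * A * mat_adjoint B))),
     2 * int (rank_mat N1) + int (i_minus M1) - int (rank_mat M2) + int (i_plus M3)
       - int (rank_mat ((B * B) @\<^sub>c (C * mat_adjoint B - B * A * mat_adjoint B)))}"
  (is "_ = Max {?a, ?b, ?c, ?e}")
proof -
  obtain X where X: "X \<in> sols" "i_plus (res X) + d \<le> max (fv.pos h K1 + d1) (fv.pos h K2 + d2)"
    "i_minus (res X) + d \<le> max (fv.neg h K1 + d1) (fv.neg h K2 + d2)" by (rule min_attained)
  have c: "Max {?a, ?b, ?c, ?e} = max (max ?a ?b) (max ?c ?e)" by (simp add: max.assoc)
  have abce: "?a = int (fv.pos h K1) + int (fv.neg h K1) + 2 * int d1 - 2 * int d"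
    "?b = int (fv.pos h K2) + int (fv.neg h K2) + 2 * int d2 - 2 * int d"
    "?c = int (fv.pos h K1) + int (fv.neg h K2) + int d1 + int d2 - 2 * int d"
    "?e = int (fv.neg h K1) + int (fv.pos h K2) + int d1 + int d2 - 2 * int d"
    unfolding int_dims by simp_all
  have lo: "max (max ?a ?b) (max ?c ?e) \<le> int (rank_mat (res Y))" if "Y \<in> sols" for Y
  proof -
    note y = inertia_bounds[OF that] inertia_res(3)[OF that]
    show ?thesis
      unfolding abce by (intro max.boundedI) (use y in linarith)+
  qed
  have "(i_plus (res X) + d \<le> fv.pos h K1 + d1 \<or> i_plus (res X) + d \<le> fv.pos h K2 + d2) \<and>
      (i_minus (res X) + d \<le> fv.neg h K1 + d1 \<or> i_minus (res X) + d \<le> fv.neg h K2 + d2)"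
    using X(2,3) unfolding le_max_iff_disj by blast
  then have "int (rank_mat (res X)) \<le> max (max ?a ?b) (max ?c ?e)"
    unfolding le_max_iff_disj abce using inertia_res(3)[OF X(1)] by linarith
  then have "int (rank_mat (res X)) = Max {?a, ?b, ?c, ?e}"
    unfolding c using lo[OF X(1)] by (rule antisym)
  then show ?thesis
  proof (rule Min_image_eqI[OF X(1)])
    show "Max {?a, ?b, ?c, ?e} \<le> int (rank_mat (res Y))" if "Y \<in> sols" for Y
      unfolding c by (rule lo[OF that])
    show "int (rank_mat (res Y)) \<le> int m" if "Y \<in> sols" for Y
      using inertia_bounds(9)[OF that] by simp
  qed
qed

lemma Max_inertia:
  "Max ((\<lambda>X. int (i_plus (res X))) ` sols) = min (int (i_plus M1)) (int m - int (rank_mat B) + int (i_plus M3))"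
  "Max ((\<lambda>X. int (i_minus (res X))) ` sols) = min (int (i_minus M1)) (int m - int (rank_mat B) + int (i_minus M3))"
proof -
  obtain X where X: "X \<in> sols"
    "m + fv.pos h K1 \<le> i_plus (res X) + fv.dim K1 \<or> m + fv.pos h K2 \<le> i_plus (res X) + fv.dim K2"
    by (rule max_plus_attained)
  have up: "int (i_plus (res Y)) \<le> min (int (i_plus M1)) (int m - int (rank_mat B) + int (i_plus M3))"
    if "Y \<in> sols" for Y
    using inertia_bounds[OF that] dims by linarith
  have "int (i_plus (res X)) = min (int (i_plus M1)) (int m - int (rank_mat B) + int (i_plus M3))"
    using up[OF X(1)] X(2) dims by linarith
  then show "Max ((\<lambda>X. int (i_plus (res X))) ` sols) =
      min (int (i_plus M1)) (int m - int (rank_mat B) + int (i_plus M3))"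
    by (rule Max_image_eqI[OF X(1)]) (use up in simp_all)
next
  obtain X where X: "X \<in> sols"
    "m + fv.neg h K1 \<le> i_minus (res X) + fv.dim K1 \<or> m + fv.neg h K2 \<le> i_minus (res X) + fv.dim K2"
    by (rule max_minus_attained)
  have up: "int (i_minus (res Y)) \<le> min (int (i_minus M1)) (int m - int (rank_mat B) + int (i_minus M3))"
    if "Y \<in> sols" for Y
    using inertia_bounds[OF that] dims by linarith
  have "int (i_minus (res X)) = min (int (i_minus M1)) (int m - int (rank_mat B) + int (i_minus M3))"
    using up[OF X(1)] X(2) dims by linarith
  then show "Max ((\<lambda>X. int (i_minus (res X))) ` sols) =
      min (int (i_minus M1)) (int m - int (rank_mat B) + int (i_minus M3))"
    by (rule Max_image_eqI[OF X(1)]) (use up in simp_all)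
qed

lemma Min_inertia:
  "Min ((\<lambda>X. int (i_plus (res X))) ` sols) = int (rank_mat N1) +
     max (int (i_plus M1) - int (rank_mat M2))
       (int (i_plus M3) - int (rank_mat ((B * B) @\<^sub>c (C * mat_adjoint B - B * A * mat_adjoint B))))"
    (is "_ = ?p")
  "Min ((\<lambda>X. int (i_minus (res X))) ` sols) = int (rank_mat N1) +
     max (int (i_minus M1) - int (rank_mat M2))
       (int (i_minus M3) - int (rank_mat ((B * B) @\<^sub>c (C * mat_adjoint B - B * A * mat_adjoint B))))"
    (is "_ = ?n")
proof -
  obtain X where X: "X \<in> sols" "i_plus (res X) + d \<le> max (fv.pos h K1 + d1) (fv.pos h K2 + d2)"
    "i_minus (res X) + d \<le> max (fv.neg h K1 + d1) (fv.neg h K2 + d2)" by (rule min_attained)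
  have lo: "?p \<le> int (i_plus (res Y))" "?n \<le> int (i_minus (res Y))"
    "int (i_plus (res Y)) \<le> int m" "int (i_minus (res Y)) \<le> int m" if "Y \<in> sols" for Y
    using inertia_bounds[OF that] inertia_res(3)[OF that] dims by linarith+
  have "int (i_plus (res X)) \<le> ?p" using X(2) dims by linarith
  then have "int (i_plus (res X)) = ?p" using lo(1)[OF X(1)] by linarith
  then show "Min ((\<lambda>X. int (i_plus (res X))) ` sols) = ?p"
    by (rule Min_image_eqI[OF X(1)]) (fact lo)+
  have "int (i_minus (res X)) \<le> ?n" using X(3) dims by linarith
  then have "int (i_minus (res X)) = ?n" using lo(2)[OF X(1)] by linarith
  then show "Min ((\<lambda>X. int (i_minus (res X))) ` sols) = ?n"
    by (rule Min_image_eqI[OF X(1)]) (fact lo)+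
qed

end

theorem theorem6p1:
  fixes m :: nat and A B C M1 M2 M3 :: "complex mat" and S :: "complex mat set"
    and s1 s2 s3 s4 :: int
  assumes A: "A \<in> herm_mats m"
    and C: "C \<in> herm_mats m"
    and B: "B \<in> carrier_mat m m"
    and M1: "M1 = four_block_mat A B (mat_adjoint B) (0\<^sub>m m m)"
    and M2: "M2 = four_block_mat (B * A) (B * B) (mat_adjoint B) (0\<^sub>m m m)"
    and M3: "M3 = B * A * mat_adjoint B - B * C - C * mat_adjoint B"
    and S: "S = {X \<in> herm_mats m. B * X * mat_adjoint B = C}"
    and solvable: "S \<noteq> {}"
    and s1: "s1 = 2 * int (rank_mat ((B * B) @\<^sub>c (C - B * A))) + int (rank_mat M1)
                  - 2 * int (rank_mat M2)"
    and s2: "s2 = 2 * int (rank_mat ((B * B) @\<^sub>c (C - B * A))) + int (rank_mat M3)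
                  - 2 * int (rank_mat ((B * B) @\<^sub>c (B * A * mat_adjoint B - C * mat_adjoint B)))"
    and s3: "s3 = 2 * int (rank_mat ((B * B) @\<^sub>c (C - B * A))) + int (i_plus M1)
                  - int (rank_mat M2) + int (i_minus M3)
                  - int (rank_mat ((B * B) @\<^sub>c (C * mat_adjoint B - B * A * mat_adjoint B)))"
    and s4: "s4 = 2 * int (rank_mat ((B * B) @\<^sub>c (C - B * A))) + int (i_minus M1)
                  - int (rank_mat M2) + int (i_plus M3)
                  - int (rank_mat ((B * B) @\<^sub>c (C * mat_adjoint B - B * A * mat_adjoint B)))"
  shows "(Max ((\<lambda>X. int (rank_mat (A - B * X - X * mat_adjoint B))) ` S) =
           Min {int m + int (rank_mat ((B * B) @\<^sub>c (C - B * A))) - int (rank_mat B),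
                int (rank_mat M1),
                2 * int m - 2 * int (rank_mat B) + int (rank_mat M3)})
       \<and> (Min ((\<lambda>X. int (rank_mat (A - B * X - X * mat_adjoint B))) ` S) =
           Max {s1, s2, s3, s4})
       \<and> (\<forall>i \<in> {i_plus, i_minus}.
           Max ((\<lambda>X. int (i (A - B * X - X * mat_adjoint B))) ` S) =
           min (int (i M1)) (int m - int (rank_mat B) + int (i M3)))
       \<and> (\<forall>i \<in> {i_plus, i_minus}.
           Min ((\<lambda>X. int (i (A - B * X - X * mat_adjoint B))) ` S) =
           int (rank_mat ((B * B) @\<^sub>c (C - B * A)))
           + max (int (i M1) - int (rank_mat M2))
                 (int (i M3) - int (rank_mat ((B * B) @\<^sub>c (C * mat_adjoint B - B * A * mat_adjoint B)))))"
proof -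
  obtain X0 where X0: "X0 \<in> herm_mats m" "B * X0 * mat_adjoint B = C"
    using solvable unfolding S by blast
  interpret E: hermitian_equation m A B X0
    by (rule hermitian_equation.intro[OF A B X0(1)])
  \<comment> \<open>Identifies the right-hand side built from \<open>X0\<close> with the given one;
    any solution may serve as \<open>X0\<close>, since the final formulas no longer mention
    it.\<close>
  have CE: "E.C = C" unfolding E.C_def by (rule X0(2))
  have e: "E.sols = S" "E.M1 = M1" "E.M2 = M2" "E.M3 = M3"
    unfolding E.sols_def E.M1_def E.M2_def E.M3_def CE S M1 M2 M3 by (rule refl)+
  note parts = E.Max_rank[unfolded e CE E.res_def] E.Min_rank[unfolded e CE E.res_def]
    E.Max_inertia[unfolded e CE E.res_def] E.Min_inertia[unfolded e CE E.res_def]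
  show ?thesis
    unfolding s1 s2 s3 s4
  proof (intro conjI ballI)
    fix i assume "i \<in> {i_plus, i_minus}"
    then consider "i = i_plus" | "i = i_minus" by blast
    then show "Max ((\<lambda>X. int (i (A - B * X - X * mat_adjoint B))) ` S) =
        min (int (i M1)) (int m - int (rank_mat B) + int (i M3))"
      by cases (simp_all only: parts(3,4))
  next
    fix i assume "i \<in> {i_plus, i_minus}"
    then consider "i = i_plus" | "i = i_minus" by blast
    then show "Min ((\<lambda>X. int (i (A - B * X - X * mat_adjoint B))) ` S) =
        int (rank_mat ((B * B) @\<^sub>c (C - B * A))) + max (int (i M1) - int (rank_mat M2))
          (int (i M3) - int (rank_mat ((B * B) @\<^sub>c (C * mat_adjoint B - B * A * mat_adjoint B))))"
      by cases (simp_all only: parts(5,6))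
  qed (fact parts(1,2))+
qed

end
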